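(* Let $d\in\mathbb{N}$, $\mu\in\mathbb{R}^d\setminus\{\mathbf{0}\}$, $\Sigma$ a symmetric non-negative definite $d\times d$ matrix, $B$ a standard $d$-dimensional Brownian motion, and $X(t):=\mu t+\Sigma^{1/2}B(t)$, $t\ge0$. Then almost surely the sequence of functions $(t\mapsto\psi_n(X(nt)))_{t\in[0,1]}$, $n\in\mathbb{N}$, in $\mathcal{C}_d^0$ is relatively compact, and its set of limit points is $W_{d,\mu,\Sigma}$.
   Context: Fix an orthonormal basis $e_1,\ldots,e_d$ of $\mathbb{R}^d$ with $e_1=\mu/\|\mu\|$ and write vectors in coordinates with respect to it. $\Sigma^{1/2}$ is the symmetric non-negative definite square root. $\ell(n):=1$ for $n\in\{0,1,2\}$ and $\ell(n):=\sqrt{2n\log\log n}$ for $n\ge3$. $\psi_n(x_1,\ldots,x_d):=(x_1/n,x_2/\ell(n),\ldots,x_d/\ell(n))$. $\mathcal{C}_d^0$ is the space of continuous $f:[0,1]\to\mathbb{R}^d$ with $f(0)=\mathbf{0}$, with the uniform metric $\rho_\infty(f,g)=\sup_{t}\|f(t)-g(t)\|$. $\Sigma_{\mu^\perp}$ is the $(d-1)\times(d-1)$ matrix with entries $(\Sigma_{\mu^\perp})_{ij}=e_{i+1}^\top\Sigma e_{j+1}$. $U_{d-1}$ is the set of $f:[0,1]\to\mathbb{R}^{d-1}$ with $f(0)=\mathbf{0}$, absolutely continuous components, and $\int_0^1\|f'(s)\|^2ds\le1$. $I_\mu(t):=\|\mu\|t$. For $d\ge2$, $W_{d,\mu,\Sigma}:=\{t\mapsto(I_\mu(t),\Sigma_{\mu^\perp}^{1/2}f(t)):f\in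 U_{d-1}\}$; for $d=1$, $W_{1,\mu,\Sigma}:=\{I_\mu\}$. *)

theory Defs
  imports "HOL-Analysis.Analysis" "HOL-Probability.Probability"
begin

definition std_brownian_motion :: "'w measure \<Rightarrow> (real \<Rightarrow> 'w \<Rightarrow> real^'d) \<Rightarrow> bool" where
  "std_brownian_motion M B \<longleftrightarrow>
     prob_space M \<and>
     (\<forall>t\<ge>0. B t \<in> borel_measurable M) \<and>
     (AE \<omega> in M. B 0 \<omega> = 0) \<and>
     (AE \<omega> in M. continuous_on {0..} (\<lambda>t. B t \<omega>)) \<and>
     (\<forall>s t (i::'d). 0 \<le> s \<and> s < t \<longrightarrow>
        distributed M lborel (\<lambda>\<omega>. (B t \<omega> - B s \<omega>) $ i) (\<lambda>x. ennreal (normal_density 0 (sqrt (t - s)) x))) \<and>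
     (\<forall>(tt::nat \<Rightarrow> real) n. 0 \<le> tt 0 \<and> strict_mono tt \<longrightarrow>
        prob_space.indep_vars M (\<lambda>_. borel)
          (\<lambda>(k, i::'d) \<omega>. (B (tt (Suc k)) \<omega> - B (tt k) \<omega>) $ i) ({..<n} \<times> UNIV))"

definition psd_matrix :: "real^'n^'n \<Rightarrow> bool" where
  "psd_matrix A \<longleftrightarrow> transpose A = A \<and> (\<forall>x. 0 \<le> x \<bullet> (A *v x))"

definition matrix_sqrt :: "real^'n^'n \<Rightarrow> real^'n^'n" where
  "matrix_sqrt A = (THE S. psd_matrix S \<and> S ** S = A)"

definition ell :: "nat \<Rightarrow> real" where
  "ell n = (if n \<le> 2 then 1 else sqrt (2 * real n * ln (ln (real n))))"

text \<open>Coordinates with respect to the orthonormal basis e (e i0 = mu/|mu| is the first vector).\<close>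
definition coords :: "('d \<Rightarrow> real^'d) \<Rightarrow> real^'d \<Rightarrow> real^'d" where
  "coords e x = (\<chi> i. x \<bullet> e i)"

definition psi :: "'d \<Rightarrow> nat \<Rightarrow> real^'d \<Rightarrow> real^'d" where
  "psi i0 n x = (\<chi> i. if i = i0 then x $ i / real n else x $ i / ell n)"

text \<open>Continuous functions on [0,1] (extensional: undefined outside [0,1]) vanishing at 0,
  with the sup metric.\<close>
definition C0 :: "(real \<Rightarrow> real^'d) metric" where
  "C0 = submetric (cfunspace (top_of_set {0..1}) euclidean_metric) {f. f 0 = 0}"

definition relatively_compact_in :: "'a metric \<Rightarrow> 'a set \<Rightarrow> bool" where
  "relatively_compact_in m S \<longleftrightarrow> S \<subseteq> mspace m \<and>
     compactin (mtopology_of m) ((mtopology_of m) closure_of S)"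

definition seq_limit_points :: "'a metric \<Rightarrow> (nat \<Rightarrow> 'a) \<Rightarrow> 'a set" where
  "seq_limit_points m g = {f \<in> mspace m. \<exists>r. strict_mono r \<and>
      limitin (mtopology_of m) (g \<circ> r) f sequentially}"

definition abs_continuous_on_interval :: "real \<Rightarrow> real \<Rightarrow> (real \<Rightarrow> real) \<Rightarrow> bool" where
  "abs_continuous_on_interval a b h \<longleftrightarrow>
     (\<forall>\<epsilon>>0. \<exists>\<delta>>0. \<forall>(n::nat) (l::nat \<Rightarrow> real) (r::nat \<Rightarrow> real).
        (\<forall>k<n. a \<le> l k \<and> l k < r k \<and> r k \<le> b) \<and>
        (\<forall>j<n. \<forall>k<n. j \<noteq> k \<longrightarrow> {l j<..<r j} \<inter> {l k<..<r k} = {}) \<and>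
        (\<Sum>k<n. r k - l k) < \<delta> \<longrightarrow>
        (\<Sum>k<n. \<bar>h (r k) - h (l k)\<bar>) < \<epsilon>)"

text \<open>U_{d-1}: the (d-1)-dimensional space is represented as the vectors in real^'d whose
  coordinate i0 vanishes (coordinates indexed by the remaining d-1 indices).\<close>
definition U_perp :: "'d \<Rightarrow> (real \<Rightarrow> real^'d) set" where
  "U_perp i0 = {f. f 0 = 0 \<and> (\<forall>t. f t $ i0 = 0) \<and>
      (\<forall>i. abs_continuous_on_interval 0 1 (\<lambda>t. f t $ i)) \<and>
      (\<exists>f'. (AE s in lborel. s \<in> {0..1} \<longrightarrow> (f has_vector_derivative f' s) (at s)) \<and>
            (\<integral>\<^sup>+ s. ennreal ((norm (f' s))\<^sup>2) * indicator {0..1} s \<partial>lborel) \<le> 1)}"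

definition Sigma_perp :: "('d \<Rightarrow> real^'d) \<Rightarrow> 'd \<Rightarrow> real^'d^'d \<Rightarrow> real^'d^'d" where
  "Sigma_perp e i0 \<Sigma> = (\<chi> i j. if i \<noteq> i0 \<and> j \<noteq> i0 then e i \<bullet> (\<Sigma> *v e j) else 0)"

definition W_set :: "('d \<Rightarrow> real^'d) \<Rightarrow> 'd \<Rightarrow> real^'d \<Rightarrow> real^'d^'d \<Rightarrow> (real \<Rightarrow> real^'d) set" where
  "W_set e i0 \<mu> \<Sigma> =
     (if CARD('d) = 1
      then {restrict (\<lambda>t. \<chi> i. if i = i0 then norm \<mu> * t else 0) {0..1}}
      else {restrict (\<lambda>t. (\<chi> i. if i = i0 then norm \<mu> * t else 0)
                          + matrix_sqrt (Sigma_perp e i0 \<Sigma>) *v f t) {0..1} | f. f \<in> U_perp i0})"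

end

(* The paths B(nt)/sqrt(2n log log n) obey Strassen's law: they are relatively compact and cluster
   exactly at the paths of energy at most one. Applying the linear map Sigma^(1/2) and reading the
   coordinates orthogonal to mu gives an image of that unit ball, which depends only on the Gram
   matrix Sigma_perp; in the direction of mu the noise is of order sqrt(n log log n) = o(n) and
   only the drift survives.

   A continuous path has energy at most one iff all its dyadic energies
   2^l sum_j |f((j+1)/2^l) - f(j/2^l)|^2 are at most one: the difference quotients form an
   L^2-bounded martingale, whose limit is the derivative. So everything reduces to dyadic increments.
   (1) A union bound on increments of all levels at the scales 2^k yields an equicontinuity bound.
   (2) Chernoff's bound for chi-square variables and the first Borel--Cantelli lemma bound each dyadic
       energy at the scales lambda^k, and by (1) at all scales once lambda is near one; with the
       Arzela--Ascoli theorem this shows relative compactness and the upper bound on the limit set.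
   (3) At the scales 2^(lq) the increments over the dyadic intervals other than the first belong to
       independent blocks, and the probability of following a given path of energy at most one is at
       least c/q; the second Borel--Cantelli lemma applies, and (1) controls the first interval. *)

theory Submission
  imports Defs "HOL-Complex_Analysis.Great_Picard" "HOL-Real_Asymp.Real_Asymp"
begin

section \<open>Spectral theorem and square roots of symmetric matrices\<close>

text \<open>A dyadic energy involves finitely many values of the path, so it passes to pointwise
  limits; derivatives enter only when the limit set is compared with \<open>W_set\<close>.

  The exceptional null set must not depend on the target path or on the tolerances, which form an
  uncountable family. Hence ratios and tolerances have the form 1 + 1/(q+1) and 1/(p+1), and
  prescribed increments are rational, rounded toward zero so that their energy stays at most one.
  The locale \<open>strassen_path\<close> records the resulting countably many properties of one
  fixed path; its consequences are deterministic.

  The dependence on the Gram matrix comes from the polar decomposition: if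
  \<open>S ** S = A ** transpose A\<close>, contractions turn \<open>A\<close> into \<open>S\<close>
  and back, and a contraction never raises a dyadic energy.

  The constants descend from the bound 6 (3/4)^j on increments of level j: chaining multiplies 6 by
  7, passing from powers of 2 to all scales doubles 42 to 84, and two steps of length at most 1/2
  give the uniform bound 126.\<close>

lemma quadratic_nonneg_linear_zero:
  fixes b q :: real
  assumes "\<And>t. 0 \<le> 2 * t * b + t\<^sup>2 * q"
  shows "b = 0"
proof (rule ccontr)
  assume "b \<noteq> 0"
  \<comment> \<open>At the point -b/c the value is b^2 (q - 2c)/c^2, which is negative as soon as 0
    < c and q < 2c.\<close>
  define c where "c = \<bar>q\<bar> + 1"
  have c: "c > 0" "q < c" by (auto simp: c_def)
  have "0 \<le> 2 * (- b / c) * b + (- b / c)\<^sup>2 * q" by (rule assms)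
  also have "\<dots> = b\<^sup>2 * (q - 2 * c) / c\<^sup>2" using c by (simp add: field_simps power2_eq_square)
  also have "\<dots> < 0" using c \<open>b \<noteq> 0\<close> by (intro divide_neg_pos mult_pos_neg) auto
  finally show False by simp
qed

lemma symmetric_inner_swap:
  fixes A :: "real^'n^'n"
  assumes "transpose A = A"
  shows "x \<bullet> (A *v y) = (A *v x) \<bullet> y"
  by (metis assms dot_lmul_matrix matrix_vector_mult_def transpose_matrix_vector)

lemma symmetricI:
  fixes A :: "real^'n^'n"
  assumes "\<And>x y. x \<bullet> (A *v y) = (A *v x) \<bullet> y"
  shows "transpose A = A"
  using assms[of "axis i 1" "axis j 1" for i j]
  by (simp add: vec_eq_iff transpose_def inner_axis inner_axis' matrix_vector_mult_basis column_def)

text \<open>First-order condition at a minimum: on \<open>V\<close> the form is nonnegative and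
  attains 0 at \<open>u\<close>, so its first variation in every direction \<open>w\<close> of
  \<open>V\<close> vanishes.\<close>

lemma form_zero_imp_orthogonal:
  fixes A :: "real^'n^'n"
  assumes sym: "transpose A = A" and V: "subspace V"
    and nn: "\<And>x. x \<in> V \<Longrightarrow> 0 \<le> x \<bullet> (A *v x)"
    and u: "u \<in> V" "u \<bullet> (A *v u) = 0" and w: "w \<in> V"
  shows "w \<bullet> (A *v u) = 0"
proof (rule quadratic_nonneg_linear_zero[where q = "w \<bullet> (A *v w)"])
  fix t :: real
  have "u + t *\<^sub>R w \<in> V" using V u w by (simp add: subspace_add subspace_scale)
  from nn[OF this] have "0 \<le> (u + t *\<^sub>R w) \<bullet> (A *v (u + t *\<^sub>R w))" .
  also have "\<dots> = u \<bullet> (A *v u) + t * (u \<bullet> (A *v w)) + t * (w \<bullet> (A *v u)) + t * t * (w \<bullet> (A *v w))"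
    by (simp add: matrix_vector_right_distrib matrix_vector_mult_scaleR inner_add_left inner_add_right algebra_simps)
  also have "u \<bullet> (A *v w) = w \<bullet> (A *v u)"
    by (simp add: symmetric_inner_swap[OF sym, of u] inner_commute)
  finally show "0 \<le> 2 * t * (w \<bullet> (A *v u)) + t\<^sup>2 * (w \<bullet> (A *v w))"
    using u by (simp add: power2_eq_square algebra_simps)
qed

lemma psd_form_zero:
  fixes A :: "real^'n^'n"
  assumes "psd_matrix A" "u \<bullet> (A *v u) = 0"
  shows "A *v u = 0"
proof -
  have "(A *v u) \<bullet> (A *v u) = 0"
    by (rule form_zero_imp_orthogonal[of A UNIV]) (use assms in \<open>auto simp: psd_matrix_def\<close>)
  then show ?thesis by simp
qed

text \<open>Let \<open>u\<close> maximise the quadratic form on the unit sphere of \<open>V\<close>,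
  with value c. The form of \<open>D = c - A\<close> is nonnegative on \<open>V\<close> and zero at
  \<open>u\<close>, so \<open>D *v u\<close> is orthogonal to \<open>V\<close>; as it also lies in
  \<open>V\<close>, it is zero. The invariant subspace \<open>V\<close> prepares the induction in
  the spectral theorem.\<close>

lemma symmetric_eigenvector:
  fixes A :: "real^'n^'n"
  assumes sym: "transpose A = A" and V: "subspace V" and inv: "\<And>x. x \<in> V \<Longrightarrow> A *v x \<in> V"
    and ne: "V \<noteq> {0}"
  obtains u where "u \<in> V" "norm u = 1" "A *v u = (u \<bullet> (A *v u)) *\<^sub>R u"
proof -
  define S where "S = V \<inter> sphere 0 1"
  from ne V obtain z where z: "z \<in> V" "z \<noteq> 0" using subspace_0 by blast
  have "compact S" unfolding S_def using V by (intro closed_Int_compact closed_subspace) auto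
  moreover have "z /\<^sub>R norm z \<in> S" using z V by (auto simp: S_def subspace_scale)
  moreover have "continuous_on S (\<lambda>x. x \<bullet> (A *v x))"
    by (intro continuous_intros linear_continuous_on_compose[OF _ matrix_vector_mul_linear])
  ultimately obtain u where u: "u \<in> S" "\<And>y. y \<in> S \<Longrightarrow> y \<bullet> (A *v y) \<le> u \<bullet> (A *v u)"
    using continuous_attains_sup[of S "\<lambda>x. x \<bullet> (A *v x)"] by blast
  define c where "c = u \<bullet> (A *v u)"
  define D where "D = c *\<^sub>R mat 1 - A"
  have Dv: "D *v x = c *\<^sub>R x - A *v x" for x
    by (simp add: D_def matrix_vector_mult_diff_rdistrib scaleR_matrix_vector_assoc[symmetric])
  have symD: "transpose D = D"
    using sym by (simp add: D_def transpose_def vec_eq_iff mat_def) 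
  have nn: "0 \<le> x \<bullet> (D *v x)" if "x \<in> V" for x
  proof (cases "x = 0")
    case False
    then have "x /\<^sub>R norm x \<in> S" using that V by (auto simp: S_def subspace_scale)
    from u(2)[OF this] have "(x \<bullet> (A *v x)) / (norm x)\<^sup>2 \<le> c"
      by (simp add: c_def matrix_vector_mult_scaleR power2_eq_square divide_inverse mult_ac)
    then have "x \<bullet> (A *v x) \<le> c * (norm x)\<^sup>2" using False by (simp add: field_simps)
    then show ?thesis by (simp add: Dv inner_diff_right power2_norm_eq_inner)
  qed simp
  have uV: "u \<in> V" "norm u = 1" using u by (auto simp: S_def)
  then have "u \<bullet> u = 1" by (simp add: norm_eq_1)
  then have z0: "u \<bullet> (D *v u) = 0" by (simp add: Dv inner_diff_right c_def)
  have "D *v u \<in> V" unfolding Dv using V uV inv by (simp add: subspace_diff subspace_scale)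
  then have "(D *v u) \<bullet> (D *v u) = 0"
    using form_zero_imp_orthogonal[OF symD V nn uV(1) z0] by blast
  then have "A *v u = c *\<^sub>R u" by (simp add: Dv)
  with uV that show ?thesis by (simp add: c_def)
qed

text \<open>Induction on the dimension of an invariant subspace: split off a unit eigenvector; by
  symmetry its orthogonal complement is invariant again. Eigenvalues appear as Rayleigh quotients
  \<open>b \<bullet> (A *v b)\<close>, so no eigenvalue function has to be carried along.\<close>

theorem symmetric_spectral:
  fixes A :: "real^'n^'n"
  assumes sym: "transpose A = A"
  obtains B where "finite B" "pairwise orthogonal B" "\<And>b. b \<in> B \<Longrightarrow> norm b = 1"
    "span B = UNIV" "\<And>b. b \<in> B \<Longrightarrow> A *v b = (b \<bullet> (A *v b)) *\<^sub>R b"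
proof -
  have "\<exists>B. finite B \<and> pairwise orthogonal B \<and> (\<forall>b\<in>B. norm b = 1) \<and> span B = V \<and>
          (\<forall>b\<in>B. A *v b = (b \<bullet> (A *v b)) *\<^sub>R b)"
    if "subspace V" "\<And>x. x \<in> V \<Longrightarrow> A *v x \<in> V" for V
    using that
  proof (induction "dim V" arbitrary: V rule: less_induct)
    case less
    show ?case
    proof (cases "V = {0}")
      case True
      then show ?thesis by (intro exI[of _ "{}"]) auto
    next
      case False
      then obtain u where u: "u \<in> V" "norm u = 1" "A *v u = (u \<bullet> (A *v u)) *\<^sub>R u"
        using symmetric_eigenvector[OF sym less.prems] by blast
      define V' where "V' = {x \<in> V. u \<bullet> x = 0}"
      have sub: "subspace V'" using less.prems(1)
        unfolding V'_def subspace_def by (auto simp: inner_add_right)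
      have "u \<bullet> (A *v x) = 0" if "u \<bullet> x = 0" for x
        using symmetric_inner_swap[OF sym, of u x] u(3) that
        by (metis inner_scaleR_left mult_zero_right)
      then have inv: "A *v x \<in> V'" if "x \<in> V'" for x
        using that less.prems(2) by (auto simp: V'_def)
      have uu: "u \<bullet> u = 1" using u by (simp add: norm_eq_1)
      have "u \<notin> V'" "V' \<subseteq> V" using uu by (auto simp: V'_def)
      then have "V' \<subset> V" using u by blast
      then have "dim V' < dim V"
        using sub less.prems(1) by (metis dim_psubset span_eq_iff)
      from less.hyps[OF this sub inv] obtain B where B: "finite B" "pairwise orthogonal B"
        "\<forall>b\<in>B. norm b = 1" "span B = V'" "\<forall>b\<in>B. A *v b = (b \<bullet> (A *v b)) *\<^sub>R b"
        by blast
      have BV: "B \<subseteq> V'" using B(4) span_superset by blast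
      have "pairwise orthogonal (insert u B)"
        using B(2) BV by (auto simp: pairwise_insert orthogonal_def V'_def inner_commute)
      moreover have "span (insert u B) = V"
      proof
        show "span (insert u B) \<subseteq> V"
          using BV u less.prems(1) by (intro span_minimal) (auto simp: V'_def)
        show "V \<subseteq> span (insert u B)"
        proof
          fix x assume "x \<in> V"
          then have "x - (u \<bullet> x) *\<^sub>R u \<in> V'"
            using u uu less.prems(1) by (auto simp: V'_def inner_diff_right subspace_diff subspace_scale)
          then have "x - (u \<bullet> x) *\<^sub>R u \<in> span (insert u B)"
            using B(4) span_mono[of B "insert u B"] by auto
          then show "x \<in> span (insert u B)"
            using span_add[OF _ span_scale[OF span_base[of u "insert u B"]], of "x - (u \<bullet> x) *\<^sub>R u" "u \<bullet> x"] by simp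
        qed
      qed
      ultimately show ?thesis using B u by (intro exI[of _ "insert u B"]) auto
    qed
  qed
  from this[of UNIV] show ?thesis using that by auto
qed

lemma orthonormal_inner:
  assumes "pairwise orthogonal B" "\<And>b. b \<in> B \<Longrightarrow> norm b = 1" "b \<in> B" "c \<in> B"
  shows "b \<bullet> c = (if b = c then 1 else 0)"
  using assms by (auto simp: pairwise_def orthogonal_def norm_eq_1)

lemma orthonormal_norm_square:
  fixes B :: "'a::real_inner set"
  assumes "finite B" "pairwise orthogonal B" "\<And>b. b \<in> B \<Longrightarrow> norm b = 1" 
  shows "(\<Sum>b\<in>B. c b *\<^sub>R b) \<bullet> (\<Sum>b\<in>B. c b *\<^sub>R b) = (\<Sum>b\<in>B. (c b)\<^sup>2)"
proof -
  have "(\<Sum>b\<in>B. c b *\<^sub>R b) \<bullet> (\<Sum>b\<in>B. c b *\<^sub>R b) = (\<Sum>b\<in>B. \<Sum>b'\<in>B. c b * c b' * (b \<bullet> b'))"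
    unfolding inner_sum_left inner_sum_right by (intro sum.cong refl) (simp add: inner_commute mult_ac)
  also have "\<dots> = (\<Sum>b\<in>B. \<Sum>b'\<in>B. if b = b' then (c b)\<^sup>2 else 0)"
    by (intro sum.cong) (auto simp: orthonormal_inner[OF assms(2,3)] power2_eq_square)
  also have "\<dots> = (\<Sum>b\<in>B. (c b)\<^sup>2)" using assms(1) by simp
  finally show ?thesis .
qed

lemma psd_sqrt_exists:
  fixes A :: "real^'n^'n"
  assumes "psd_matrix A"
  obtains S where "psd_matrix S" "S ** S = A"
proof -
  from assms have sym: "transpose A = A" and nn: "0 \<le> x \<bullet> (A *v x)" for x
    by (auto simp: psd_matrix_def)
  obtain B where B: "finite B" "pairwise orthogonal B" "\<And>b. b \<in> B \<Longrightarrow> norm b = 1"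
    "span B = UNIV" "\<And>b. b \<in> B \<Longrightarrow> A *v b = (b \<bullet> (A *v b)) *\<^sub>R b"
    using symmetric_spectral[OF sym] by blast
  define l where "l b = b \<bullet> (A *v b)" for b
  \<comment> \<open>The sum of the rank-one matrices b b^T with weights \<open>sqrt (l b)\<close>,
    written entrywise.\<close>
  define S :: "real^'n^'n" where "S = (\<chi> i j. \<Sum>b\<in>B. sqrt (l b) * b $ i * b $ j)"
  have Sv: "S *v x = (\<Sum>b\<in>B. (sqrt (l b) * (b \<bullet> x)) *\<^sub>R b)" for x
    by (simp add: vec_eq_iff S_def matrix_vector_mult_def inner_vec_def sum_distrib_left sum_distrib_right)
       (subst sum.swap, simp add: algebra_simps)
  have expand: "(\<Sum>b\<in>B. (b \<bullet> x) *\<^sub>R b) = x" for x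
    using orthonormal_basis_expand[OF B(2,3) _ B(1), of x] B(4) by (simp add: inner_commute)
  have bS: "b \<bullet> (S *v x) = sqrt (l b) * (b \<bullet> x)" if "b \<in> B" for b x
  proof -
    have "b \<bullet> (S *v x) = (\<Sum>c\<in>B. if c = b then sqrt (l c) * (c \<bullet> x) else 0)"
      unfolding Sv inner_sum_right
      by (intro sum.cong) (use that in \<open>auto simp: orthonormal_inner[OF B(2,3)]\<close>)
    then show ?thesis using that B(1) by simp
  qed
  have "S *v (S *v x) = A *v x" for x
  proof -
    have "S *v (S *v x) = (\<Sum>b\<in>B. (sqrt (l b) * (b \<bullet> (S *v x))) *\<^sub>R b)" by (rule Sv)
    also have "\<dots> = (\<Sum>b\<in>B. (b \<bullet> x) *\<^sub>R (A *v b))"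
    proof (rule sum.cong)
      fix b assume b: "b \<in> B"
      have "sqrt (l b) * (b \<bullet> (S *v x)) = l b * (b \<bullet> x)"
        using nn by (simp add: bS[OF b] l_def flip: mult.assoc)
      then show "(sqrt (l b) * (b \<bullet> (S *v x))) *\<^sub>R b = (b \<bullet> x) *\<^sub>R (A *v b)"
        using B(5)[OF b] by (metis l_def mult.commute scaleR_scaleR)
    qed simp
    also have "\<dots> = A *v (\<Sum>b\<in>B. (b \<bullet> x) *\<^sub>R b)"
      by (simp add: linear_sum[OF matrix_vector_mul_linear] matrix_vector_mult_scaleR)
    finally show ?thesis by (simp add: expand)
  qed
  then have "S ** S = A" by (simp add: matrix_eq flip: matrix_vector_mul_assoc)
  moreover have "transpose S = S"
    by (simp add: S_def transpose_def vec_eq_iff mult.assoc) (simp add: mult.commute)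
  moreover have "0 \<le> x \<bullet> (S *v x)" for x
    unfolding Sv inner_sum_right using nn
    by (intro sum_nonneg) (simp add: l_def inner_commute mult.assoc)
  ultimately show ?thesis using that by (auto simp: psd_matrix_def)
qed

lemma psd_sqrt_unique:
  fixes S T :: "real^'n^'n"
  assumes S: "psd_matrix S" and T: "psd_matrix T" and eq: "S ** S = T ** T"
  shows "S = T"
proof -
  from S T have sS: "transpose S = S" and sT: "transpose T = T" by (auto simp: psd_matrix_def)
  define D where "D = S - T"
  have Dv: "D *v x = S *v x - T *v x" for x by (simp add: D_def matrix_vector_mult_diff_rdistrib)
  have sD: "x \<bullet> (D *v y) = (D *v x) \<bullet> y" for x y
    by (simp add: Dv inner_diff_left inner_diff_right symmetric_inner_swap[OF sS] symmetric_inner_swap[OF sT])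
  have SS: "S *v (S *v x) = T *v (T *v x)" for x using eq by (simp add: matrix_vector_mul_assoc)
  \<comment> \<open>Pairing this identity with an eigenvector of \<open>D\<close> forces the eigenvalue to vanish.\<close>
  have anti: "S *v (D *v x) + D *v (T *v x) = 0" for x
    by (simp add: Dv SS linear_diff[OF matrix_vector_mul_linear])
  have symD: "transpose D = D" by (rule symmetricI) (rule sD)
  obtain E where E: "finite E" "pairwise orthogonal E" "\<And>b. b \<in> E \<Longrightarrow> norm b = 1"
    "span E = UNIV" "\<And>b. b \<in> E \<Longrightarrow> D *v b = (b \<bullet> (D *v b)) *\<^sub>R b"
    using symmetric_spectral[OF symD] by blast
  have zero: "D *v b = 0" if b: "b \<in> E" for b
  proof -
    define d where "d = b \<bullet> (D *v b)"
    have Db: "D *v b = d *\<^sub>R b" unfolding d_def by (rule E(5)[OF b])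
    have "0 = b \<bullet> (S *v (D *v b)) + b \<bullet> (D *v (T *v b))" by (simp add: anti flip: inner_add_right)
    also have "\<dots> = d * (b \<bullet> (S *v b) + b \<bullet> (T *v b))"
      by (simp add: sD Db matrix_vector_mult_scaleR distrib_left)
    finally have "d = 0 \<or> b \<bullet> (S *v b) + b \<bullet> (T *v b) = 0" by simp
    moreover have "0 \<le> b \<bullet> (S *v b)" "0 \<le> b \<bullet> (T *v b)" using S T by (auto simp: psd_matrix_def)
    \<comment> \<open>Two nonnegative numbers with sum 0: unless d = 0, the vector \<open>b\<close>
      lies in the kernels of both \<open>S\<close> and \<open>T\<close>, and then
      \<open>D *v b = 0\<close> again.\<close>
    ultimately have "d = 0 \<or> b \<bullet> (S *v b) = 0 \<and> b \<bullet> (T *v b) = 0" by linarith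
    then show ?thesis
    proof
      assume "b \<bullet> (S *v b) = 0 \<and> b \<bullet> (T *v b) = 0"
      then have "S *v b = 0" "T *v b = 0" using psd_form_zero[OF S] psd_form_zero[OF T] by blast+
      then show ?thesis unfolding Dv by simp
    qed (simp add: Db)
  qed
  have "D *v x = 0" for x
  proof -
    have "x \<in> span E" unfolding E(4) by simp
    with zero show ?thesis by (rule linear_eq_0_on_span[OF matrix_vector_mul_linear])
  qed
  then have "S *v x = T *v x" for x by (simp add: Dv)
  then show ?thesis by (simp add: matrix_eq)
qed

lemma matrix_sqrt:
  fixes A :: "real^'n^'n"
  assumes "psd_matrix A"
  shows "psd_matrix (matrix_sqrt A)" "matrix_sqrt A ** matrix_sqrt A = A"
proof -
  have "\<exists>!S. psd_matrix S \<and> S ** S = A"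
    using psd_sqrt_exists[OF assms] psd_sqrt_unique by metis
  from theI'[OF this] show "psd_matrix (matrix_sqrt A)" "matrix_sqrt A ** matrix_sqrt A = A"
    by (auto simp: matrix_sqrt_def)
qed

text \<open>Polar decomposition A = S Q, together with S = A R. It shows that \<open>S\<close> and
  \<open>A\<close> map the paths of energy at most one onto the same set, because contractions
  preserve that class.\<close>

lemma contraction_factor:
  fixes S A :: "real^'n^'n"
  assumes S: "psd_matrix S" and eq: "S ** S = A ** transpose A"
  obtains Q R :: "real^'n^'n" where "\<And>x. S *v (Q *v x) = A *v x" "\<And>x. A *v (R *v x) = S *v x"
    "\<And>x. norm (Q *v x) \<le> norm x" "\<And>x. norm (R *v x) \<le> norm x"
proof -
  have sym: "transpose S = S" using S by (auto simp: psd_matrix_def)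
  obtain B where B: "finite B" "pairwise orthogonal B" "\<And>b. b \<in> B \<Longrightarrow> norm b = 1"
    "span B = UNIV" "\<And>b. b \<in> B \<Longrightarrow> S *v b = (b \<bullet> (S *v b)) *\<^sub>R b"
    using symmetric_spectral[OF sym] by blast
  define s where "s b = b \<bullet> (S *v b)" for b
  \<comment> \<open>These are unnormalised right singular vectors of \<open>A\<close>: they are
    orthogonal and have squared lengths \<open>(s b)\<^sup>2\<close>.\<close>
  define a where "a b = transpose A *v b" for b
  have Sb: "S *v b = s b *\<^sub>R b" if "b \<in> B" for b using B(5)[OF that] by (simp add: s_def)
  have expand: "(\<Sum>b\<in>B. (b \<bullet> x) *\<^sub>R b) = x" for x
    using orthonormal_basis_expand[OF B(2,3) _ B(1), of x] B(4) by (simp add: inner_commute)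
  have ax: "a b \<bullet> x = b \<bullet> (A *v x)" for b x
    unfolding a_def by (metis dot_lmul_matrix transpose_matrix_vector)
  have Aa: "A *v a b = (s b)\<^sup>2 *\<^sub>R b" if "b \<in> B" for b
  proof -
    have "A *v a b = S *v (S *v b)" unfolding a_def matrix_vector_mul_assoc eq ..
    then show ?thesis using that by (simp add: Sb matrix_vector_mult_scaleR power2_eq_square)
  qed
  have aa: "a b \<bullet> a c = (if b = c then (s c)\<^sup>2 else 0)" if "b \<in> B" "c \<in> B" for b c
    using that by (simp add: ax Aa orthonormal_inner[OF B(2,3)])
  have a0: "a b = 0" if "b \<in> B" "s b = 0" for b
    using aa[OF that(1) that(1)] that by simp
  define R where "R y = (\<Sum>b\<in>B. ((y \<bullet> b) / s b) *\<^sub>R a b)" for y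
  \<comment> \<open>\<open>Q\<close> is the pseudo-inverse of \<open>S\<close> times \<open>A\<close>, and \<open>R\<close> its adjoint; where \<open>s b = 0\<close> the junk value
    of the division is harmless, since then \<open>a b = 0\<close>.\<close>
  define Q where "Q x = (\<Sum>b\<in>B. ((a b \<bullet> x) / s b) *\<^sub>R b)" for x
  have lin: "linear R" "linear Q"
    unfolding R_def Q_def
    by (rule linearI; simp add: inner_add_left inner_add_right add_divide_distrib scaleR_add_left sum.distrib scaleR_sum_right)+
  have QR: "Q x \<bullet> y = x \<bullet> R y" for x y
    by (simp add: Q_def R_def inner_sum_left inner_sum_right)
       (intro sum.cong refl; simp add: inner_commute)
  have nR: "norm (R y) \<le> norm y" for y
  proof -
    have "R y \<bullet> R y = (\<Sum>b\<in>B. \<Sum>c\<in>B. ((y \<bullet> b) / s b) * ((y \<bullet> c) / s c) * (a b \<bullet> a c))"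
      unfolding R_def inner_sum_left inner_sum_right
      by (intro sum.cong refl) (simp add: inner_commute mult_ac)
    also have "\<dots> = (\<Sum>b\<in>B. \<Sum>c\<in>B. if b = c then (if s c = 0 then 0 else (y \<bullet> c)\<^sup>2) else 0)"
      by (intro sum.cong) (auto simp: aa power2_eq_square)
    also have "\<dots> = (\<Sum>b\<in>B. if s b = 0 then 0 else (y \<bullet> b)\<^sup>2)" using B(1) by simp
    also have "\<dots> \<le> (\<Sum>b\<in>B. (b \<bullet> y)\<^sup>2)" by (intro sum_mono) (auto simp: inner_commute)
    also have "\<dots> = y \<bullet> y" using orthonormal_norm_square[OF B(1-3), of "\<lambda>b. b \<bullet> y"] by (simp add: expand)
    finally show ?thesis by (simp add: norm_le)
  qed
  have nQ: "norm (Q x) \<le> norm x" for x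
  proof -
    have "norm (Q x) * norm (Q x) = x \<bullet> R (Q x)" by (metis QR power2_eq_square power2_norm_eq_inner)
    also have "\<dots> \<le> norm x * norm (R (Q x))" by (rule norm_cauchy_schwarz)
    also have "\<dots> \<le> norm x * norm (Q x)" by (intro mult_left_mono nR) auto
    finally show ?thesis by (cases "Q x = 0") auto
  qed
  have SQ: "S *v Q x = A *v x" for x
  proof -
    have "S *v Q x = (\<Sum>b\<in>B. ((a b \<bullet> x) / s b) *\<^sub>R (S *v b))"
      by (simp add: Q_def linear_sum[OF matrix_vector_mul_linear] matrix_vector_mult_scaleR)
    also have "\<dots> = (\<Sum>b\<in>B. (b \<bullet> (A *v x)) *\<^sub>R b)"
    proof (rule sum.cong)
      fix b assume b: "b \<in> B"
      show "((a b \<bullet> x) / s b) *\<^sub>R (S *v b) = (b \<bullet> (A *v x)) *\<^sub>R b"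
        using a0[OF b] by (cases "s b = 0") (simp_all add: Sb[OF b] flip: ax)
    qed simp
    finally show ?thesis by (simp add: expand)
  qed
  have AR: "A *v R x = S *v x" for x
  proof -
    have "A *v R x = (\<Sum>b\<in>B. ((x \<bullet> b) / s b) *\<^sub>R (A *v a b))"
      by (simp add: R_def linear_sum[OF matrix_vector_mul_linear] matrix_vector_mult_scaleR)
    also have "\<dots> = (\<Sum>b\<in>B. (b \<bullet> x) *\<^sub>R (S *v b))"
    proof (rule sum.cong)
      fix b assume b: "b \<in> B"
      show "((x \<bullet> b) / s b) *\<^sub>R (A *v a b) = (b \<bullet> x) *\<^sub>R (S *v b)"
        by (cases "s b = 0") (simp_all add: Sb[OF b] Aa[OF b] power2_eq_square inner_commute)
    qed simp
    also have "\<dots> = S *v (\<Sum>b\<in>B. (b \<bullet> x) *\<^sub>R b)"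
      by (simp add: linear_sum[OF matrix_vector_mul_linear] matrix_vector_mult_scaleR)
    finally show ?thesis by (simp add: expand)
  qed
  show ?thesis
    using that[of "matrix Q" "matrix R"] SQ AR nQ nR by (simp add: matrix_works lin)
qed

section \<open>Absolutely continuous functions and energy\<close>

text \<open>Fundamental theorem for the gauge integral. At tags outside \<open>N\<close> the gauge
  enforces the linear approximation of \<open>h\<close>; at tags in \<open>N\<close> it keeps the
  intervals inside an open set of measure below \<delta>, where absolute continuity bounds the total
  increment.\<close>

lemma absolutely_continuous_has_integral:
  fixes h h' :: "real \<Rightarrow> real"
  assumes ac: "abs_continuous_on_interval a b h" and ab: "a \<le> s" "s \<le> t" "t \<le> b"
    and N: "N \<in> null_sets lborel"
    and der: "\<And>x. x \<in> {s..t} - N \<Longrightarrow> (h has_real_derivative h' x) (at x)"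
  shows "((\<lambda>x. if x \<in> N then 0 else h' x) has_integral (h t - h s)) {s..t}"
  unfolding has_integral_real
proof (intro allI impI)
  fix e :: real assume e: "e > 0"
  let ?f = "\<lambda>x. if x \<in> N then 0 else h' x"
  have "e / 2 > 0" using e by simp
  note ac' = ac[unfolded abs_continuous_on_interval_def, THEN spec, THEN mp, OF this]
  obtain \<delta> where \<delta>: "\<delta> > 0" "\<And>(n::nat) l r. (\<forall>k<n. a \<le> l k \<and> l k < r k \<and> r k \<le> b) \<Longrightarrow>
        (\<forall>j<n. \<forall>k<n. j \<noteq> k \<longrightarrow> {l j<..<r j} \<inter> {l k<..<r k} = {}) \<Longrightarrow>
        (\<Sum>k<n. r k - l k) < \<delta> \<Longrightarrow> (\<Sum>k<n. \<bar>h (r k) - h (l k)\<bar>) < e / 2"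
    using ac' by (elim exE conjE) blast
  \<comment> \<open>Outer regularity supplies the open set that is to contain every interval tagged
    in \<open>N\<close>.\<close>
  obtain T where T: "open T" "N \<subseteq> T" "emeasure lborel (T - N) < ennreal \<delta>"
    using outer_regular_lborel[of N \<delta>] null_setsD2[OF N] \<delta>(1) by (metis sets_lborel)
  have [measurable]: "T \<in> sets borel" using T by auto
  have T\<delta>: "emeasure lborel T < ennreal \<delta>"
    using T(3) N by (simp add: emeasure_Diff_null_set)
  \<comment> \<open>The summand 1 keeps the denominator positive when s = t; each of the two kinds
    of tags may use e/2.\<close>
  define \<eta> where "\<eta> = e / (2 * (t - s + 1))"
  have \<eta>: "\<eta> > 0" "\<eta> * (t - s) < e / 2"
    using e ab(2) by (auto simp: \<eta>_def field_simps)
  have "\<exists>d>0. (x \<in> N \<longrightarrow> ball x d \<subseteq> T) \<and>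
      (x \<in> {s..t} - N \<longrightarrow> (\<forall>y. \<bar>y - x\<bar> < d \<longrightarrow> \<bar>h y - h x - h' x * (y - x)\<bar> \<le> \<eta> * \<bar>y - x\<bar>))" for x
  proof (cases "x \<in> N")
    case True
    then show ?thesis using T(1,2) open_contains_ball by (metis Diff_iff subset_eq)
  next
    case False
    show ?thesis
    proof (cases "x \<in> {s..t}")
      case True
      then have "(h has_derivative (\<lambda>t. h' x * t)) (at x)"
        using der False by (auto simp: has_field_derivative_def)
      then show ?thesis using \<eta> False unfolding has_derivative_at_alt by force
    qed (use False in \<open>auto intro: exI[of _ 1]\<close>)
  qed
  then obtain d where d: "\<And>x. d x > 0" "\<And>x. x \<in> N \<Longrightarrow> ball x (d x) \<subseteq> T"
    "\<And>x y. x \<in> {s..t} - N \<Longrightarrow> \<bar>y - x\<bar> < d x \<Longrightarrow> \<bar>h y - h x - h' x * (y - x)\<bar> \<le> \<eta> * \<bar>y - x\<bar>"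
    by metis
  show "\<exists>\<gamma>. gauge \<gamma> \<and> (\<forall>\<D>. \<D> tagged_division_of {s..t} \<and> \<gamma> fine \<D> \<longrightarrow>
      norm ((\<Sum>(x, k)\<in>\<D>. measure lborel k *\<^sub>R ?f x) - (h t - h s)) < e)"
  proof (intro exI conjI allI impI; (elim conjE)?)
    show "gauge (\<lambda>x. ball x (d x))" using d(1) by (intro gauge_ball_dependent) auto
  next
    fix p assume p: "p tagged_division_of {s..t}" and fine: "(\<lambda>x. ball x (d x)) fine p"
    note pD = tagged_division_ofD[OF p]
    define L where "L z = Inf (snd z)" for z :: "real \<times> real set"
    define R where "R z = Sup (snd z)" for z :: "real \<times> real set"
    have fin: "finite p" by (rule pD(1))
    have K: "snd z = {L z..R z}" "L z \<le> fst z" "fst z \<le> R z" "s \<le> L z" "R z \<le> t"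
      "{L z..R z} \<subseteq> ball (fst z) (d (fst z))" "measure lborel (snd z) = R z - L z" "fst z \<in> {s..t}" if "z \<in> p" for z
    proof -
      obtain x k where z: "z = (x, k)" by force
      with that have xk: "(x, k) \<in> p" by simp
      from pD(4)[OF xk] obtain u v where k: "k = {u..v}" by auto
      have x: "x \<in> k" "k \<subseteq> {s..t}" "k \<subseteq> ball x (d x)"
        using pD(2,3)[OF xk] fineD[OF fine xk] by auto
      then have uv: "u \<le> v" "L z = u" "R z = v" using k by (auto simp: L_def R_def z)
      show "snd z = {L z..R z}" "L z \<le> fst z" "fst z \<le> R z" "s \<le> L z" "R z \<le> t"
        "{L z..R z} \<subseteq> ball (fst z) (d (fst z))" "measure lborel (snd z) = R z - L z" "fst z \<in> {s..t}"
        unfolding uv using uv(1) x k by (auto simp: z)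
    qed
    have disj: "{L z<..<R z} \<inter> {L w<..<R w} = {}" if "z \<in> p" "w \<in> p" "z \<noteq> w" for z w
    proof -
      have "interior (snd z) \<inter> interior (snd w) = {}"
        by (rule pD(5)[of "fst z" _ "fst w"]) (use that in \<open>auto simp: prod_eq_iff\<close>)
      then show ?thesis unfolding K(1)[OF that(1)] K(1)[OF that(2)] interior_atLeastAtMost_real .
    qed
    \<comment> \<open>Degenerate intervals are left out because absolute continuity is stated for l
      < r; they contribute 0 on both sides.\<close>
    define q where "q = {z \<in> p. fst z \<in> N \<and> L z < R z}"
    have q: "finite q" "q \<subseteq> p" using fin by (auto simp: q_def)
    have dsum: "(\<Sum>z\<in>q. R z - L z) < \<delta>"
    proof -
      have "ennreal (\<Sum>z\<in>q. R z - L z) = (\<Sum>z\<in>q. emeasure lborel {L z<..<R z})"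
        by (subst sum_ennreal[symmetric]) (auto simp: q_def)
      also have "\<dots> = emeasure lborel (\<Union>z\<in>q. {L z<..<R z})"
      proof (rule sum_emeasure)
        show "disjoint_family_on (\<lambda>z. {L z<..<R z}) q"
          unfolding disjoint_family_on_def using q(2) disj by (meson subsetD)
      qed (use q in auto)
      also have "\<dots> \<le> emeasure lborel T"
      proof (rule emeasure_mono)
        show "(\<Union>z\<in>q. {L z<..<R z}) \<subseteq> T"
        proof (rule UN_least)
          fix z assume z: "z \<in> q"
          then have "{L z..R z} \<subseteq> T" using K(6)[of z] d(2)[of "fst z"] by (auto simp: q_def)
          then show "{L z<..<R z} \<subseteq> T" using greaterThanLessThan_subseteq_atLeastAtMost_iff by fastforce
        qed
      qed simp
      also have "\<dots> < ennreal \<delta>" by (rule T\<delta>)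
      finally have "ennreal (\<Sum>z\<in>q. R z - L z) < ennreal \<delta>" .
      moreover have "0 \<le> (\<Sum>z\<in>q. R z - L z)" by (rule sum_nonneg) (auto simp: q_def)
      ultimately show ?thesis by (simp add: ennreal_less_iff)
    qed
    have bad: "(\<Sum>z\<in>q. \<bar>h (R z) - h (L z)\<bar>) < e / 2"
    proof -
      obtain g where g: "bij_betw g {0..<card q} q" using ex_bij_betw_nat_finite[OF q(1)] by blast
      then have g': "bij_betw g {..<card q} q" by (simp add: atLeast0LessThan)
      have gq: "g k \<in> q" if "k < card q" for k using g' that by (auto simp: bij_betw_def)
      have "(\<Sum>k<card q. \<bar>h (R (g k)) - h (L (g k))\<bar>) < e / 2"
      proof (rule \<delta>(2))
        show "\<forall>k<card q. a \<le> L (g k) \<and> L (g k) < R (g k) \<and> R (g k) \<le> b"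
        proof (intro allI impI)
          fix k assume "k < card q"
          from gq[OF this] have "g k \<in> p" "L (g k) < R (g k)" by (auto simp: q_def)
          with K(4,5)[of "g k"] ab show "a \<le> L (g k) \<and> L (g k) < R (g k) \<and> R (g k) \<le> b" by auto
        qed
        show "\<forall>j<card q. \<forall>k<card q. j \<noteq> k \<longrightarrow> {L (g j)<..<R (g j)} \<inter> {L (g k)<..<R (g k)} = {}"
          using gq q(2) g' by (intro allI impI disj) (auto simp: bij_betw_def inj_on_def)
        show "(\<Sum>k<card q. R (g k) - L (g k)) < \<delta>"
          using dsum sum.reindex_bij_betw[OF g', of "\<lambda>z. R z - L z"] by simp
      qed
      then show ?thesis using sum.reindex_bij_betw[OF g', of "\<lambda>z. \<bar>h (R z) - h (L z)\<bar>"] by simp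
    qed
    have close: "\<bar>measure lborel (snd z) * ?f (fst z) - (h (R z) - h (L z))\<bar>
        \<le> \<eta> * measure lborel (snd z) + (if z \<in> q then \<bar>h (R z) - h (L z)\<bar> else 0)" if z: "z \<in> p" for z
    proof (cases "fst z \<in> N")
      case True
      have "L z \<le> R z" using K(2,3)[OF z] by simp
      moreover have "0 \<le> \<eta> * (R z - L z)" using \<open>L z \<le> R z\<close> \<eta>(1) by simp
      ultimately show ?thesis using True z K(7)[OF z]
        by (cases "L z = R z") (auto simp: q_def abs_minus_commute)
    next
      case False
      let ?x = "fst z"
      have x: "?x \<in> {s..t} - N" using False K(8)[OF z] by auto
      have "{L z..R z} \<subseteq> ball ?x (d ?x)" "L z \<le> R z" using K(2,3,6)[OF z] by auto
      then have "L z \<in> ball ?x (d ?x)" "R z \<in> ball ?x (d ?x)" by auto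
      then have "\<bar>R z - ?x\<bar> < d ?x" "\<bar>L z - ?x\<bar> < d ?x" by (auto simp: dist_real_def)
      from d(3)[OF x this(1)] d(3)[OF x this(2)]
      have "\<bar>h (R z) - h ?x - h' ?x * (R z - ?x)\<bar> \<le> \<eta> * (R z - ?x)"
        "\<bar>h (L z) - h ?x - h' ?x * (L z - ?x)\<bar> \<le> \<eta> * (?x - L z)" using K(2,3)[OF z] by auto
      then have "\<bar>(R z - L z) * h' ?x - (h (R z) - h (L z))\<bar> \<le> \<eta> * (R z - L z)"
        by (simp add: algebra_simps abs_le_iff)
      then show ?thesis using False K(7)[OF z] by (auto simp: q_def)
    qed
    have cont: "(\<Sum>z\<in>p. measure lborel (snd z)) = t - s"
      using additive_content_tagged_division[of p s t] p ab(2) by (simp add: case_prod_beta)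
    have tel: "(\<Sum>z\<in>p. h (R z) - h (L z)) = h t - h s"
      using additive_tagged_division_1[OF ab(2) p, of h] by (simp add: R_def L_def case_prod_beta)
    have "\<bar>(\<Sum>z\<in>p. measure lborel (snd z) * ?f (fst z)) - (h t - h s)\<bar>
       = \<bar>\<Sum>z\<in>p. measure lborel (snd z) * ?f (fst z) - (h (R z) - h (L z))\<bar>"
      by (simp add: tel[symmetric] sum_subtractf)
    also have "\<dots> \<le> (\<Sum>z\<in>p. \<eta> * measure lborel (snd z) + (if z \<in> q then \<bar>h (R z) - h (L z)\<bar> else 0))"
      by (intro order.trans[OF sum_abs] sum_mono close)
    also have "\<dots> = \<eta> * (t - s) + (\<Sum>z\<in>q. \<bar>h (R z) - h (L z)\<bar>)"
      using q fin by (simp add: sum.distrib cont sum_distrib_left[symmetric] sum.inter_restrict[symmetric] Int_absorb1)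
    also have "\<dots> < e" using bad \<eta> by simp
    finally show "norm ((\<Sum>(x, k)\<in>p. measure lborel k *\<^sub>R ?f x) - (h t - h s)) < e"
      by (simp add: case_prod_beta)
  qed
qed

text \<open>Since \<open>g\<close> is only gauge integrable, the case of infinite energy is split
  off first; otherwise \<open>(norm (g x))\<^sup>2\<close> is gauge integrable too. The open
  interval on the right lets adjacent intervals count as disjoint when the estimates are
  summed.\<close>

lemma energy_interval:
  fixes g :: "real \<Rightarrow> 'a::euclidean_space"
  assumes st: "s < t" and g: "(g has_integral v) {s..t}"
  shows "ennreal ((norm v)\<^sup>2 / (t - s)) \<le> (\<integral>\<^sup>+x. ennreal ((norm (g x))\<^sup>2) * indicator {s<..<t} x \<partial>lborel)"
    (is "_ \<le> ?I")
proof (cases "?I = \<infinity>")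
  case False
  define \<phi> where "\<phi> x = (norm (indicator {s..t} x *\<^sub>R g x))\<^sup>2" for x
  have [measurable]: "(\<lambda>x. indicator {s..t} x *\<^sub>R g x) \<in> borel_measurable lebesgue"
    by (rule has_integral_implies_lebesgue_measurable[OF g])
  have "AE x in lborel. x \<noteq> s" "AE x in lborel. x \<noteq> t" by (rule AE_lborel_singleton)+
  then have "(\<integral>\<^sup>+x. ennreal (\<phi> x) \<partial>lebesgue) = ?I"
    unfolding nn_integral_completion
    by (intro nn_integral_cong_AE) (auto simp: \<phi>_def indicator_def elim!: AE_mp)
  moreover obtain r where r: "?I = ennreal r" "r \<ge> 0" using False by (cases ?I) auto
  moreover have "\<phi> \<in> borel_measurable lebesgue" unfolding \<phi>_def by measurable
  ultimately have "(\<phi> has_integral r) UNIV"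
    by (subst has_integral_iff_nn_integral_lebesgue) (auto simp: \<phi>_def)
  moreover have "\<phi> = (\<lambda>x. if x \<in> {s..t} then (norm (g x))\<^sup>2 else 0)"
    by (auto simp: \<phi>_def fun_eq_iff)
  ultimately have I2: "((\<lambda>x. (norm (g x))\<^sup>2) has_integral r) {s..t}"
    using has_integral_restrict_UNIV by metis
  \<comment> \<open>Integrating \<open>0 \<le> |g x - w|\<^sup>2\<close> for the mean \<open>w\<close> of \<open>g\<close> gives the Cauchy--Schwarz bound.\<close>
  define w where "w = v /\<^sub>R (t - s)"
  have I1: "((\<lambda>x. g x \<bullet> w) has_integral v \<bullet> w) {s..t}"
    using has_integral_linear[OF g bounded_linear_inner_left[of w]] by (simp add: o_def)
  have I0: "((\<lambda>x. (norm w)\<^sup>2) has_integral (t - s) * (norm w)\<^sup>2) {s..t}"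
    using has_integral_const_real[of "(norm w)\<^sup>2" s t] st by simp
  have "((\<lambda>x. (norm (g x))\<^sup>2 - 2 * (g x \<bullet> w) + (norm w)\<^sup>2) has_integral
      r - 2 * (v \<bullet> w) + (t - s) * (norm w)\<^sup>2) {s..t}"
    by (intro has_integral_add has_integral_diff I2 I0 has_integral_mult_right I1)
  moreover have "0 \<le> (norm (g x))\<^sup>2 - 2 * (g x \<bullet> w) + (norm w)\<^sup>2" for x
  proof -
    have "(norm (g x))\<^sup>2 - 2 * (g x \<bullet> w) + (norm w)\<^sup>2 = (norm (g x - w))\<^sup>2"
      by (simp add: power2_norm_eq_inner inner_diff_left inner_diff_right inner_commute)
    then show ?thesis by simp
  qed
  ultimately have "0 \<le> r - 2 * (v \<bullet> w) + (t - s) * (norm w)\<^sup>2"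
    by (rule has_integral_nonneg) 
  moreover have "v \<bullet> w = (norm v)\<^sup>2 / (t - s)"
    by (simp add: w_def power2_norm_eq_inner divide_inverse mult.commute)
  moreover have "norm w = norm v / (t - s)" using st by (simp add: w_def divide_inverse mult.commute)
  then have "(t - s) * (norm w)\<^sup>2 = (norm v)\<^sup>2 / (t - s)"
    using st by (simp add: power2_eq_square)
  ultimately have "(norm v)\<^sup>2 / (t - s) \<le> r" by simp
  then show ?thesis unfolding r(1) by (rule ennreal_leI)
qed simp

text \<open>Expresses that g is the derivative of f through the increments of f, with energy at most
  one. This integrated form can be reached both from a derivative that exists almost everywhere and
  from the limit of dyadic slopes.\<close>

definition energy_density :: "(real \<Rightarrow> 'a::euclidean_space) \<Rightarrow> (real \<Rightarrow> 'a) \<Rightarrow> bool" where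
  "energy_density g f \<longleftrightarrow>
    (\<forall>s t. 0 \<le> s \<longrightarrow> s \<le> t \<longrightarrow> t \<le> 1 \<longrightarrow> (g has_integral (f t - f s)) {s..t}) \<and>
    (\<integral>\<^sup>+x. ennreal ((norm (g x))\<^sup>2) * indicator {0..1} x \<partial>lborel) \<le> 1"

lemma energy_densityD:
  assumes "energy_density g f" "0 \<le> s" "s \<le> t" "t \<le> 1"
  shows "(g has_integral (f t - f s)) {s..t}"
  using assms by (auto simp: energy_density_def)

lemma energy_disjoint_intervals:
  fixes g :: "real \<Rightarrow> 'a::euclidean_space"
  assumes dens: "energy_density g f"
    and fin: "finite I" and lr: "\<And>k. k \<in> I \<Longrightarrow> 0 \<le> l k \<and> l k < r k \<and> r k \<le> 1"
    and disj: "disjoint_family_on (\<lambda>k. {l k<..<r k}) I"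
  shows "(\<Sum>k\<in>I. (norm (f (r k) - f (l k)))\<^sup>2 / (r k - l k)) \<le> 1"
proof -
  note g = energy_densityD[OF dens]
  \<comment> \<open>Gauge integrability yields measurability only for the completed measure, so the
    summation runs over \<open>lebesgue\<close> and returns to \<open>lborel\<close> at the
    end.\<close>
  have meas: "(\<lambda>x. indicator {0..1} x *\<^sub>R g x) \<in> borel_measurable lebesgue"
    by (rule has_integral_implies_lebesgue_measurable[OF g]) auto
  have [measurable]: "(\<lambda>x. ennreal ((norm (g x))\<^sup>2) * indicator {l k<..<r k} x) \<in> borel_measurable lebesgue" if "k \<in> I" for k
  proof -
    have "(\<lambda>x. ennreal ((norm (g x))\<^sup>2) * indicator {l k<..<r k} x) =
      (\<lambda>x. ennreal ((norm (indicator {0..1} x *\<^sub>R g x))\<^sup>2) * indicator {l k<..<r k} x)"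
      using lr[OF that] by (auto simp: fun_eq_iff indicator_def)
    also have "\<dots> \<in> borel_measurable lebesgue"
    proof (rule borel_measurable_times_ennreal)
      show "(\<lambda>x. ennreal ((norm (indicator {0..1} x *\<^sub>R g x))\<^sup>2)) \<in> borel_measurable lebesgue"
        using meas by measurable
      show "indicator {l k<..<r k} \<in> borel_measurable lebesgue"
        by (rule borel_measurable_indicator) simp
    qed
    finally show ?thesis .
  qed
  have "ennreal (\<Sum>k\<in>I. (norm (f (r k) - f (l k)))\<^sup>2 / (r k - l k)) =
     (\<Sum>k\<in>I. ennreal ((norm (f (r k) - f (l k)))\<^sup>2 / (r k - l k)))"
    by (rule sum_ennreal[symmetric]) (use lr in \<open>auto simp: less_imp_le\<close>)
  also have "\<dots> \<le> (\<Sum>k\<in>I. \<integral>\<^sup>+x. ennreal ((norm (g x))\<^sup>2) * indicator {l k<..<r k} x \<partial>lebesgue)"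
    unfolding nn_integral_completion using lr
    by (intro sum_mono energy_interval g) (auto simp: less_imp_le)
  also have "\<dots> = (\<integral>\<^sup>+x. (\<Sum>k\<in>I. ennreal ((norm (g x))\<^sup>2) * indicator {l k<..<r k} x) \<partial>lebesgue)"
    by (rule nn_integral_sum[symmetric]) auto
  also have "\<dots> \<le> (\<integral>\<^sup>+x. ennreal ((norm (g x))\<^sup>2) * indicator {0..1} x \<partial>lebesgue)"
  proof (intro nn_integral_mono)
    fix x :: real
    have "(\<Sum>k\<in>I. indicator {l k<..<r k} x) = (indicator (\<Union>k\<in>I. {l k<..<r k}) x :: ennreal)"
      by (rule indicator_UN_disjoint[symmetric]) (use fin disj in auto)
    also have "\<dots> \<le> indicator {0..1} x" 
      using lr by (fastforce simp: indicator_def)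
    finally show "(\<Sum>k\<in>I. ennreal ((norm (g x))\<^sup>2) * indicator {l k<..<r k} x) \<le> ennreal ((norm (g x))\<^sup>2) * indicator {0..1} x"
      by (simp add: sum_distrib_left[symmetric] mult_left_mono)
  qed
  also have "\<dots> \<le> 1" using dens by (simp add: nn_integral_completion energy_density_def)
  finally show ?thesis by (simp add: ennreal_le_1)
qed

section \<open>Dyadic difference quotients\<close>

text \<open>Half-open cells make the index unique and less than 2^l. The value 0 outside [0,1) turns
  integrals over the whole line into finite sums.\<close>

definition dstep :: "nat \<Rightarrow> (nat \<Rightarrow> 'a) \<Rightarrow> real \<Rightarrow> 'a::real_normed_vector" where
  "dstep l c x = (if 0 \<le> x \<and> x < 1 then c (nat \<lfloor>2 ^ l * x\<rfloor>) else 0)"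

lemma dyadic_index:
  assumes "0 \<le> x" "x < (1::real)"
  shows "nat \<lfloor>2 ^ l * x\<rfloor> < 2 ^ l" "real (nat \<lfloor>2 ^ l * x\<rfloor>) / 2 ^ l \<le> x"
    "x < real (Suc (nat \<lfloor>2 ^ l * x\<rfloor>)) / 2 ^ l"
proof -
  define m where "m = \<lfloor>2 ^ l * x\<rfloor>"
  have m: "0 \<le> m" "real_of_int m \<le> 2 ^ l * x" "2 ^ l * x < real_of_int m + 1"
    unfolding m_def using assms by simp linarith+
  have "2 ^ l * x < 2 ^ l" using assms by simp
  then have "real_of_int m < 2 ^ l" using m by linarith
  then have "m < 2 ^ l" by (metis of_int_less_iff of_int_numeral of_int_power)
  then show "nat \<lfloor>2 ^ l * x\<rfloor> < 2 ^ l" using m(1) unfolding m_def[symmetric]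
    by (simp add: nat_less_iff)
  have rm: "real (nat m) = real_of_int m" using m(1) by simp
  show "real (nat \<lfloor>2 ^ l * x\<rfloor>) / 2 ^ l \<le> x" "x < real (Suc (nat \<lfloor>2 ^ l * x\<rfloor>)) / 2 ^ l"
    unfolding m_def[symmetric] using m rm by (auto simp: field_simps)
qed

lemma dyadic_point_in_unit:
  assumes "j < 2 ^ l"
  shows "real (Suc j) / 2 ^ l \<in> {0..1} \<and> real j / 2 ^ l \<in> {0..1}"
proof -
  have "real (Suc j) \<le> 2 ^ l" using assms by (metis Suc_leI of_nat_le_iff of_nat_numeral of_nat_power)
  then show ?thesis using assms by (auto simp: divide_le_eq)
qed

lemma dyadic_index_unique:
  assumes "real j / 2 ^ l \<le> x" "x < real (Suc j) / 2 ^ l"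
  shows "nat \<lfloor>2 ^ l * x\<rfloor> = j"
proof -
  have "real j \<le> 2 ^ l * x" "2 ^ l * x < real j + 1"
    using assms by (auto simp: field_simps)
  then have "\<lfloor>2 ^ l * x\<rfloor> = int j" by linarith
  then show ?thesis by simp
qed

lemma dyadic_index_le: "t \<le> 1 \<Longrightarrow> nat \<lfloor>2^l * t\<rfloor> \<le> 2^l" for t :: real
proof -
  assume "t \<le> 1"
  then have "2 ^ l * t \<le> 2 ^ l" by simp
  then have "\<lfloor>2 ^ l * t\<rfloor> \<le> \<lfloor>(2::real) ^ l\<rfloor>" by (rule floor_mono)
  also have "\<lfloor>(2::real) ^ l\<rfloor> = 2 ^ l" by (metis floor_of_int of_int_numeral of_int_power)
  finally show ?thesis by (simp add: nat_le_iff)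
qed

lemma dyadic_floor_dist:
  assumes "0 \<le> (t::real)"
  shows "real (nat \<lfloor>2^l * t\<rfloor>) / 2^l \<le> t" "t - real (nat \<lfloor>2^l * t\<rfloor>) / 2^l \<le> 1 / 2^l"
proof -
  have "0 \<le> \<lfloor>2 ^ l * t\<rfloor>" using assms by simp
  then have n: "real (nat \<lfloor>2 ^ l * t\<rfloor>) = of_int \<lfloor>2 ^ l * t\<rfloor>" by simp
  have "of_int \<lfloor>2 ^ l * t\<rfloor> \<le> 2 ^ l * t" "2 ^ l * t \<le> of_int \<lfloor>2 ^ l * t\<rfloor> + 1" by linarith+
  then have "real_of_int \<lfloor>2 ^ l * t\<rfloor> \<le> t * 2 ^ l" "2 ^ l * t - of_int \<lfloor>2 ^ l * t\<rfloor> \<le> 1"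
    by (simp_all only: mult.commute[of t] diff_le_eq add.commute[of 1])
  note le = this
  have 1: "real_of_int \<lfloor>2 ^ l * t\<rfloor> / 2 ^ l \<le> t" using le(1) by (simp only: pos_divide_le_eq zero_less_power zero_less_numeral)
  have 2: "(2 ^ l * t - of_int \<lfloor>2 ^ l * t\<rfloor>) / 2 ^ l \<le> 1 / 2 ^ l"
    by (rule divide_right_mono[OF le(2)]) simp
  show "real (nat \<lfloor>2^l * t\<rfloor>) / 2^l \<le> t" unfolding n by (rule 1)
  show "t - real (nat \<lfloor>2^l * t\<rfloor>) / 2^l \<le> 1 / 2^l"
    unfolding n using 2 by (simp add: diff_divide_distrib)
qed

lemma dstep_sum:
  "dstep l c x = (\<Sum>j<2^l. indicator {real j / 2^l..<real (Suc j) / 2^l} x *\<^sub>R c j)"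
proof (cases "0 \<le> x \<and> x < 1")
  case True
  let ?J = "nat \<lfloor>2 ^ l * x\<rfloor>"
  have "(\<Sum>j<2^l. indicator {real j / 2^l..<real (Suc j) / 2^l} x *\<^sub>R c j) = (\<Sum>j<2^l. if j = ?J then c j else 0)"
  proof (rule sum.cong)
    fix j :: nat assume "j \<in> {..<2^l}"
    have "x \<in> {real j / 2^l..<real (Suc j) / 2^l} \<longleftrightarrow> j = ?J"
    proof
      assume "x \<in> {real j / 2^l..<real (Suc j) / 2^l}"
      then have "real j / 2^l \<le> x" "x < real (Suc j) / 2^l" by (simp_all only: atLeastLessThan_iff)
      then show "j = ?J" by (rule dyadic_index_unique[symmetric])
    next
      assume j: "j = ?J"
      show "x \<in> {real j / 2^l..<real (Suc j) / 2^l}"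
        unfolding j atLeastLessThan_iff using True by (intro conjI dyadic_index(2,3)) auto
    qed
    then show "indicator {real j / 2^l..<real (Suc j) / 2^l} x *\<^sub>R c j = (if j = ?J then c j else 0)"
      by (simp add: indicator_def del: of_nat_Suc)
  qed simp
  then show ?thesis using True dyadic_index(1)[of x l] by (simp add: dstep_def)
next
  case False
  have "x \<notin> {real j / 2^l..<real (Suc j) / 2^l}" if "j < 2^l" for j
  proof
    assume "x \<in> {real j / 2^l..<real (Suc j) / 2^l}"
    then have x: "real j / 2^l \<le> x" "x < real (Suc j) / 2^l" by (simp_all only: atLeastLessThan_iff)
    have "real (Suc j) / 2 ^ l \<le> 1" using dyadic_point_in_unit[OF that] by (simp only: atLeastAtMost_iff)
    with x(2) have "x < 1" by (rule less_le_trans)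
    moreover have "0 \<le> x" by (rule order.trans[OF _ x(1)]) simp
    ultimately show False using False by simp
  qed
  then have "indicator {real j / 2^l..<real (Suc j) / 2^l} x *\<^sub>R c j = 0" if "j < 2^l" for j
    using that by simp
  then have "(\<Sum>j<2^l. indicator {real j / 2^l..<real (Suc j) / 2^l} x *\<^sub>R c j) = 0"
    by (intro sum.neutral) simp
  then show ?thesis using False by (simp only: dstep_def if_False)
qed

lemma dstep_integral:
  fixes c :: "nat \<Rightarrow> 'a::euclidean_space"
  shows "has_bochner_integral lborel (dstep l c) ((\<Sum>j<2^l. c j) /\<^sub>R 2 ^ l)"
proof -
  have "has_bochner_integral lborel (\<lambda>x. \<Sum>j<2^l. indicator {real j / 2^l..<real (Suc j) / 2^l} x *\<^sub>R c j)
     (\<Sum>j<2^l. measure lborel {real j / 2^l..<real (Suc j) / 2^l} *\<^sub>R c j)"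
    by (intro has_bochner_integral_sum has_bochner_integral_indicator has_bochner_integral_scaleR_left has_bochner_integral_real_indicator)
       (simp_all add: emeasure_lborel_Ico divide_right_mono)
  moreover have "measure lborel {real j / 2^l..<real (Suc j) / 2^l} = 1 / 2 ^ l" for j
    by (simp add: field_simps)
  ultimately show ?thesis
    by (simp add: dstep_sum[abs_def] scaleR_sum_right divide_inverse)
qed

lemma dstep_refine:
  assumes "l \<le> m"
  shows "dstep l c = dstep m (\<lambda>J. c (J div 2 ^ (m - l)))"
proof
  fix x :: real
  have "nat \<lfloor>2 ^ l * x\<rfloor> = nat \<lfloor>2 ^ m * x\<rfloor> div 2 ^ (m - l)" if "0 \<le> x"
  proof -
    have "\<lfloor>2 ^ l * x\<rfloor> = \<lfloor>2 ^ m * x / real_of_int (2 ^ (m - l))\<rfloor>"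
    proof -
      have "(2::real) ^ m = 2 ^ l * 2 ^ (m - l)" using assms by (metis le_add_diff_inverse power_add)
      then show ?thesis by simp
    qed
    also have "\<dots> = \<lfloor>2 ^ m * x\<rfloor> div 2 ^ (m - l)"
      by (rule floor_divide_real_eq_div) simp
    finally show ?thesis by (simp add: nat_div_distrib' that nat_power_eq)
  qed
  then show "dstep l c x = dstep m (\<lambda>J. c (J div 2 ^ (m - l))) x" by (simp add: dstep_def)
qed

definition dinc :: "(real \<Rightarrow> 'a::real_normed_vector) \<Rightarrow> nat \<Rightarrow> nat \<Rightarrow> 'a" where
  "dinc f l j = f (real (Suc j) / 2 ^ l) - f (real j / 2 ^ l)"

text \<open>The energy of the polygonal interpolation of f at level l: slopes 2^l times the
  increments, squared and integrated over cells of length 2^(-l).\<close>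

definition denergy :: "(real \<Rightarrow> 'a::real_normed_vector) \<Rightarrow> nat \<Rightarrow> real" where
  "denergy f l = 2 ^ l * (\<Sum>j<2^l. (norm (dinc f l j))\<^sup>2)"

lemma sum_dinc: "(\<Sum>j<n. dinc f l j) = f (real n / 2 ^ l) - f 0"
  unfolding dinc_def by (subst sum_lessThan_telescope) simp

lemma sum_block:
  fixes c :: "nat \<Rightarrow> 'a::comm_monoid_add"
  shows "(\<Sum>J<n * k. c J) = (\<Sum>j<n. \<Sum>i<k. c (j * k + i))"
proof -
  have "(\<Sum>J<n * k. c J) = (\<Sum>j<n. sum c {j * k..<j * k + k})"
    by (rule sum.nat_group[symmetric])
  also have "\<dots> = (\<Sum>j<n. \<Sum>i<k. c (j * k + i))"
  proof (rule sum.cong)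
    fix j show "sum c {j * k..<j * k + k} = (\<Sum>i<k. c (j * k + i))"
      using sum.shift_bounds_nat_ivl[of c 0 "j * k" k] by (simp add: atLeast0LessThan add.commute)
  qed simp
  finally show ?thesis .
qed

lemma sum_dinc_block:
  "(\<Sum>i<2^p. dinc f (l + p) (j * 2^p + i)) = dinc f l j"
proof -
  have "(\<Sum>i<2^p. dinc f (l + p) (j * 2^p + i)) =
     (\<Sum>i<2^p. (\<lambda>i. f (real (j * 2^p + i) / 2^(l+p))) (Suc i) - (\<lambda>i. f (real (j * 2^p + i) / 2^(l+p))) i)"
    by (simp add: dinc_def)
  also have "\<dots> = f (real (j * 2^p + 2^p) / 2^(l+p)) - f (real (j * 2^p) / 2^(l+p))"
    by (subst sum_lessThan_telescope) simp
  also have "real (j * 2^p + 2^p) / 2^(l+p) = real (Suc j) / 2^l"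
    by (simp add: power_add field_simps)
  also have "real (j * 2^p) / 2^(l+p) = real j / 2^l"
    by (simp add: power_add)
  also have "f (real (Suc j) / 2^l) - f (real j / 2^l) = dinc f l j" by (simp add: dinc_def)
  finally show ?thesis .
qed

text \<open>Pythagoras for the \<open>L\<^sup>2\<close>-bounded martingale of dyadic difference quotients.\<close>

lemma denergy_diff:
  fixes f :: "real \<Rightarrow> 'a::real_inner"
  shows "(\<Sum>J<2^(l+p). (norm (2 ^ (l+p) *\<^sub>R dinc f (l+p) J - 2 ^ l *\<^sub>R dinc f l (J div 2 ^ p)))\<^sup>2) / 2 ^ (l+p)
     = denergy f (l+p) - denergy f l"
proof -
  define a where "a = (2::real) ^ (l+p)"
  have a: "a > 0" "a = 2 ^ l * 2 ^ p" by (auto simp: a_def power_add)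
  let ?d = "\<lambda>J. dinc f (l+p) J" and ?e = "\<lambda>J. dinc f l (J div 2^p)"
  have split: "(\<Sum>J<2^(l+p). F J) = (\<Sum>j<2^l. \<Sum>i<2^p. F (j * 2^p + i))" for F :: "nat \<Rightarrow> real"
    using sum_block[of F "2^l" "2^p"] by (simp add: power_add)
  have ex: "(norm (a *\<^sub>R ?d J - 2^l *\<^sub>R ?e J))\<^sup>2 = a\<^sup>2 * (norm (?d J))\<^sup>2 - 2 * a * 2^l * (?d J \<bullet> ?e J) + (2^l)\<^sup>2 * (norm (?e J))\<^sup>2" for J
    unfolding power2_norm_eq_inner
    by (simp add: inner_diff_left inner_diff_right inner_commute power2_eq_square algebra_simps)
  have "(\<Sum>J<2^(l+p). ?d J \<bullet> ?e J) = (\<Sum>j<2^l. (\<Sum>i<2^p. dinc f (l+p) (j * 2^p + i)) \<bullet> dinc f l j)"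
    unfolding split by (simp add: inner_sum_left)
  also have "\<dots> = (\<Sum>j<2^l. (norm (dinc f l j))\<^sup>2)"
    by (simp only: sum_dinc_block power2_norm_eq_inner)
  finally have c: "(\<Sum>J<2^(l+p). ?d J \<bullet> ?e J) = (\<Sum>j<2^l. (norm (dinc f l j))\<^sup>2)" .
  have e: "(\<Sum>J<2^(l+p). (norm (?e J))\<^sup>2) = 2 ^ p * (\<Sum>j<2^l. (norm (dinc f l j))\<^sup>2)"
    unfolding split by (simp add: sum_distrib_left)
  have "(\<Sum>J<2^(l+p). (norm (a *\<^sub>R ?d J - 2^l *\<^sub>R ?e J))\<^sup>2) =
     a\<^sup>2 * (\<Sum>J<2^(l+p). (norm (?d J))\<^sup>2) - 2 * a * 2^l * (\<Sum>J<2^(l+p). ?d J \<bullet> ?e J) + (2^l)\<^sup>2 * (\<Sum>J<2^(l+p). (norm (?e J))\<^sup>2)"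
    by (simp add: ex sum.distrib sum_subtractf sum_distrib_left)
  also have "\<dots> = a * (denergy f (l+p) - denergy f l)"
    unfolding c e denergy_def a_def[symmetric] 
    by (simp add: a(2) power2_eq_square algebra_simps)
  finally show ?thesis unfolding a_def[symmetric] using a(1) by simp
qed

lemma denergy_mono:
  fixes f :: "real \<Rightarrow> 'a::real_inner"
  assumes "l \<le> m" shows "denergy f l \<le> denergy f m"
proof -
  have "0 \<le> denergy f (l + (m - l)) - denergy f l"
    unfolding denergy_diff[symmetric] by (intro divide_nonneg_pos sum_nonneg) auto
  then show ?thesis using assms by simp
qed

section \<open>The limit of the dyadic slopes\<close>

definition dderiv :: "(real \<Rightarrow> 'a::real_normed_vector) \<Rightarrow> nat \<Rightarrow> real \<Rightarrow> 'a" where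
  "dderiv f l = dstep l (\<lambda>j. 2 ^ l *\<^sub>R dinc f l j)"

lemma sum_le_sqrt_mean_square:
  fixes c :: "nat \<Rightarrow> real"
  shows "(\<Sum>j<n. c j) / real n \<le> sqrt ((\<Sum>j<n. (c j)\<^sup>2) / real n)"
proof (cases "n = 0")
  case False
  have "(\<Sum>j<n. c j * 1)\<^sup>2 \<le> (\<Sum>j<n. (c j)\<^sup>2) * (\<Sum>j<n. 1\<^sup>2)"
    by (rule Cauchy_Schwarz_ineq_sum)
  then have "((\<Sum>j<n. c j) / real n)\<^sup>2 \<le> (\<Sum>j<n. (c j)\<^sup>2) / real n"
    using False by (simp add: power_divide field_simps power2_eq_square)
  then show ?thesis by (rule real_le_rsqrt)
qed simp

text \<open>At the finer level both slopes are step functions, and on [0,1] the mean is at most the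
  root mean square. The squared L2 distance is the increase of the dyadic energy, by
  Pythagoras.\<close>

lemma dderiv_L1_dist:
  fixes f :: "real \<Rightarrow> 'a::euclidean_space"
  assumes "l \<le> m"
  shows "(LINT x|lborel. norm (dderiv f l x - dderiv f m x)) \<le> sqrt (denergy f m - denergy f l)"
proof -
  define p where "p = m - l"
  have m: "m = l + p" using assms by (simp add: p_def)
  let ?c = "\<lambda>J. 2 ^ m *\<^sub>R dinc f m J - 2 ^ l *\<^sub>R dinc f l (J div 2 ^ p)"
  have eq: "norm (dderiv f l x - dderiv f m x) = dstep m (\<lambda>J. norm (?c J)) x" for x
    unfolding dderiv_def dstep_refine[OF assms] p_def[symmetric]
    by (simp add: dstep_def norm_minus_commute)
  have "(LINT x|lborel. norm (dderiv f l x - dderiv f m x)) = (\<Sum>J<2^m. norm (?c J)) / 2 ^ m"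
    unfolding eq has_bochner_integral_integral_eq[OF dstep_integral] by (simp add: divide_inverse)
  also have "\<dots> \<le> sqrt ((\<Sum>J<2^m. (norm (?c J))\<^sup>2) / 2 ^ m)"
    using sum_le_sqrt_mean_square[of "\<lambda>J. norm (?c J)" "2 ^ m"] by simp
  also have "\<dots> = sqrt (denergy f m - denergy f l)"
    unfolding m denergy_diff ..
  finally show ?thesis .
qed

lemma dstep_restrict:
  assumes "K \<le> 2 ^ l"
  shows "indicator {0..<real K / 2^l} x *\<^sub>R dstep l c x = dstep l (\<lambda>j. if j < K then c j else 0) x"
proof (cases "0 \<le> x \<and> x < 1")
  case True
  have "x < real K / 2 ^ l \<longleftrightarrow> 2 ^ l * x < real_of_int (int K)" by (simp add: field_simps)
  also have "\<dots> \<longleftrightarrow> \<lfloor>2 ^ l * x\<rfloor> < int K" by (rule floor_less_iff[symmetric])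
  also have "\<dots> \<longleftrightarrow> nat \<lfloor>2 ^ l * x\<rfloor> < K" using True by (simp add: nat_less_iff)
  finally show ?thesis using True by (simp add: dstep_def indicator_def)
qed (auto simp: dstep_def)

text \<open>The slopes of level l reproduce f exactly at the grid points of level l, by telescoping.
  This is how f is recovered from the limit of the slopes.\<close>

lemma dderiv_integral_prefix:
  fixes f :: "real \<Rightarrow> 'a::euclidean_space"
  assumes "K \<le> 2 ^ l" "f 0 = 0"
  shows "(LINT x|lborel. indicator {0..<real K / 2^l} x *\<^sub>R dderiv f l x) = f (real K / 2 ^ l)"
proof -
  have "(LINT x|lborel. indicator {0..<real K / 2^l} x *\<^sub>R dderiv f l x)
     = (\<Sum>j<2^l. if j < K then 2 ^ l *\<^sub>R dinc f l j else 0) /\<^sub>R 2 ^ l"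
    unfolding dderiv_def dstep_restrict[OF assms(1)]
    by (rule has_bochner_integral_integral_eq[OF dstep_integral])
  also have "(\<Sum>j<2^l. if j < K then 2 ^ l *\<^sub>R dinc f l j else 0) = (\<Sum>j<K. 2 ^ l *\<^sub>R dinc f l j)"
  proof -
    have "{..<2^l} \<inter> {j. j < K} = {..<K}" using assms(1) by auto
    then show ?thesis by (simp add: sum.If_cases)
  qed
  also have "\<dots> /\<^sub>R 2 ^ l = (\<Sum>j<K. dinc f l j)" by (simp add: scaleR_sum_right)
  also have "\<dots> = f (real K / 2 ^ l)" using assms(2) by (simp add: sum_dinc)
  finally show ?thesis .
qed

lemma integrable_dderiv:
  fixes f :: "real \<Rightarrow> 'a::euclidean_space"
  shows "integrable lborel (dderiv f l)"
  unfolding dderiv_def using dstep_integral by (blast intro: integrable.intros)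

lemma dderiv_energy:
  fixes f :: "real \<Rightarrow> 'a::euclidean_space"
  shows "(\<integral>\<^sup>+x. ennreal ((norm (dderiv f l x))\<^sup>2) \<partial>lborel) = ennreal (denergy f l)"
proof -
  let ?c = "\<lambda>j. (norm (2 ^ l *\<^sub>R dinc f l j))\<^sup>2"
  have eq: "(norm (dderiv f l x))\<^sup>2 = dstep l ?c x" for x
    by (simp add: dderiv_def dstep_def)
  have "(\<integral>\<^sup>+x. ennreal (dstep l ?c x) \<partial>lborel) = ennreal ((\<Sum>j<2^l. ?c j) /\<^sub>R 2 ^ l)"
  proof (rule nn_integral_eq_integral[THEN trans])
    show "integrable lborel (dstep l ?c)" using dstep_integral by (blast intro: integrable.intros)
    show "ennreal (integral\<^sup>L lborel (dstep l ?c)) = ennreal ((\<Sum>j<2^l. ?c j) /\<^sub>R 2 ^ l)"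
      by (simp add: has_bochner_integral_integral_eq[OF dstep_integral])
    show "AE x in lborel. 0 \<le> dstep l ?c x" by (rule AE_I2) (simp add: dstep_def)
  qed
  also have "(\<Sum>j<2^l. ?c j) /\<^sub>R 2 ^ l = denergy f l"
    by (simp add: denergy_def power_mult_distrib sum_distrib_left[symmetric] power2_eq_square[of "2 ^ l"])
  finally show ?thesis unfolding eq .
qed

lemma dyadic_floor_tendsto:
  assumes "0 \<le> t"
  shows "(\<lambda>l. real (nat \<lfloor>2 ^ l * t\<rfloor>) / 2 ^ l) \<longlonglongrightarrow> (t::real)"
proof (rule LIM_zero_cancel, rule Lim_null_comparison)
  have *: "\<bar>real (nat \<lfloor>2 ^ l * t\<rfloor>) / 2 ^ l - t\<bar> \<le> (1/2) ^ l" for l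
    using dyadic_floor_dist[OF assms, of l] by (simp add: power_divide)
  show "\<forall>\<^sub>F l in sequentially. norm (real (nat \<lfloor>2 ^ l * t\<rfloor>) / 2 ^ l - t) \<le> (1/2) ^ l"
    using * by simp
  show "(\<lambda>l. (1/2) ^ l) \<longlonglongrightarrow> (0::real)" by (rule LIMSEQ_power_zero) simp
qed

text \<open>Fatou's lemma, packaged so that an eventual bound on integrals survives an almost
  everywhere limit.\<close>

lemma nn_integral_le_if_AE_tendsto:
  fixes u :: "nat \<Rightarrow> 'a \<Rightarrow> ennreal"
  assumes [measurable]: "\<And>j. u j \<in> borel_measurable M"
    and lim: "AE x in M. (\<lambda>j. u j x) \<longlonglongrightarrow> v x"
    and le: "\<forall>\<^sub>F j in sequentially. (\<integral>\<^sup>+x. u j x \<partial>M) \<le> c"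
  shows "(\<integral>\<^sup>+x. v x \<partial>M) \<le> c"
proof -
  have "AE x in M. v x = liminf (\<lambda>j. u j x)"
    using lim by eventually_elim (simp add: lim_imp_Liminf)
  then have "(\<integral>\<^sup>+x. v x \<partial>M) = (\<integral>\<^sup>+x. liminf (\<lambda>j. u j x) \<partial>M)" by (rule nn_integral_cong_AE)
  also have "\<dots> \<le> liminf (\<lambda>j. \<integral>\<^sup>+x. u j x \<partial>M)" by (rule nn_integral_liminf) simp
  also have "\<dots> \<le> limsup (\<lambda>j. \<integral>\<^sup>+x. u j x \<partial>M)" by (rule Liminf_le_Limsup) simp
  also have "\<dots> \<le> c" by (rule Limsup_bounded[OF le])
  finally show ?thesis .
qed

text \<open>The dyadic energies increase and are bounded, so the slopes are Cauchy in L1 and a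
  subsequence converges almost everywhere to some \<open>g\<close>. Fatou's lemma gives both the
  energy bound and convergence in L1; the latter identifies f with the integral of
  \<open>g\<close>.\<close>

theorem bounded_denergy_imp_density:
  fixes f :: "real \<Rightarrow> 'a::euclidean_space"
  assumes cont: "continuous_on {0..1} f" and f0: "f 0 = 0" and E: "\<And>l. denergy f l \<le> 1"
  shows "\<exists>g. integrable lborel g \<and> energy_density g f"
proof -
  let ?G = "dderiv f"
  have intG: "integrable lborel (?G l)" for l by (rule integrable_dderiv)
  have [measurable]: "?G l \<in> borel_measurable lborel" for l using intG by auto
  have cauchy: "\<exists>N. \<forall>i\<ge>N. \<forall>j\<ge>N. (LINT x|lborel. norm (?G i x - ?G j x)) < e" if "e > 0" for e
  proof -
    obtain L where L: "(\<lambda>l. denergy f l) \<longlonglongrightarrow> L" "\<And>l. denergy f l \<le> L"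
      using incseq_convergent[of "denergy f" 1] E denergy_mono by (metis incseq_def)
    have "\<forall>\<^sub>F l in sequentially. L - e\<^sup>2 < denergy f l"
      using that by (intro order_tendstoD(1)[OF L(1)]) simp
    then obtain N where N: "\<And>l. l \<ge> N \<Longrightarrow> L - e\<^sup>2 < denergy f l"
      by (auto simp: eventually_sequentially)
    have *: "(LINT x|lborel. norm (?G i x - ?G j x)) < e" if ij: "N \<le> i" "i \<le> j" for i j
    proof -
      have "(LINT x|lborel. norm (?G i x - ?G j x)) \<le> sqrt (denergy f j - denergy f i)"
        by (rule dderiv_L1_dist[OF ij(2)])
      also have "\<dots> < sqrt (e\<^sup>2)" using N[OF ij(1)] L(2)[of j] by (intro real_sqrt_less_mono) simp
      finally show ?thesis using \<open>e > 0\<close> by simp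
    qed
    show ?thesis
    proof (intro exI[of _ N] allI impI)
      fix i j assume "N \<le> i" "N \<le> j"
      then show "(LINT x|lborel. norm (?G i x - ?G j x)) < e"
        using *[of i j] *[of j i] by (cases "i \<le> j") (auto simp: norm_minus_commute)
    qed
  qed
  from cauchy_L1_AE_cauchy_subseq[OF intG cauchy]
  obtain r where r: "strict_mono r" "AE x in lborel. Cauchy (\<lambda>i. ?G (r i) x)" by blast
  define g where "g x = lim (\<lambda>i. ?G (r i) x)" for x
  have [measurable]: "g \<in> borel_measurable lborel" unfolding g_def by measurable
  have lim: "AE x in lborel. (\<lambda>i. ?G (r i) x) \<longlonglongrightarrow> g x"
    using r(2) by eventually_elim (simp add: g_def Cauchy_convergent_iff convergent_LIMSEQ_iff)
  let ?D = "\<lambda>i. \<integral>\<^sup>+x. ennreal (norm (?G (r i) x - g x)) \<partial>lborel"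
  have L1: "\<exists>N. \<forall>i\<ge>N. ?D i \<le> ennreal e" if e0: "e > 0" for e
  proof -
    obtain N where N: "\<And>i j. i \<ge> N \<Longrightarrow> j \<ge> N \<Longrightarrow> (LINT x|lborel. norm (?G i x - ?G j x)) < e"
      using cauchy[OF e0] by blast
    show ?thesis
    proof (intro exI[of _ N] allI impI)
      fix i assume i: "N \<le> i"
      show "?D i \<le> ennreal e"
      proof (rule nn_integral_le_if_AE_tendsto)
        show "AE x in lborel. (\<lambda>j. ennreal (norm (?G (r i) x - ?G (r j) x))) \<longlonglongrightarrow> ennreal (norm (?G (r i) x - g x))"
          using lim by eventually_elim (intro tendsto_ennrealI tendsto_norm tendsto_diff tendsto_const)
        show "\<forall>\<^sub>F j in sequentially. (\<integral>\<^sup>+x. ennreal (norm (?G (r i) x - ?G (r j) x)) \<partial>lborel) \<le> ennreal e"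
          using eventually_ge_at_top[of N]
        proof eventually_elim
          fix j assume j: "N \<le> j"
          have "(\<integral>\<^sup>+x. ennreal (norm (?G (r i) x - ?G (r j) x)) \<partial>lborel) = ennreal (LINT x|lborel. norm (?G (r i) x - ?G (r j) x))"
            by (intro nn_integral_eq_integral integrable_norm Bochner_Integration.integrable_diff intG) simp
          also have "\<dots> \<le> ennreal e"
            using N[of "r i" "r j"] i j seq_suble[OF r(1)] by (intro ennreal_leI less_imp_le) (meson order.trans)
          finally show "(\<integral>\<^sup>+x. ennreal (norm (?G (r i) x - ?G (r j) x)) \<partial>lborel) \<le> ennreal e" .
        qed
      qed simp
    qed
  qed
  have intD: "integrable lborel (\<lambda>x. ?G (r i) x - g x)" if "?D i \<le> ennreal e" for i e
    by (rule integrableI_bounded) (use that in \<open>auto intro: le_less_trans\<close>)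
  have intg: "integrable lborel g"
  proof -
    obtain i where "?D i \<le> ennreal 1" using L1[of 1] by auto
    from Bochner_Integration.integrable_diff[OF intG[of "r i"] intD[OF this]] show ?thesis by simp
  qed
  have energy: "(\<integral>\<^sup>+x. ennreal ((norm (g x))\<^sup>2) * indicator {0..1} x \<partial>lborel) \<le> 1"
  proof (rule order.trans[OF nn_integral_mono nn_integral_le_if_AE_tendsto])
    show "AE x in lborel. (\<lambda>j. ennreal ((norm (?G (r j) x))\<^sup>2)) \<longlonglongrightarrow> ennreal ((norm (g x))\<^sup>2)"
      using lim by eventually_elim (intro tendsto_ennrealI tendsto_norm tendsto_power)
    show "\<forall>\<^sub>F j in sequentially. (\<integral>\<^sup>+x. ennreal ((norm (?G (r j) x))\<^sup>2) \<partial>lborel) \<le> 1"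
      unfolding dderiv_energy by (simp add: E)
  qed (auto simp: indicator_def)
  have gon: "g integrable_on {a..b}" for a b
    using integrable_on_lborel[OF intg] integrable_on_subinterval[of g UNIV a b] by simp
  have ind: "(LINT x|lborel. indicator {0..<a} x *\<^sub>R g x) = integral {0..a} g" for a :: real
  proof -
    have "(LINT x|lborel. indicator {0..<a} x *\<^sub>R g x) = (LINT x:{0..a}|lborel. g x)"
      unfolding set_lebesgue_integral_def
    proof (rule integral_cong_AE)
      show "AE x in lborel. indicator {0..<a} x *\<^sub>R g x = indicator {0..a} x *\<^sub>R g x"
        using AE_lborel_singleton[of a] by eventually_elim (auto simp: indicator_def)
    qed auto
    also have "\<dots> = integral {0..a} g"
    proof (rule set_borel_integral_eq_integral(2))
      show "set_integrable lborel {0..a} g"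
        unfolding set_integrable_def by (rule integrable_mult_indicator) (use intg in auto)
    qed
    finally show ?thesis .
  qed
  have fint: "f t = integral {0..t} g" if t: "t \<in> {0..1}" for t
  proof -
    \<comment> \<open>The point approximating t must lie on the same grid as the slope it is used
      with, since only there is the integral of that slope a value of f.\<close>
    define K where "K l = nat \<lfloor>2 ^ l * t\<rfloor>" for l :: nat
    define a where "a l = real (K l) / 2 ^ l" for l
    have Kle: "K l \<le> 2 ^ l" for l
      using dyadic_index_le[of t l] t by (simp add: K_def)
    have a01: "a l \<in> {0..1}" for l
      using Kle[of l] by (simp add: a_def divide_le_eq)
    have at: "a \<longlonglongrightarrow> t"
      unfolding a_def K_def using dyadic_floor_tendsto[of t] t by simp
    have ar: "(\<lambda>i. a (r i)) \<longlonglongrightarrow> t" using LIMSEQ_subseq_LIMSEQ[OF at r(1)] by (simp add: o_def)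
    have "continuous_on {0..1} (\<lambda>x. f x - integral {0..x} g)"
      by (intro continuous_intros cont indefinite_integral_continuous_1 gon)
    then have lim1: "(\<lambda>i. f (a (r i)) - integral {0..a (r i)} g) \<longlonglongrightarrow> f t - integral {0..t} g"
      using ar a01 t by (intro continuous_on_tendsto_compose[of "{0..1}" "\<lambda>x. f x - integral {0..x} g"]) auto
    \<comment> \<open>The error at every grid point is at most the full L1 distance between slope
      and \<open>g\<close>, so the moving endpoint does no harm.\<close>
    have "(\<lambda>i. f (a (r i)) - integral {0..a (r i)} g) \<longlonglongrightarrow> 0"
    proof (rule metric_LIMSEQ_I)
      fix e :: real assume "e > 0"
      then obtain N where N: "\<And>i. i \<ge> N \<Longrightarrow> ?D i \<le> ennreal (e/2)"
        using L1[of "e/2"] by auto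
      show "\<exists>N. \<forall>i\<ge>N. dist (f (a (r i)) - integral {0..a (r i)} g) 0 < e"
      proof (intro exI[of _ N] allI impI)
        fix i assume i: "i \<ge> N"
        note D = intD[OF N[OF i]]
        let ?I = "indicator {0..<a (r i)} :: real \<Rightarrow> real"
        have "f (a (r i)) - integral {0..a (r i)} g = (LINT x|lborel. ?I x *\<^sub>R ?G (r i) x) - (LINT x|lborel. ?I x *\<^sub>R g x)"
          unfolding ind using dderiv_integral_prefix[of "K (r i)" "r i" f] Kle f0 by (simp add: a_def)
        also have "\<dots> = (LINT x|lborel. ?I x *\<^sub>R (?G (r i) x - g x))"
          unfolding scaleR_diff_right
          by (rule Bochner_Integration.integral_diff[symmetric]; rule integrable_mult_indicator; use intG intg in simp)
        also have "norm \<dots> \<le> (LINT x|lborel. norm (?I x *\<^sub>R (?G (r i) x - g x)))"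
          by (rule integral_norm_bound)
        also have "\<dots> \<le> (LINT x|lborel. norm (?G (r i) x - g x))"
        proof (rule integral_mono)
          show "integrable lborel (\<lambda>x. norm (?I x *\<^sub>R (?G (r i) x - g x)))"
            by (intro integrable_norm integrable_mult_indicator D) auto
          show "integrable lborel (\<lambda>x. norm (?G (r i) x - g x))" using D by simp
        qed (auto simp: indicator_def)
        also have "\<dots> \<le> e/2"
        proof -
          have "ennreal (LINT x|lborel. norm (?G (r i) x - g x)) \<le> ennreal (e/2)"
            using N[OF i] D by (subst nn_integral_eq_integral[symmetric]) auto
          then show ?thesis using \<open>e > 0\<close> by (simp add: ennreal_le_iff)
        qed
        finally show "dist (f (a (r i)) - integral {0..a (r i)} g) 0 < e" using \<open>e > 0\<close> by simp
      qed
    qed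
    from LIMSEQ_unique[OF lim1 this] show ?thesis by simp
  qed
  have "(g has_integral (f t - f s)) {s..t}" if "0 \<le> s" "s \<le> t" "t \<le> 1" for s t
  proof -
    have "integral {0..s} g + integral {s..t} g = integral {0..t} g"
      using that by (intro Henstock_Kurzweil_Integration.integral_combine gon) auto
    then have "f t - f s = integral {s..t} g" using that by (simp add: fint[of t] fint[of s] algebra_simps)
    then show ?thesis using gon by (simp add: has_integral_integrable_integral)
  qed
  then show ?thesis using intg energy by (auto simp: energy_density_def)
qed

text \<open>Lebesgue differentiation gives right-hand derivatives of the integral; applied to the
  reflected function it gives the left-hand ones.\<close>

lemma AE_has_vector_derivative_integral:
  fixes f g :: "real \<Rightarrow> 'a::euclidean_space"
  assumes g: "integrable lborel g"
    and dens: "energy_density g f"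
  shows "AE x in lborel. x \<in> {0..1} \<longrightarrow> (f has_vector_derivative g x) (at x)"
proof -
  have gon: "g integrable_on {a..b}" for a b
    using integrable_on_lborel[OF g] integrable_on_subinterval[of g UNIV a b] by simp
  note f = energy_densityD[OF dens]
  obtain N1 where N1: "negligible N1" "\<And>x e. x \<notin> N1 \<Longrightarrow> 0 < e \<Longrightarrow>
      \<exists>d>0. \<forall>h. 0 < h \<and> h < d \<longrightarrow> norm (integral {x..x + h} g /\<^sub>R h - g x) < e"
    using integrable_ccontinuous_explicit[of g] gon by (auto simp: cbox_interval)
  have "(\<lambda>x. g (- x)) integrable_on cbox a b" for a b
    using gon[of "-b" "-a"] Henstock_Kurzweil_Integration.integrable_reflect_real[where f=g and a="-b" and b="-a"] by (simp add: cbox_interval)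
  then obtain N2 where N2: "negligible N2" "\<And>x e. x \<notin> N2 \<Longrightarrow> 0 < e \<Longrightarrow>
      \<exists>d>0. \<forall>h. 0 < h \<and> h < d \<longrightarrow> norm (integral {x..x + h} (\<lambda>x. g (- x)) /\<^sub>R h - g (- x)) < e"
    using integrable_ccontinuous_explicit[of "\<lambda>x. g (- x)"] by (auto simp: cbox_interval)
  \<comment> \<open>The endpoints 0 and 1 are discarded because the derivative is two-sided, while f
    is an integral of \<open>g\<close> only inside [0,1].\<close>
  define N where "N = N1 \<union> uminus ` N2 \<union> {0, 1}"
  have "negligible (uminus ` N2)"
    by (rule negligible_differentiable_image_negligible[OF _ N2(1)])
       (auto intro!: linear_imp_differentiable_on linearI)
  then have "negligible N"
    unfolding N_def using N1(1) by (intro negligible_Un) auto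
  then have "AE x in lborel. x \<notin> N"
    using AE_not_in[of N lebesgue] by (simp add: negligible_iff_null_sets AE_completion_iff)
  then show ?thesis
  proof eventually_elim
    fix x assume x: "x \<notin> N"
    show "x \<in> {0..1} \<longrightarrow> (f has_vector_derivative g x) (at x)"
    proof
      assume "x \<in> {0..1}"
      then have x01: "0 < x" "x < 1" using x by (auto simp: N_def less_le)
      show "(f has_vector_derivative g x) (at x)"
        unfolding has_vector_derivative_def has_derivative_at_alt
      proof (intro conjI allI impI)
        show "bounded_linear (\<lambda>h. h *\<^sub>R g x)" by (rule bounded_linear_scaleR_left)
        fix e :: real assume e: "e > 0"
        have xN: "x \<notin> N1" "- x \<notin> N2" using x by (auto simp: N_def image_iff) 
        obtain d1 where d1: "d1 > 0" "\<And>h. 0 < h \<Longrightarrow> h < d1 \<Longrightarrow> norm (integral {x..x + h} g /\<^sub>R h - g x) < e"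
          using N1(2)[OF xN(1) e] by blast
        obtain d2 where d2: "d2 > 0" "\<And>h. 0 < h \<Longrightarrow> h < d2 \<Longrightarrow> norm (integral {-x..-x + h} (\<lambda>x. g (- x)) /\<^sub>R h - g x) < e"
          using N2(2)[OF xN(2) e] by auto
        show "\<exists>d>0. \<forall>y. norm (y - x) < d \<longrightarrow> norm (f y - f x - (y - x) *\<^sub>R g x) \<le> e * norm (y - x)"
        proof (intro exI[of _ "min (min d1 d2) (min x (1 - x))"] conjI allI impI)
          show "0 < min (min d1 d2) (min x (1 - x))" using d1 d2 x01 by simp
          fix y assume y: "norm (y - x) < min (min d1 d2) (min x (1 - x))"
          have scale: "norm (v - h *\<^sub>R w) \<le> e * h" if "h > 0" "norm (v /\<^sub>R h - w) < e" for v w :: 'a and h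
          proof -
            have "v - h *\<^sub>R w = h *\<^sub>R (v /\<^sub>R h - w)" using that by (simp add: scaleR_diff_right)
            then have "norm (v - h *\<^sub>R w) = h * norm (v /\<^sub>R h - w)" using that(1) by (metis norm_scaleR abs_of_pos)
            then show ?thesis using that by (simp add: mult.commute mult_left_mono)
          qed
          consider "y = x" | "y > x" | "y < x" by linarith
          then show "norm (f y - f x - (y - x) *\<^sub>R g x) \<le> e * norm (y - x)"
          proof cases
            case 2
            then have "integral {x..x + (y - x)} g = f y - f x"
              using f[of x y] x01 y by (intro integral_unique) auto
            with scale[of "y - x" "f y - f x" "g x"] d1(2)[of "y - x"] 2 y show ?thesis by simp
          next
            case 3
            have "integral {y..x} g = f x - f y"
              using f[of y x] x01 y 3 by (intro integral_unique) auto
            moreover have "integral {- x..- x + (x - y)} (\<lambda>x. g (- x)) = integral {y..x} g"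
              using Henstock_Kurzweil_Integration.integral_reflect_real[where f=g and a=y and b=x] by simp
            ultimately have "norm (f x - f y - (x - y) *\<^sub>R g x) \<le> e * (x - y)"
              using scale[of "x - y" "f x - f y" "g x"] d2(2)[of "x - y"] 3 y by simp
            moreover have "f y - f x - (y - x) *\<^sub>R g x = - (f x - f y - (x - y) *\<^sub>R g x)"
              by (simp add: algebra_simps)
            ultimately show ?thesis using 3 by (metis abs_of_neg diff_less_0_iff_less minus_diff_eq norm_minus_cancel real_norm_def)
          qed simp
        qed
      qed
    qed
  qed
qed

section \<open>Functions of energy at most one\<close>

text \<open>A description of energy at most one without derivatives: it can be checked on pointwise
  limits and on finitely many increments at a time. Values outside [0,1] are left free.\<close>

definition finite_energy :: "(real \<Rightarrow> 'a::real_inner) \<Rightarrow> bool" where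
  "finite_energy f \<longleftrightarrow> continuous_on {0..1} f \<and> f 0 = 0 \<and> (\<forall>l. denergy f l \<le> 1)"

lemma dyadic_intervals_disjoint:
  "disjoint_family_on (\<lambda>j. {real j / 2 ^ l<..<real (Suc j) / 2 ^ l}) I"
  unfolding disjoint_family_on_def
proof (intro ballI impI)
  fix i j :: nat assume "i \<noteq> j"
  show "{real i / 2 ^ l<..<real (Suc i) / 2 ^ l} \<inter> {real j / 2 ^ l<..<real (Suc j) / 2 ^ l} = {}"
  proof (rule ccontr)
    assume "\<not> ?thesis"
    then obtain x where "x \<in> {real i / 2 ^ l<..<real (Suc i) / 2 ^ l}" "x \<in> {real j / 2 ^ l<..<real (Suc j) / 2 ^ l}"
      by blast
    then have x: "real i / 2 ^ l < x" "x < real (Suc i) / 2 ^ l" "real j / 2 ^ l < x" "x < real (Suc j) / 2 ^ l"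
      by (simp_all only: greaterThanLessThan_iff)
    then have "nat \<lfloor>2 ^ l * x\<rfloor> = i" "nat \<lfloor>2 ^ l * x\<rfloor> = j"
      using dyadic_index_unique[OF less_imp_le[OF x(1)] x(2)] dyadic_index_unique[OF less_imp_le[OF x(3)] x(4)]
      by blast+
    then show False using \<open>i \<noteq> j\<close> by simp
  qed
qed

text \<open>The estimate for disjoint intervals is used twice: with a single interval it gives
  Hoelder continuity of exponent 1/2, with all cells of one level it bounds the dyadic
  energy.\<close>

lemma finite_energy_norm_increment:
  fixes f :: "real \<Rightarrow> 'a::euclidean_space"
  assumes dens: "energy_density g f"
    and f0: "f 0 = 0"
  shows "\<And>s t. 0 \<le> s \<Longrightarrow> s \<le> t \<Longrightarrow> t \<le> 1 \<Longrightarrow> (norm (f t - f s))\<^sup>2 \<le> t - s"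
    and "finite_energy f"
proof -
  note dis = energy_disjoint_intervals[OF dens]
  show 1: "(norm (f t - f s))\<^sup>2 \<le> t - s" if "0 \<le> s" "s \<le> t" "t \<le> 1" for s t
  proof (cases "s = t")
    case False
    have "(\<Sum>k\<in>{0::nat}. (norm (f t - f s))\<^sup>2 / (t - s)) \<le> 1"
      by (rule dis) (use that False in \<open>auto simp: disjoint_family_on_def\<close>)
    then show ?thesis using that False by (simp add: divide_le_eq)
  qed simp
  have le: "norm (f t - f s) \<le> sqrt \<bar>t - s\<bar>" if "s \<in> {0..1}" "t \<in> {0..1}" for s t
  proof (cases "s \<le> t")
    case True
    then show ?thesis using 1[of s t] that by (intro real_le_rsqrt) auto
  next
    case False
    then have "norm (f s - f t) \<le> sqrt \<bar>t - s\<bar>" using 1[of t s] that by (intro real_le_rsqrt) auto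
    then show ?thesis by (simp add: norm_minus_commute)
  qed
  have "continuous_on {0..1} f"
    unfolding continuous_on_def
  proof
    fix s :: real assume s: "s \<in> {0..1}"
    have "((\<lambda>t. sqrt \<bar>t - s\<bar>) \<longlongrightarrow> sqrt \<bar>s - s\<bar>) (at s within {0..1})"
      by (intro tendsto_intros)
    then have z: "((\<lambda>t. sqrt \<bar>t - s\<bar>) \<longlongrightarrow> 0) (at s within {0..1})" by simp
    have "\<forall>\<^sub>F t in at s within {0..1}. norm (f t - f s) \<le> sqrt \<bar>t - s\<bar>"
      unfolding eventually_at_filter by (rule always_eventually) (use le[OF s] in blast)
    from Lim_null_comparison[OF this z]
    have "((\<lambda>t. f t - f s) \<longlongrightarrow> 0) (at s within {0..1})" .
    then show "(f \<longlongrightarrow> f s) (at s within {0..1})" by (simp add: LIM_zero_iff)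
  qed
  moreover have "denergy f l \<le> 1" for l
  proof -
    have "(\<Sum>j<2^l. (norm (f (real (Suc j) / 2 ^ l) - f (real j / 2 ^ l)))\<^sup>2 / (real (Suc j) / 2 ^ l - real j / 2 ^ l)) \<le> 1"
    proof (rule dis)
      fix j :: nat assume "j \<in> {..<2 ^ l}"
      then show "0 \<le> real j / 2 ^ l \<and> real j / 2 ^ l < real (Suc j) / 2 ^ l \<and> real (Suc j) / 2 ^ l \<le> 1"
        using dyadic_point_in_unit[of j l] by (simp add: divide_strict_right_mono)
    qed (use dyadic_intervals_disjoint in auto)
    moreover have "real (Suc j) / 2 ^ l - real j / 2 ^ l = 1 / 2 ^ l" for j
      by (simp add: diff_divide_distrib[symmetric])
    ultimately show ?thesis
      by (simp only: denergy_def dinc_def sum_distrib_left) (simp add: mult.commute)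
  qed
  ultimately show "finite_energy f" using f0 by (simp add: finite_energy_def)
qed

lemma finite_energy_increment:
  fixes f :: "real \<Rightarrow> 'a::euclidean_space"
  assumes "finite_energy f" "0 \<le> s" "s \<le> t" "t \<le> 1"
  shows "(norm (f t - f s))\<^sup>2 \<le> t - s"
proof -
  from assms(1) have fe: "continuous_on {0..1} f" "f 0 = 0" "\<And>l. denergy f l \<le> 1"
    by (auto simp: finite_energy_def)
  obtain g where "energy_density g f" using bounded_denergy_imp_density[OF fe] by blast
  from finite_energy_norm_increment(1)[OF this] assms show ?thesis
    by (simp add: finite_energy_def)
qed

lemma finite_energy_contraction:
  fixes f :: "real \<Rightarrow> 'a::euclidean_space" and Q :: "'a \<Rightarrow> 'b::euclidean_space"
  assumes "finite_energy f" "linear Q" "\<And>x. norm (Q x) \<le> norm x"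
  shows "finite_energy (\<lambda>t. Q (f t))"
  unfolding finite_energy_def
proof (intro conjI allI)
  show "continuous_on {0..1} (\<lambda>t. Q (f t))"
    using assms(1) by (intro linear_continuous_on_compose[OF _ assms(2)]) (simp add: finite_energy_def)
  show "Q (f 0) = 0" using assms by (simp add: finite_energy_def linear_0)
  fix l
  have "denergy (\<lambda>t. Q (f t)) l \<le> denergy f l"
    unfolding denergy_def dinc_def linear_diff[OF assms(2), symmetric]
    by (intro mult_left_mono sum_mono power_mono assms(3)) auto
  then show "denergy (\<lambda>t. Q (f t)) l \<le> 1" using assms(1) order.trans unfolding finite_energy_def by blast
qed

lemma U_perp_imp_finite_energy:
  fixes f :: "real \<Rightarrow> real^'d"
  assumes "f \<in> U_perp i0"
  shows "finite_energy f"
proof -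
  from assms obtain f' where f0: "f 0 = 0"
    and ac: "\<And>i. abs_continuous_on_interval 0 1 (\<lambda>t. f t $ i)"
    and der: "AE s in lborel. s \<in> {0..1} \<longrightarrow> (f has_vector_derivative f' s) (at s)"
    and E: "(\<integral>\<^sup>+ s. ennreal ((norm (f' s))\<^sup>2) * indicator {0..1} s \<partial>lborel) \<le> 1"
    by (auto simp: U_perp_def)
  obtain N where N: "N \<in> null_sets lborel" "{s. \<not> (s \<in> {0..1} \<longrightarrow> (f has_vector_derivative f' s) (at s))} \<subseteq> N"
    using der by (elim AE_E) (auto simp: null_sets_def)
  \<comment> \<open>Setting the derivative to 0 on a null set that contains all exceptional points
    makes the fundamental theorem applicable and leaves the energy unchanged.\<close>
  define F where "F x = (if x \<in> N then 0 else f' x)" for x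
  have F: "(F has_integral (f t - f s)) {s..t}" if st: "0 \<le> s" "s \<le> t" "t \<le> 1" for s t
  proof -
    have "((\<lambda>x. F x \<bullet> axis i 1) has_integral ((f t - f s) \<bullet> axis i 1)) {s..t}" for i
    proof -
      have "((\<lambda>x. if x \<in> N then 0 else f' x $ i) has_integral (f t $ i - f s $ i)) {s..t}"
      proof (rule absolutely_continuous_has_integral[OF ac st N(1)])
        fix x assume "x \<in> {s..t} - N"
        then have "x \<notin> N" "x \<in> {0..1}" using st by auto
        then have "(f has_vector_derivative f' x) (at x)" using N(2) by blast
        then have "((\<lambda>t. f t $ i) has_vector_derivative f' x $ i) (at x)"
          by (rule bounded_linear.has_vector_derivative[OF bounded_linear_vec_nth])
        then show "((\<lambda>t. f t $ i) has_real_derivative f' x $ i) (at x)"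
          by (simp add: has_real_derivative_iff_has_vector_derivative)
      qed
      then show ?thesis by (simp add: inner_axis F_def if_distrib[of "\<lambda>v. v $ i"] cong: if_cong)
    qed
    then show ?thesis by (subst has_integral_componentwise_iff) (auto simp: Basis_vec_def)
  qed
  have "(\<integral>\<^sup>+ s. ennreal ((norm (F s))\<^sup>2) * indicator {0..1} s \<partial>lborel) = (\<integral>\<^sup>+ s. ennreal ((norm (f' s))\<^sup>2) * indicator {0..1} s \<partial>lborel)"
    using AE_not_in[OF N(1)] by (intro nn_integral_cong_AE) (auto simp: F_def elim!: eventually_mono)
  then have "energy_density F f" using F E by (simp add: energy_density_def)
  then show ?thesis using f0 by (rule finite_energy_norm_increment(2))
qed

text \<open>The density found from dyadic energies is the derivative almost everywhere. For absolute
  continuity \<delta> = e^2 works: by Cauchy-Schwarz the squared sum of increments is at most the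
  total length times the sum of |increment|^2 / length, and that sum is at most 1.\<close>

lemma finite_energy_imp_U_perp:
  fixes f :: "real \<Rightarrow> real^'d"
  assumes f: "finite_energy f" and i0: "\<And>t. f t $ i0 = 0"
  shows "f \<in> U_perp i0"
proof -
  from f have fe: "continuous_on {0..1} f" "f 0 = 0" "\<And>l. denergy f l \<le> 1"
    by (auto simp: finite_energy_def)
  obtain g where gi: "integrable lborel g" and dens: "energy_density g f"
    using bounded_denergy_imp_density[OF fe] by blast
  have "abs_continuous_on_interval 0 1 (\<lambda>t. f t $ i)" for i
    unfolding abs_continuous_on_interval_def
  proof (intro allI impI)
    fix e :: real assume e: "e > 0"
    show "\<exists>\<delta>>0. \<forall>(n::nat) l r. (\<forall>k<n. 0 \<le> l k \<and> l k < r k \<and> r k \<le> 1) \<and>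
        (\<forall>j<n. \<forall>k<n. j \<noteq> k \<longrightarrow> {l j<..<r j} \<inter> {l k<..<r k} = {}) \<and>
        (\<Sum>k<n. r k - l k) < \<delta> \<longrightarrow> (\<Sum>k<n. \<bar>f (r k) $ i - f (l k) $ i\<bar>) < e"
    proof (rule exI[of _ "e\<^sup>2"], rule conjI, use e in simp, intro allI impI, elim conjE)
      fix n :: nat and l r :: "nat \<Rightarrow> real"
      assume lr: "\<forall>k<n. 0 \<le> l k \<and> l k < r k \<and> r k \<le> 1"
        and dj: "\<forall>j<n. \<forall>k<n. j \<noteq> k \<longrightarrow> {l j<..<r j} \<inter> {l k<..<r k} = {}"
        and small: "(\<Sum>k<n. r k - l k) < e\<^sup>2"
      let ?D = "\<lambda>k. norm (f (r k) - f (l k))"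
      have T: "(\<Sum>k<n. (?D k)\<^sup>2 / (r k - l k)) \<le> 1"
      proof (rule energy_disjoint_intervals[OF dens])
        show "disjoint_family_on (\<lambda>k. {l k<..<r k}) {..<n}"
          using dj by (simp only: disjoint_family_on_def Ball_def lessThan_iff)
      qed (use lr in auto)
      have "(\<Sum>k<n. ?D k) = (\<Sum>k<n. sqrt (r k - l k) * (?D k / sqrt (r k - l k)))"
        by (intro sum.cong refl) (use lr in \<open>simp add: less_imp_neq[THEN not_sym]\<close>)
      then have "(\<Sum>k<n. ?D k)\<^sup>2 \<le>
          (\<Sum>k<n. (sqrt (r k - l k))\<^sup>2) * (\<Sum>k<n. (?D k / sqrt (r k - l k))\<^sup>2)"
        by (simp only: Cauchy_Schwarz_ineq_sum)
      also have "(\<Sum>k<n. (sqrt (r k - l k))\<^sup>2) = (\<Sum>k<n. r k - l k)"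
        by (intro sum.cong refl real_sqrt_pow2) (use lr in \<open>simp add: less_imp_le\<close>)
      also have "(\<Sum>k<n. (?D k / sqrt (r k - l k))\<^sup>2) = (\<Sum>k<n. (?D k)\<^sup>2 / (r k - l k))"
        unfolding power_divide
        by (intro sum.cong refl arg_cong2[where f = "(/)"] real_sqrt_pow2) (use lr in \<open>simp add: less_imp_le\<close>)
      also have "(\<Sum>k<n. r k - l k) * \<dots> \<le> (\<Sum>k<n. r k - l k)"
        by (rule mult_left_le[OF T], rule sum_nonneg) (use lr in \<open>simp add: less_imp_le\<close>)
      also have "\<dots> < e\<^sup>2" by (rule small)
      finally have "(\<Sum>k<n. ?D k) < e" using e by (simp add: power2_less_imp_less)
      moreover have "(\<Sum>k<n. \<bar>f (r k) $ i - f (l k) $ i\<bar>) \<le> (\<Sum>k<n. ?D k)"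
        by (intro sum_mono) (metis component_le_norm_cart vector_minus_component)
      ultimately show "(\<Sum>k<n. \<bar>f (r k) $ i - f (l k) $ i\<bar>) < e" by simp
    qed
  qed
  moreover note AE_has_vector_derivative_integral[OF gi dens]
  ultimately show ?thesis using f i0 dens unfolding U_perp_def finite_energy_def energy_density_def by blast
qed

section \<open>Gaussian estimates\<close>

text \<open>The norming at real arguments, since the scales lam^k need not be integers. As
  \<open>sqrt\<close> is negative on negative arguments, estimates assume \<open>ln (ln s)\<close>
  nonnegative or s beyond \<open>exp (exp 1)\<close>.\<close>

definition LL :: "real \<Rightarrow> real" where "LL s = sqrt (2 * s * ln (ln s))"

text \<open>The exponential weight turns the normal density of variance \<sigma>^2 into a multiple
  of the one of variance \<sigma>^2 / (1 - \<rho>); this is the moment generating function of a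
  chi-square variable.\<close>

lemma normal_square_exp_moment:
  assumes Z: "distributed M lborel Z (\<lambda>x. ennreal (normal_density 0 \<sigma> x))"
    and \<sigma>: "\<sigma> > 0" and \<rho>: "0 < \<rho>" "\<rho> < 1"
  shows "(\<integral>\<^sup>+\<omega>. ennreal (exp (\<rho> / (2 * \<sigma>\<^sup>2) * (Z \<omega>)\<^sup>2)) \<partial>M) = ennreal (1 / sqrt (1 - \<rho>))"
proof -
  define \<tau> where "\<tau> = \<sigma> / sqrt (1 - \<rho>)"
  have \<tau>: "\<tau> > 0" "\<tau>\<^sup>2 = \<sigma>\<^sup>2 / (1 - \<rho>)" using \<sigma> \<rho> by (auto simp: \<tau>_def power_divide)
  have dens: "normal_density 0 \<sigma> x * exp (\<rho> / (2 * \<sigma>\<^sup>2) * x\<^sup>2) = 1 / sqrt (1 - \<rho>) * normal_density 0 \<tau> x" for x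
  proof -
    have "exp (- x\<^sup>2 / (2 * \<sigma>\<^sup>2)) * exp (\<rho> / (2 * \<sigma>\<^sup>2) * x\<^sup>2) = exp (- x\<^sup>2 / (2 * \<tau>\<^sup>2))"
      unfolding exp_add[symmetric] \<tau>(2) using \<sigma> \<rho> by (intro arg_cong[where f = exp]) (simp add: field_simps)
    moreover have "1 / sqrt (2 * pi * \<sigma>\<^sup>2) = 1 / sqrt (1 - \<rho>) * (1 / sqrt (2 * pi * \<tau>\<^sup>2))"
      unfolding \<tau>(2) using \<sigma> \<rho> by (simp add: real_sqrt_mult real_sqrt_divide)
    ultimately show ?thesis by (simp add: normal_density_def mult.assoc)
  qed
  have "(\<integral>\<^sup>+\<omega>. ennreal (exp (\<rho> / (2 * \<sigma>\<^sup>2) * (Z \<omega>)\<^sup>2)) \<partial>M)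
      = (\<integral>\<^sup>+x. ennreal (normal_density 0 \<sigma> x) * ennreal (exp (\<rho> / (2 * \<sigma>\<^sup>2) * x\<^sup>2)) \<partial>lborel)"
    by (rule distributed_nn_integral[OF Z, symmetric]) measurable
  also have "\<dots> = (\<integral>\<^sup>+x. ennreal (1 / sqrt (1 - \<rho>) * normal_density 0 \<tau> x) \<partial>lborel)"
    by (intro nn_integral_cong) (simp only: ennreal_mult[symmetric] normal_density_nonneg exp_ge_zero dens)
  also have "\<dots> = ennreal (\<integral>x. 1 / sqrt (1 - \<rho>) * normal_density 0 \<tau> x \<partial>lborel)"
    using \<tau>(1) \<rho> by (intro nn_integral_eq_integral) auto
  also have "\<dots> = ennreal (1 / sqrt (1 - \<rho>))" using \<tau>(1) by simp
  finally show ?thesis .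
qed

text \<open>The interval of length \<open>\<sigma>\<close> ending at \<open>m\<close> on the side of the origin carries enough mass.\<close>

lemma normal_interval_lower_bound:
  assumes Z: "distributed M lborel Z (\<lambda>x. ennreal (normal_density 0 \<sigma> x))" and M: "prob_space M"
    and \<sigma>: "\<sigma> > 0" and w: "w \<ge> \<sigma>"
  shows "exp (- 1 / 2) / sqrt (2 * pi) * exp (- m\<^sup>2 / (2 * \<sigma>\<^sup>2)) \<le> measure M {\<omega> \<in> space M. \<bar>Z \<omega> - m\<bar> \<le> w}"
proof -
  interpret prob_space M by fact
  define a where "a = (if m \<ge> 0 then m - \<sigma> else m)"
  have a: "\<bar>x - m\<bar> \<le> w \<and> x\<^sup>2 \<le> m\<^sup>2 + \<sigma>\<^sup>2" if "x \<in> {a..a+\<sigma>}" for x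
  proof -
    have "\<bar>x\<bar> \<le> \<bar>m\<bar> \<or> \<bar>x\<bar> \<le> \<sigma>" using that by (auto simp: a_def split: if_splits)
    then have "x\<^sup>2 \<le> m\<^sup>2 \<or> x\<^sup>2 \<le> \<sigma>\<^sup>2" using \<sigma> by (metis abs_le_square_iff abs_of_pos)
    then have "x\<^sup>2 \<le> m\<^sup>2 + \<sigma>\<^sup>2" by (auto intro: order.trans)
    then show ?thesis using that w by (auto simp: a_def split: if_splits)
  qed
  \<comment> \<open>A lower bound for the density where x^2 is at most m^2 + \<sigma>^2. The length
    \<sigma> cancels the normalisation, and the extra \<sigma>^2 costs only the factor exp (-1/2),
    so the constant does not depend on \<sigma>.\<close>
  let ?c = "1 / sqrt (2 * pi * \<sigma>\<^sup>2) * exp (- (m\<^sup>2 + \<sigma>\<^sup>2) / (2 * \<sigma>\<^sup>2))"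
  have "ennreal (?c * \<sigma>) = ennreal ?c * ennreal \<sigma>"
    by (rule ennreal_mult) (use \<sigma> in auto)
  also have "\<dots> = (\<integral>\<^sup>+x. ennreal ?c * indicator {a..a+\<sigma>} x \<partial>lborel)"
    using \<sigma> by (subst nn_integral_cmult_indicator) auto
  also have "\<dots> \<le> (\<integral>\<^sup>+x. ennreal (normal_density 0 \<sigma> x) * indicator {x. \<bar>x - m\<bar> \<le> w} x \<partial>lborel)"
  proof (intro nn_integral_mono)
    fix x
    show "ennreal ?c * indicator {a..a+\<sigma>} x \<le> ennreal (normal_density 0 \<sigma> x) * indicator {x. \<bar>x - m\<bar> \<le> w} x"
    proof (cases "x \<in> {a..a+\<sigma>}")
      case True
      have "- (m\<^sup>2 + \<sigma>\<^sup>2) / (2 * \<sigma>\<^sup>2) \<le> - x\<^sup>2 / (2 * \<sigma>\<^sup>2)"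
        using a[OF True] \<sigma> by (intro divide_right_mono) auto
      then have "?c \<le> normal_density 0 \<sigma> x"
        by (simp add: normal_density_def divide_right_mono)
      then show ?thesis using True a[OF True] by (simp add: ennreal_leI)
    qed simp
  qed
  also have "\<dots> = (\<integral>\<^sup>+\<omega>. indicator {x. \<bar>x - m\<bar> \<le> w} (Z \<omega>) \<partial>M)"
    by (rule distributed_nn_integral[OF Z]) measurable
  also have "\<dots> = (\<integral>\<^sup>+\<omega>. indicator {\<omega> \<in> space M. \<bar>Z \<omega> - m\<bar> \<le> w} \<omega> \<partial>M)"
    by (intro nn_integral_cong) (auto simp: indicator_def)
  also have "\<dots> = emeasure M {\<omega> \<in> space M. \<bar>Z \<omega> - m\<bar> \<le> w}"
  proof -
    have [measurable]: "Z \<in> borel_measurable M" using distributed_measurable[OF Z] by simp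
    show ?thesis by (rule nn_integral_indicator) measurable
  qed
  finally have "?c * \<sigma> \<le> measure M {\<omega> \<in> space M. \<bar>Z \<omega> - m\<bar> \<le> w}"
    by (simp add: emeasure_eq_measure)
  moreover have "?c * \<sigma> = exp (- 1 / 2) / sqrt (2 * pi) * exp (- m\<^sup>2 / (2 * \<sigma>\<^sup>2))"
  proof -
    have "- (m\<^sup>2 + \<sigma>\<^sup>2) / (2 * \<sigma>\<^sup>2) = - m\<^sup>2 / (2 * \<sigma>\<^sup>2) + (- 1 / 2)"
      using \<sigma> by (simp add: field_simps)
    then have "exp (- (m\<^sup>2 + \<sigma>\<^sup>2) / (2 * \<sigma>\<^sup>2)) = exp (- m\<^sup>2 / (2 * \<sigma>\<^sup>2)) * exp (- 1 / 2)"
      by (simp only: exp_add)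
    moreover have "sqrt (2 * pi * \<sigma>\<^sup>2) = sqrt (2 * pi) * \<sigma>" using \<sigma> by (simp add: real_sqrt_mult)
    ultimately show ?thesis using \<sigma> by simp
  qed
  ultimately show ?thesis by simp
qed

text \<open>Second Borel--Cantelli lemma. Independence is asked for only as the product formula for
  complements over finite windows, which is what the block construction delivers; then 1 - p \<le>
  exp (-p) finishes.\<close>

lemma (in prob_space) infinitely_often_if_independent:
  assumes E: "\<And>q. E q \<in> events"
    and ind: "\<And>m Q. m < Q \<Longrightarrow> prob (\<Inter>q\<in>{m..<Q}. space M - E q) = (\<Prod>q\<in>{m..<Q}. prob (space M - E q))"
    and div: "\<not> summable (\<lambda>q. prob (E q))"
  shows "AE \<omega> in M. \<exists>\<^sub>\<infinity>q. \<omega> \<in> E q"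
proof -
  have null: "AE \<omega> in M. \<not> (\<forall>q\<ge>m. \<omega> \<notin> E q)" for m
  proof -
    define A where "A = {\<omega> \<in> space M. \<forall>q\<ge>m. \<omega> \<notin> E q}"
    have A: "A \<in> events" unfolding A_def using E by measurable
    have bound: "prob A \<le> exp (- (\<Sum>q\<in>{m..<Q}. prob (E q)))" if "m < Q" for Q
    proof -
      have "prob A \<le> prob (\<Inter>q\<in>{m..<Q}. space M - E q)"
        using that E by (intro finite_measure_mono sets.finite_INT) (auto simp: A_def)
      also have "\<dots> = (\<Prod>q\<in>{m..<Q}. prob (space M - E q))" by (rule ind[OF that])
      also have "\<dots> \<le> (\<Prod>q\<in>{m..<Q}. exp (- prob (E q)))"
      proof (intro prod_mono conjI)
        fix q
        show "prob (space M - E q) \<le> exp (- prob (E q))"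
          using exp_ge_add_one_self[of "- prob (E q)"] prob_compl[OF E[of q]] by simp
      qed simp
      also have "\<dots> = exp (- (\<Sum>q\<in>{m..<Q}. prob (E q)))"
        by (simp add: exp_sum sum_negf[symmetric])
      finally show ?thesis .
    qed
    have "prob A \<le> 0"
    proof (rule field_le_epsilon)
      fix e :: real assume e: "e > 0"
      have "\<not> summable (\<lambda>q. prob (E (q + m)))" using div summable_iff_shift[of "\<lambda>q. prob (E q)" m] by simp
      \<comment> \<open>Divergence pushes some partial sum above |ln e|, which makes the exponential
        bound smaller than e.\<close>
      then have "\<not> (\<forall>n. (\<Sum>q<n. prob (E (q + m))) \<le> \<bar>ln e\<bar>)"
        using summableI_nonneg_bounded[of "\<lambda>q. prob (E (q + m))" "\<bar>ln e\<bar>"] by auto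
      then obtain n where n: "\<bar>ln e\<bar> < (\<Sum>q<n. prob (E (q + m)))" by (auto simp: not_le)
      then have "n > 0" by (cases n) auto
      have "(\<Sum>q\<in>{m..<n+m}. prob (E q)) = (\<Sum>q<n. prob (E (q + m)))"
        using sum.shift_bounds_nat_ivl[of "\<lambda>q. prob (E q)" 0 m n] by (simp add: atLeast0LessThan)
      then have "prob A \<le> exp (- (\<Sum>q<n. prob (E (q + m))))"
        using bound[of "n + m"] \<open>n > 0\<close> by simp
      also have "\<dots> \<le> exp (ln e)" using n by simp
      finally show "prob A \<le> 0 + e" using e by simp
    qed
    then have "A \<in> null_sets M" using A by (auto simp: null_sets_def emeasure_eq_measure measure_le_0_iff)
    then show ?thesis
      by (rule AE_I') (auto simp: A_def)
  qed
  have "AE \<omega> in M. \<forall>m. \<not> (\<forall>q\<ge>m. \<omega> \<notin> E q)"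
    unfolding AE_all_countable using null by blast
  then show ?thesis by eventually_elim (auto simp: INFM_nat_le)
qed

section \<open>Brownian increments and their Chernoff bound\<close>

locale std_bm =
  fixes M :: "'w measure" and B :: "real \<Rightarrow> 'w \<Rightarrow> real^'d"
  assumes BM: "std_brownian_motion M B"

sublocale std_bm \<subseteq> prob_space M
  using BM by (simp add: std_brownian_motion_def)

context std_bm
begin

lemma B_measurable: "t \<ge> 0 \<Longrightarrow> B t \<in> borel_measurable M"
  using BM by (simp add: std_brownian_motion_def)

lemma B_increment: "0 \<le> s \<Longrightarrow> s < t \<Longrightarrow>
    distributed M lborel (\<lambda>\<omega>. (B t \<omega> - B s \<omega>) $ i) (\<lambda>x. ennreal (normal_density 0 (sqrt (t - s)) x))"
  using BM by (simp only: std_brownian_motion_def)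

lemma B_independent: "0 \<le> tt 0 \<Longrightarrow> strict_mono tt \<Longrightarrow>
    indep_vars (\<lambda>_. borel) (\<lambda>p \<omega>. (B (tt (Suc (fst p))) \<omega> - B (tt (fst p)) \<omega>) $ (snd p)) ({..<n} \<times> UNIV)"
  for tt :: "nat \<Rightarrow> real"
  using BM by (simp add: std_brownian_motion_def case_prod_beta')

text \<open>Exponential Markov inequality with parameter \<rho> / (2h) for n times the dimension
  independent squared Gaussians. \<rho> stays free: 1/2 suffices for single increments, while the
  sharp energy bound takes it close to 1, where the prefactor grows but does not depend on the
  scale.\<close>

lemma increments_chernoff:
  assumes t0: "t0 \<ge> 0" and h: "h > 0" and \<rho>: "0 < \<rho>" "\<rho> < 1"
  shows "prob {\<omega> \<in> space M. x \<le> (\<Sum>k<n. (norm (B (t0 + real (Suc k) * h) \<omega> - B (t0 + real k * h) \<omega>))\<^sup>2)}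
     \<le> (1 / sqrt (1 - \<rho>)) ^ (n * CARD('d)) * exp (- \<rho> * x / (2 * h))"
proof -
  define tt where "tt k = t0 + real k * h" for k
  define c where "c = \<rho> / (2 * h)"
  have c: "c > 0" using \<rho> h by (simp add: c_def)
  let ?Z = "\<lambda>p \<omega>. (B (tt (Suc (fst p))) \<omega> - B (tt (fst p)) \<omega>) $ (snd p)"
  let ?I = "{..<n} \<times> (UNIV :: 'd set)"
  let ?S = "\<lambda>\<omega>. \<Sum>k<n. (norm (B (tt (Suc k)) \<omega> - B (tt k) \<omega>))\<^sup>2"
  have "strict_mono tt" using h by (auto simp: strict_mono_def tt_def)
  then have ind: "indep_vars (\<lambda>_. borel) ?Z ?I" using t0 by (intro B_independent) (simp add: tt_def)
  have tt0: "0 \<le> tt k" "tt k < tt (Suc k)" "tt (Suc k) - tt k = h" for k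
    using t0 h by (auto simp: tt_def algebra_simps)
  have S: "?S \<omega> = (\<Sum>p\<in>?I. (?Z p \<omega>)\<^sup>2)" for \<omega>
    unfolding power2_norm_eq_inner by (simp add: sum.cartesian_product' inner_vec_def power2_eq_square)
  have [measurable]: "?S \<in> borel_measurable M"
    using B_measurable tt0(1) by (intro borel_measurable_sum) (measurable, auto)
  have "emeasure M {\<omega> \<in> space M. x \<le> ?S \<omega>} \<le> ennreal (exp (- c * x)) * (\<integral>\<^sup>+\<omega>. ennreal (exp (c * ?S \<omega>)) * indicator (space M) \<omega> \<partial>M)"
    by (rule Chernoff_ineq_nn_integral_ge) (use c in auto)
  also have "(\<integral>\<^sup>+\<omega>. ennreal (exp (c * ?S \<omega>)) * indicator (space M) \<omega> \<partial>M) = (\<integral>\<^sup>+\<omega>. (\<Prod>p\<in>?I. ennreal (exp (c * (?Z p \<omega>)\<^sup>2))) \<partial>M)"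
    by (intro nn_integral_cong) (simp only: S sum_distrib_left exp_sum finite_cartesian_product finite_lessThan finite prod_ennreal exp_ge_zero indicator_simps mult_1_right)
  also have "\<dots> = (\<Prod>p\<in>?I. \<integral>\<^sup>+\<omega>. ennreal (exp (c * (?Z p \<omega>)\<^sup>2)) \<partial>M)"
  proof (rule indep_vars_nn_integral)
    show "indep_vars (\<lambda>_. borel) (\<lambda>p \<omega>. ennreal (exp (c * (?Z p \<omega>)\<^sup>2))) ?I"
      by (rule indep_vars_compose2[OF ind, where Y = "\<lambda>_ z. ennreal (exp (c * z\<^sup>2))"]) measurable
  qed auto
  also have "\<dots> = (\<Prod>p\<in>?I. ennreal (1 / sqrt (1 - \<rho>)))"
  proof (rule prod.cong)
    fix p
    have "distributed M lborel (?Z p) (\<lambda>x. ennreal (normal_density 0 (sqrt h) x))"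
      using B_increment[of "tt (fst p)" "tt (Suc (fst p))" "snd p"] tt0 by simp
    from normal_square_exp_moment[OF this _ \<rho>] h
    show "(\<integral>\<^sup>+\<omega>. ennreal (exp (c * (?Z p \<omega>)\<^sup>2)) \<partial>M) = ennreal (1 / sqrt (1 - \<rho>))"
      by (simp add: c_def)
  qed simp
  also have "\<dots> = ennreal ((1 / sqrt (1 - \<rho>)) ^ (n * CARD('d)))"
    using \<rho> by (simp add: card_cartesian_product ennreal_power)
  finally have "emeasure M {\<omega> \<in> space M. x \<le> ?S \<omega>} \<le> ennreal (exp (- c * x) * (1 / sqrt (1 - \<rho>)) ^ (n * CARD('d)))"
    using \<rho> by (simp add: ennreal_mult)
  then have "prob {\<omega> \<in> space M. x \<le> ?S \<omega>} \<le> exp (- c * x) * (1 / sqrt (1 - \<rho>)) ^ (n * CARD('d))"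
    using \<rho> by (simp add: emeasure_eq_measure)
  then show ?thesis by (simp add: tt_def c_def mult.commute)
qed

end

section \<open>Almost sure bounds along geometric scales\<close>

lemma (in prob_space) prob_union_geometric:
  assumes X: "\<And>j. X j \<in> events" and le: "\<And>j. prob (X j) \<le> C * q ^ Suc j"
    and q: "0 \<le> q" "q \<le> 1 / 2" and C: "0 \<le> C"
  shows "prob (\<Union>j. X j) \<le> 2 * C * q"
proof -
  have sg: "summable (\<lambda>j. C * q ^ Suc j)"
    using summable_geometric[of q] q by (intro summable_mult) (simp add: summable_mult)
  have s: "summable (\<lambda>j. prob (X j))"
    by (rule summable_comparison_test[OF _ sg]) (use le in auto)
  have "prob (\<Union>j. X j) \<le> (\<Sum>j. prob (X j))"
    by (rule finite_measure_subadditive_countably) (use X s in auto)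
  also have "\<dots> \<le> (\<Sum>j. C * q ^ Suc j)" by (rule suminf_le[OF le s sg])
  also have "\<dots> = (\<Sum>j. (C * q) * q ^ j)" by (simp add: mult_ac)
  also have "\<dots> = C * q * (1 / (1 - q))"
    using suminf_mult[of "\<lambda>j. q ^ j" "C * q"] summable_geometric[of q] suminf_geometric[of q] q by simp
  also have "\<dots> \<le> C * q * 2"
    using q C by (intro mult_left_mono) (auto simp: divide_le_eq)
  finally show ?thesis by simp
qed

lemma (in prob_space) eventually_avoided:
  assumes A: "\<And>k. A k \<in> events" and le: "\<And>k. k \<ge> K \<Longrightarrow> prob (A k) \<le> c k" and c: "summable c"
  shows "AE \<omega> in M. \<forall>\<^sub>F k in sequentially. \<omega> \<in> space M - A k"
proof (rule borel_cantelli_AE1[OF A])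
  show "summable (\<lambda>k. prob (A k))"
    by (rule summable_comparison_test[OF _ c]) (use le in auto)
qed (simp add: emeasure_eq_measure)

lemma LL_nonneg: "s \<ge> 0 \<Longrightarrow> ln (ln s) \<ge> 0 \<Longrightarrow> LL s \<ge> 0" and
  LL_square: "s \<ge> 0 \<Longrightarrow> ln (ln s) \<ge> 0 \<Longrightarrow> (LL s)\<^sup>2 = 2 * s * ln (ln s)"
  by (auto simp: LL_def)

context std_bm
begin

text \<open>The bounds \<open>6 (3/4)\<^sup>j\<close> are summable in \<open>j\<close>, while \<open>(6 (3/4)\<^sup>j)\<^sup>2 2\<^sup>j\<close> still grows at least linearly, which
  beats the number \<open>2\<^sup>j\<close> of increments at level \<open>j\<close>.\<close>

lemma dyadic_increments_small:
  "AE \<omega> in M. \<forall>\<^sub>F k in sequentially. \<forall>j\<ge>1. \<forall>i<2^j.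
     norm (B (real (Suc i) * (2^k / 2^j)) \<omega> - B (real i * (2^k / 2^j)) \<omega>) < 6 * (3/4)^j * LL (2^k)"
    (is "AE \<omega> in M. \<forall>\<^sub>F k in sequentially. ?P k \<omega>")
proof -
  define C where "C = (1 / sqrt (1 / 2 :: real)) ^ CARD('d)"
  have C: "C \<ge> 0" by (simp add: C_def)
  define A where "A k j i = {\<omega> \<in> space M. (6 * (3/4)^j * LL (2^k))\<^sup>2 \<le> (norm (B (real (Suc i) * (2^k / 2^j)) \<omega> - B (real i * (2^k / 2^j)) \<omega>))\<^sup>2}"
    for k j i :: nat
  have A_ev: "A k j i \<in> events" for k j i
    unfolding A_def using B_measurable[of "real (Suc i) * (2^k / 2^j)"] B_measurable[of "real i * (2^k / 2^j)"]
    by measurable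
  \<comment> \<open>The factor 2 absorbs the 2^j increments of level j: the union over a level has
    probability at most a multiple of (q k)^j. For k \<ge> 3 this ratio is at most 1/2.\<close>
  define q where "q k = 2 / (real k * ln 2)\<^sup>2" for k :: nat
  have k2: "2 \<le> real k * ln 2" if "k \<ge> 3" for k
  proof -
    have "3 * (2/3) \<le> real k * ln 2" using that ln2_ge_two_thirds by (intro mult_mono) auto
    then show ?thesis by simp
  qed
  have q: "0 \<le> q k" "q k \<le> 1 / 2" if "k \<ge> 3" for k
  proof -
    have "2\<^sup>2 \<le> (real k * ln 2)\<^sup>2" using k2[OF that] by (intro power_mono) auto
    then show "q k \<le> 1 / 2" by (simp add: q_def divide_le_eq)
  qed (simp add: q_def)
  have A_prob: "prob (A k j i) \<le> C * (1 / (real k * ln 2)\<^sup>2) ^ j" if k: "k \<ge> 3" for k j i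
  proof -
    define h where "h = (2::real) ^ k / 2 ^ j"
    define x where "x = (6 * (3/4)^j * LL (2^k))\<^sup>2"
    have h: "h > 0" by (simp add: h_def)
    have lk: "ln (2 ^ k) = real k * ln (2::real)" by (simp add: ln_realpow)
    have l2: "2 \<le> ln ((2::real) ^ k)" using k2[OF k] by (simp add: lk)
    then have l0: "0 \<le> ln (ln ((2::real) ^ k))" by simp
    have "prob (A k j i) \<le> (1 / sqrt (1 - 1/2)) ^ (1 * CARD('d)) * exp (- (1/2) * x / (2 * h))"
      using increments_chernoff[of "real i * h" h "1/2" x 1] h
      by (simp add: A_def x_def h_def[symmetric] algebra_simps)
    also have "- (1/2) * x / (2 * h) = - 18 * (9/8) ^ j * ln (ln (2 ^ k))"
    proof -
      have "x = 36 * (9/16) ^ j * (2 * 2 ^ k * ln (ln (2 ^ k)))"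
        by (simp add: x_def power_mult_distrib LL_square l0 flip: power_mult power2_eq_square)
           (simp add: power_mult mult.commute[of _ 2] power_divide)
      moreover have "(9/8::real) ^ j = (9/16) ^ j * 2 ^ j" by (simp flip: power_mult_distrib)
      ultimately show ?thesis by (simp add: h_def)
    qed
    also have "exp (- 18 * (9/8) ^ j * ln (ln (2 ^ k))) \<le> exp (- 2 * real j * ln (ln (2 ^ k)))"
    proof -
      \<comment> \<open>The exponent 18 (9/8)^j is 6^2 (9/16)^j 2^j / 2. Bernoulli's inequality
        reduces it to 2j, one factor 1/(k ln 2)^2 per level.\<close>
      have "1 + real j * (1/8) \<le> (1 + 1/8) ^ j" by (rule Bernoulli_inequality) simp
      then have "2 * real j \<le> 18 * (9/8) ^ j" by simp
      then show ?thesis using l0 by (simp add: mult_right_mono)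
    qed
    also have "exp (- 2 * real j * ln (ln (2 ^ k))) = (1 / (real k * ln 2)\<^sup>2) ^ j"
    proof -
      have "exp (- 2 * real j * ln (ln (2 ^ k))) = (1 / exp (ln (ln (2 ^ k))) ^ 2) ^ j"
        by (simp add: exp_of_nat_mult[symmetric] exp_minus exp_diff power_divide flip: exp_of_nat_mult power_mult)
           (simp add: exp_minus field_simps)
      then show ?thesis using l2 by (simp add: lk)
    qed
    finally show ?thesis by (simp add: C_def mult_left_mono)
  qed
  \<comment> \<open>Levels start at 1, so the geometric series has no constant term and its sum is
    of order 1/k^2, summable in k.\<close>
  define D where "D k = (\<Union>j. \<Union>i<2^Suc j. A k (Suc j) i)" for k
  have D_ev: "D k \<in> events" for k unfolding D_def using A_ev by (intro sets.countable_UN sets.finite_UN image_subsetI) auto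
  have D_prob: "prob (D k) \<le> 2 * C * q k" if k: "k \<ge> 3" for k
    unfolding D_def
  proof (rule prob_union_geometric[OF _ _ q[OF k] C])
    fix j
    show "(\<Union>i<2^Suc j. A k (Suc j) i) \<in> events" using A_ev by auto
    have "prob (\<Union>i<2^Suc j. A k (Suc j) i) \<le> (\<Sum>i<2^Suc j. prob (A k (Suc j) i))"
      by (rule finite_measure_subadditive_finite) (use A_ev in auto)
    also have "\<dots> \<le> (\<Sum>i<(2::nat)^Suc j. C * (1 / (real k * ln 2)\<^sup>2) ^ Suc j)"
      by (intro sum_mono A_prob k)
    also have "\<dots> = C * q k ^ Suc j"
      by (simp add: q_def power_divide)
    finally show "prob (\<Union>i<2^Suc j. A k (Suc j) i) \<le> C * q k ^ Suc j" .
  qed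
  have "AE \<omega> in M. \<forall>\<^sub>F k in sequentially. \<omega> \<in> space M - D k"
  proof (rule eventually_avoided[OF D_ev D_prob])
    have "2 * C * q k = 4 * C / (ln 2)\<^sup>2 * inverse (real k ^ 2)" for k
      by (simp add: q_def power_mult_distrib divide_inverse mult_ac)
    then show "summable (\<lambda>k. 2 * C * q k)"
      using inverse_power_summable[of 2, where 'a = real] by (simp only: order_refl summable_mult)
  qed
  then show ?thesis
  proof eventually_elim
    fix \<omega> assume "\<forall>\<^sub>F k in sequentially. \<omega> \<in> space M - D k"
    then show "\<forall>\<^sub>F k in sequentially. ?P k \<omega>"
    proof (rule eventually_elim2[OF _ eventually_ge_at_top[of 3]], intro allI impI)
      fix k j i :: nat assume \<omega>: "\<omega> \<in> space M - D k" and "k \<ge> 3" and j: "1 \<le> j" and i: "i < 2 ^ j"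
      obtain j' where j': "j = Suc j'" using j by (cases j) auto
      have "\<omega> \<notin> A k j i" using \<omega> i unfolding D_def j' by blast
      then have lt: "(norm (B (real (Suc i) * (2^k / 2^j)) \<omega> - B (real i * (2^k / 2^j)) \<omega>))\<^sup>2 < (6 * (3/4)^j * LL (2^k))\<^sup>2"
        using \<omega> by (auto simp: A_def not_le)
      have "0 \<le> ln (ln ((2::real) ^ k))" using k2[OF \<open>k \<ge> 3\<close>] by (simp add: ln_realpow)
      then have "0 \<le> 6 * (3/4)^j * LL (2^k)" by (simp add: LL_nonneg)
      with lt show "norm (B (real (Suc i) * (2^k / 2^j)) \<omega> - B (real i * (2^k / 2^j)) \<omega>) < 6 * (3/4)^j * LL (2^k)"
        by (rule power2_less_imp_less)
    qed
  qed
qed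

text \<open>The Chernoff bound with \<rho> = 1/r turns the excess r^2 into the exponent r times ln
  ln of the scale: one factor r is spent on keeping \<rho> below 1, the other makes the
  probabilities, of order k^(-r), summable.\<close>

lemma dyadic_energy_small:
  assumes r: "r > 1" and lam: "lam > 1"
  shows "AE \<omega> in M. \<forall>\<^sub>F k in sequentially.
     (\<Sum>j<2^l. (norm (B (real (Suc j) * (lam^k / 2^l)) \<omega> - B (real j * (lam^k / 2^l)) \<omega>))\<^sup>2) < r\<^sup>2 * (LL (lam^k))\<^sup>2 / 2^l"
    (is "AE \<omega> in M. \<forall>\<^sub>F k in sequentially. ?P k \<omega>")
proof -
  define S where "S k \<omega> = (\<Sum>j<2^l. (norm (B (real (Suc j) * (lam^k / 2^l)) \<omega> - B (real j * (lam^k / 2^l)) \<omega>))\<^sup>2)" for k \<omega>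
  define x where "x k = r\<^sup>2 * (LL (lam^k))\<^sup>2 / 2^l" for k
  define A where "A k = {\<omega> \<in> space M. x k \<le> S k \<omega>}" for k
  define C where "C = (1 / sqrt (1 - 1 / r)) ^ (2 ^ l * CARD('d))"
  have lpos: "lam ^ k > 0" for k using lam by simp
  have "S k \<in> borel_measurable M" for k
    unfolding S_def using B_measurable lpos
    by (intro borel_measurable_sum borel_measurable_power borel_measurable_norm borel_measurable_diff) (auto simp: less_imp_le)
  then have A_ev: "A k \<in> events" for k unfolding A_def by measurable
  define K where "K = nat \<lceil>1 / ln lam\<rceil> + 1"
  have lnl: "ln lam > 0" using lam by simp
  have K: "1 \<le> real k * ln lam" if "k \<ge> K" for k
  proof -
    have "1 / ln lam \<le> real K" unfolding K_def by linarith
    also have "\<dots> \<le> real k" using that by simp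
    finally show ?thesis using lnl by (simp add: divide_le_eq)
  qed
  have A_prob: "prob (A k) \<le> C * (ln lam powr (-r) * real k powr (-r))" if k: "k \<ge> K" for k
  proof -
    define h where "h = lam ^ k / 2 ^ l"
    have h: "h > 0" using lpos by (simp add: h_def)
    have lk: "ln (lam ^ k) = real k * ln lam" using lam by (simp add: ln_realpow)
    have l1: "1 \<le> ln (lam ^ k)" using K[OF k] by (simp add: lk)
    have "prob (A k) \<le> (1 / sqrt (1 - 1 / r)) ^ (2 ^ l * CARD('d)) * exp (- (1 / r) * x k / (2 * h))"
      using increments_chernoff[of 0 h "1/r" "x k" "2 ^ l"] h r
      by (simp add: A_def S_def h_def[symmetric] del: of_nat_Suc)
    also have "- (1 / r) * x k / (2 * h) = - r * ln (ln (lam ^ k))"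
    proof -
      have "(LL (lam ^ k))\<^sup>2 = 2 * lam ^ k * ln (ln (lam ^ k))"
        by (rule LL_square) (use l1 lpos[of k] in auto)
      then show ?thesis using r lam by (simp add: x_def h_def power2_eq_square[of r])
    qed
    also have "exp (- r * ln (ln (lam ^ k))) = (ln (lam ^ k)) powr (- r)"
      using l1 by (simp add: powr_def)
    also have "\<dots> = ln lam powr (-r) * real k powr (-r)"
      using lnl by (simp add: lk powr_mult)
    finally show ?thesis by (simp add: C_def)
  qed
  have "AE \<omega> in M. \<forall>\<^sub>F k in sequentially. \<omega> \<in> space M - A k"
  proof (rule eventually_avoided[OF A_ev A_prob])
    show "summable (\<lambda>k. C * (ln lam powr (-r) * real k powr (-r)))"
      using summable_real_powr_iff[of "-r"] r by (intro summable_mult) simp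
  qed
  then show ?thesis
  proof eventually_elim
    fix \<omega> assume "\<forall>\<^sub>F k in sequentially. \<omega> \<in> space M - A k"
    then show "\<forall>\<^sub>F k in sequentially.
     ?P k \<omega>"
      by (rule eventually_mono) (auto simp only: A_def x_def S_def mem_Collect_eq Diff_iff not_le)
  qed
qed

end

section \<open>Shadowing a prescribed path infinitely often\<close>

context std_bm
begin

text \<open>Following increments LL w over intervals of length h = 2^(l q) has Gaussian cost equal
  to the sum of (LL w)^2 / (2h), which is the energy of \<open>w\<close> times ln ln of the scale
  2^(l (q+1)). Energy at most one therefore leaves a probability of order 1/(q+1), whose sum
  diverges.\<close>

lemma increments_follow_infinitely_often:
  fixes w :: "nat \<times> 'd \<Rightarrow> real"
  assumes l: "l \<ge> 1" and \<delta>: "\<delta> > 0"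
    and w: "2 ^ l * (\<Sum>j\<in>{1..<2^l}. \<Sum>i\<in>UNIV. (w (j, i))\<^sup>2) \<le> 1"
  shows "AE \<omega> in M. \<exists>\<^sub>\<infinity>q. \<forall>j\<in>{1..<2^l}. \<forall>i.
     \<bar>(B (real (Suc j) * 2^(l*q)) \<omega> - B (real j * 2^(l*q)) \<omega>) $ i - LL (2^(l * Suc q)) * w (j, i)\<bar> \<le> \<delta> * LL (2^(l * Suc q))"
    (is "AE \<omega> in M. \<exists>\<^sub>\<infinity>q. ?P q \<omega>")
proof -
  define N where "N = (2::nat) ^ l - 1"
  have "2 ^ 1 \<le> (2::nat) ^ l" using l by (intro power_increasing) auto
  then have N: "N \<ge> 1" "Suc N = 2 ^ l" by (auto simp: N_def)
  \<comment> \<open>The \<open>q\<close>-th block of \<open>N\<close> consecutive steps cuts \<open>[2\<^sup>l\<^sup>q, 2\<^sup>l\<^sup>(\<^sup>q\<^sup>+\<^sup>1\<^sup>)]\<close> into intervals of length \<open>2\<^sup>l\<^sup>q\<close>,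
    so different blocks use disjoint increments.\<close>
  define tt where "tt m = 2 ^ (l * (m div N)) * real (Suc (m mod N))" for m
  have tt_block: "tt (q * N + r) = 2 ^ (l * q) * real (Suc r)" if "r < N" for q r
    using that N by (simp add: tt_def)
  have tt_Suc: "tt (Suc (q * N + r)) = 2 ^ (l * q) * real (Suc (Suc r))" if r: "r < N" for q r
  proof (cases "Suc r < N")
    case True
    then show ?thesis using tt_block[OF True, of q] by simp
  next
    case False
    then have eq: "Suc (q * N + r) = Suc q * N + 0" and "Suc r = N" using r by auto
    have "tt (Suc (q * N + r)) = 2 ^ (l * Suc q)"
      unfolding eq using tt_block[of 0 "Suc q"] N by simp
    also have "\<dots> = 2 ^ (l * q) * real (Suc N)" by (simp add: N power_add)
    finally show ?thesis using \<open>Suc r = N\<close> by simp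
  qed
  have dm: "m = (m div N) * N + m mod N" "m mod N < N" for m using N by auto
  have tt_lt: "tt m < tt (Suc m)" for m
    using tt_block[OF dm(2), of "m div N" m] tt_Suc[OF dm(2), of "m div N" m] dm(1)[of m] by simp
  have mono: "strict_mono tt" using tt_lt by (simp add: strict_mono_Suc_iff)
  have tt0: "0 \<le> tt m" for m by (simp add: tt_def)
  let ?Z = "\<lambda>p \<omega>. (B (tt (Suc (fst p))) \<omega> - B (tt (fst p)) \<omega>) $ (snd p)"
  define L where "L q = LL (2 ^ (l * Suc q))" for q
  define K where "K q = {q * N..<Suc q * N} \<times> (UNIV::'d set)" for q
  \<comment> \<open>Position r in a block corresponds to the dyadic interval with index r + 1, as
    the interval with index 0 is omitted.\<close>
  define T where "T q p = {z::real. \<bar>z - L q * w (Suc (fst p - q * N), snd p)\<bar> \<le> \<delta> * L q}" for q and p :: "nat \<times> 'd"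
  define E where "E q = (\<Inter>p\<in>K q. ?Z p -` T q p \<inter> space M)" for q
  have K: "finite (K q)" "K q \<noteq> {}" "card (K q) = N * CARD('d)" for q
    using N by (auto simp: K_def card_cartesian_product)
  have [measurable]: "T q p \<in> sets borel" for q p unfolding T_def by measurable
  have Zm: "?Z p \<in> borel_measurable M" for p
    using distributed_measurable[OF B_increment[OF tt0 tt_lt]] by simp
  have E_ev: "E q \<in> events" for q
    unfolding E_def using K Zm by (intro sets.finite_INT) (auto intro!: measurable_sets[OF Zm])
  have indZ: "indep_vars (\<lambda>_. borel) ?Z ({..<n} \<times> UNIV)" for n
    by (rule B_independent[OF tt0 mono])
  have ind: "prob (\<Inter>q\<in>{m..<Q}. space M - E q) = (\<Prod>q\<in>{m..<Q}. prob (space M - E q))" if "m < Q" for m Q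
  proof -
    let ?Y = "\<lambda>q \<omega>. restrict (\<lambda>p. ?Z p \<omega>) (K q)"
    have "indep_vars (\<lambda>q. PiM (K q) (\<lambda>_. borel)) ?Y {m..<Q}"
    proof (rule indep_vars_restrict[OF indZ[of "Q * N"]])
      show "K q \<subseteq> {..<Q * N} \<times> UNIV" if "q \<in> {m..<Q}" for q
      proof -
        have "Suc q * N \<le> Q * N" using that by (intro mult_le_mono1) simp
        then show ?thesis unfolding K_def by auto
      qed
      have "disjoint_family_on (\<lambda>q. {q * N..<Suc q * N}) {m..<Q}"
      proof -
        have "k div N = q" if "k \<in> {q * N..<Suc q * N}" for k q
          using that by (auto intro!: div_nat_eqI simp: mult.commute)
        then show ?thesis unfolding disjoint_family_on_def by blast
      qed
      then show "disjoint_family_on K {m..<Q}"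
        unfolding disjoint_family_on_def K_def by blast
    qed
    \<comment> \<open>The complement of the block event is the preimage of a measurable set under
      the increments of that block alone, so independence of blocks yields the product
      formula.\<close>
    note D = indep_varsD[OF this, of "{m..<Q}" "\<lambda>q. {x \<in> space (PiM (K q) (\<lambda>_. borel)). \<not> (\<forall>p\<in>K q. x p \<in> T q p)}"]
    have eq: "?Y q -` {x \<in> space (PiM (K q) (\<lambda>_. borel)). \<not> (\<forall>p\<in>K q. x p \<in> T q p)} \<inter> space M = space M - E q" for q
      using K(2)[of q] by (auto simp: E_def space_PiM)
    show ?thesis
      using D[unfolded eq] that
    proof -
      have "{x \<in> space (PiM (K q) (\<lambda>_. borel)). \<not> (\<forall>p\<in>K q. x p \<in> T q p)} \<in> sets (PiM (K q) (\<lambda>_. borel))" for q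
        using K(1,2)[of q] by (intro sets.sets_Collect_neg sets.sets_Collect_finite_All') measurable
      then show ?thesis using D[unfolded eq] that by simp
    qed
  qed
  define c where "c = exp (- 1 / 2) / sqrt (2 * pi)"
  have c: "c > 0" by (simp add: c_def)
  \<comment> \<open>One factor c for each component of each increment in the block; the denominator
    comes from ln (2^(l (q+1))) = l (q+1) ln 2.\<close>
  define C where "C = c ^ (N * CARD('d)) / (real l * ln 2)"
  have C: "C > 0" using c l by (simp add: C_def)
  have E_prob: "C * inverse (real (Suc q)) \<le> prob (E q)" if q: "1 / \<delta>\<^sup>2 \<le> ln (ln (2 ^ (l * Suc q)))" for q
  proof -
    define h where "h = (2::real) ^ (l * q)"
    define u where "u = ln (ln ((2::real) ^ (l * Suc q)))"
    have h: "h > 0" by (simp add: h_def)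
    have lk: "ln ((2::real) ^ (l * Suc q)) = real l * real (Suc q) * ln 2"
      by (simp add: ln_realpow distrib_left)
    have pos: "0 < ln ((2::real) ^ (l * Suc q))" unfolding lk using l by simp
    have u0: "0 < 1 / \<delta>\<^sup>2" using \<delta> by simp
    have u: "u \<ge> 0" unfolding u_def using order.trans[OF less_imp_le[OF u0] q] .
    have "(L q)\<^sup>2 = 2 * 2 ^ (l * Suc q) * u"
      unfolding L_def u_def by (rule LL_square) (use u in \<open>simp_all only: u_def zero_le_power zero_le_numeral\<close>)
    then have L2: "(L q)\<^sup>2 = 2 * h * 2 ^ l * u"
      by (simp add: h_def power_add)
    have L0: "0 \<le> L q"
      unfolding L_def by (rule LL_nonneg) (use u in \<open>simp_all only: u_def zero_le_power zero_le_numeral\<close>)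
    \<comment> \<open>Makes the tolerance \<delta> L at least one standard deviation
      \<open>sqrt h\<close>, as the Gaussian lower bound requires.\<close>
    have "h \<le> \<delta>\<^sup>2 * (L q)\<^sup>2"
    proof -
      have "1 / \<delta>\<^sup>2 \<le> u" unfolding u_def by (rule q)
      then have "1 \<le> \<delta>\<^sup>2 * u" using \<delta> by (simp add: divide_le_eq mult.commute)
      moreover have "1 \<le> (2::real) * 2 ^ l" using one_le_power[of "2::real" "Suc l"] by simp
      ultimately have "1 * 1 \<le> (2 * 2 ^ l) * (\<delta>\<^sup>2 * u)"
        by (intro mult_mono) auto
      then have "h * 1 \<le> h * ((2 * 2 ^ l) * (\<delta>\<^sup>2 * u))" using h by (intro mult_left_mono) auto
      then show ?thesis by (simp add: L2 mult_ac)
    qed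
    then have wid: "sqrt h \<le> \<delta> * L q"
      using \<delta> L0 by (intro real_le_lsqrt) (auto simp: power_mult_distrib h less_imp_le)
    define m where "m p = L q * w (Suc (fst p - q * N), snd p)" for p :: "nat \<times> 'd"
    have lower: "c * exp (- (m p)\<^sup>2 / (2 * h)) \<le> prob (?Z p -` T q p \<inter> space M)" if p: "p \<in> K q" for p
    proof -
      define r where "r = fst p - q * N"
      have r: "fst p = q * N + r" "r < N" using p by (auto simp: K_def r_def)
      have "tt (Suc (fst p)) - tt (fst p) = h"
        unfolding r(1) tt_block[OF r(2)] tt_Suc[OF r(2)] by (simp add: h_def algebra_simps)
      then have "distributed M lborel (?Z p) (\<lambda>x. ennreal (normal_density 0 (sqrt h) x))"
        using B_increment[OF tt0 tt_lt, of "fst p" "snd p"] by simp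
      from normal_interval_lower_bound[OF this prob_space_axioms _ wid, of "m p"] h
      have "c * exp (- (m p)\<^sup>2 / (2 * h)) \<le> prob {\<omega> \<in> space M. \<bar>?Z p \<omega> - m p\<bar> \<le> \<delta> * L q}"
        by (simp add: c_def)
      also have "{\<omega> \<in> space M. \<bar>?Z p \<omega> - m p\<bar> \<le> \<delta> * L q} = ?Z p -` T q p \<inter> space M"
        by (auto simp: T_def m_def)
      finally show ?thesis .
    qed
    have sumw: "(\<Sum>p\<in>K q. (m p)\<^sup>2) / (2 * h) \<le> u"
    proof -
      have "(\<Sum>p\<in>K q. (w (Suc (fst p - q * N), snd p))\<^sup>2) = (\<Sum>k\<in>{q * N..<Suc q * N}. \<Sum>i\<in>UNIV. (w (Suc (k - q * N), i))\<^sup>2)"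
        unfolding K_def by (simp add: sum.cartesian_product')
      also have "\<dots> = (\<Sum>j\<in>{1..<2^l}. \<Sum>i\<in>UNIV. (w (j, i))\<^sup>2)"
        by (rule sum.reindex_bij_witness[where i = "\<lambda>j. q * N + (j - 1)" and j = "\<lambda>k. Suc (k - q * N)"])
           (use N in auto)
      finally have "(\<Sum>p\<in>K q. (m p)\<^sup>2) / (2 * h) = u * (2 ^ l * (\<Sum>j\<in>{1..<2^l}. \<Sum>i\<in>UNIV. (w (j, i))\<^sup>2))"
        using h by (simp add: m_def power_mult_distrib L2 sum_distrib_left[symmetric])
      also have "\<dots> \<le> u * 1" using u w by (intro mult_left_mono) auto
      finally show ?thesis by simp
    qed
    have "exp (- u) = inverse (real l * real (Suc q) * ln 2)"
      using exp_ln[OF pos] by (simp only: u_def exp_minus lk)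
    then have "C * inverse (real (Suc q)) = c ^ (N * CARD('d)) * exp (- u)"
      by (simp add: C_def divide_inverse mult_ac del: of_nat_Suc)
    also have "\<dots> \<le> c ^ (N * CARD('d)) * exp (- ((\<Sum>p\<in>K q. (m p)\<^sup>2) / (2 * h)))"
      using sumw c by (intro mult_left_mono) auto
    also have "\<dots> = (\<Prod>p\<in>K q. c * exp (- (m p)\<^sup>2 / (2 * h)))"
      by (simp add: prod.distrib K exp_sum[OF K(1), symmetric] sum_negf sum_divide_distrib)
    also have "\<dots> \<le> (\<Prod>p\<in>K q. prob (?Z p -` T q p \<inter> space M))"
      using c lower by (intro prod_mono) auto
    also have "\<dots> = prob (E q)"
      unfolding E_def
    proof (rule indep_varsD_finite[symmetric])
      show "indep_vars (\<lambda>_. borel) ?Z (K q)"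
        by (rule indep_vars_subset[OF indZ[of "Suc q * N"]]) (auto simp: K_def)
    qed (use K in auto)
    finally show ?thesis .
  qed
  have "\<not> summable (\<lambda>q. prob (E q))"
  proof
    assume s: "summable (\<lambda>q. prob (E q))"
    have "filterlim (\<lambda>q. ln (ln ((2::real) ^ (l * Suc q)))) at_top sequentially"
    proof -
      have "filterlim (\<lambda>q. (real l * ln 2) * real (Suc q)) at_top sequentially"
        using l by (intro filterlim_tendsto_pos_mult_at_top[OF tendsto_const] filterlim_compose[OF filterlim_real_sequentially filterlim_Suc]) auto
      then have "filterlim (\<lambda>q. ln ((real l * ln 2) * real (Suc q))) at_top sequentially"
        by (rule filterlim_compose[OF ln_at_top])
      then show ?thesis by (simp add: ln_realpow algebra_simps)
    qed
    then have "\<forall>\<^sub>F q in sequentially. 1 / \<delta>\<^sup>2 \<le> ln (ln ((2::real) ^ (l * Suc q)))"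
      by (simp add: filterlim_at_top)
    then have "\<forall>\<^sub>F q in sequentially. norm (C * inverse (real (Suc q))) \<le> prob (E q)"
      by (rule eventually_mono) (use E_prob C in auto)
    from summable_comparison_test_ev[OF this s]
    have "summable (\<lambda>q. inverse C * (C * inverse (real (Suc q))))" by (rule summable_mult)
    then have "summable (\<lambda>q. inverse (real (Suc q)))" using C by (simp add: mult.assoc[symmetric])
    then have "summable (\<lambda>q. inverse (real q))" by (subst (asm) summable_Suc_iff)
    then show False using not_summable_harmonic[where 'a = real] by simp
  qed
  from infinitely_often_if_independent[OF E_ev ind this]
  have "AE \<omega> in M. \<exists>\<^sub>\<infinity>q. \<omega> \<in> E q" .
  then show ?thesis
  proof eventually_elim
    fix \<omega> assume "\<exists>\<^sub>\<infinity>q. \<omega> \<in> E q"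
    then show "\<exists>\<^sub>\<infinity>q. ?P q \<omega>"
    proof (rule INFM_mono, intro ballI allI)
      fix q j :: nat and i :: 'd assume \<omega>: "\<omega> \<in> E q" and j: "j \<in> {1..<2^l}"
      define r where "r = j - 1"
      have r: "j = Suc r" "r < N" using j N by (auto simp: r_def)
      have "(q * N + r, i) \<in> K q" using r by (simp add: K_def)
      then have "?Z (q * N + r, i) \<omega> \<in> T q (q * N + r, i)" using \<omega> unfolding E_def by blast
      then show "\<bar>(B (real (Suc j) * 2^(l*q)) \<omega> - B (real j * 2^(l*q)) \<omega>) $ i - LL (2^(l * Suc q)) * w (j, i)\<bar> \<le> \<delta> * LL (2^(l * Suc q))"
        by (simp add: T_def tt_block[OF r(2)] tt_Suc[OF r(2)] L_def r(1) mult.commute[of "2 ^ (l * q)"] del: of_nat_Suc mult_Suc_right)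
    qed
  qed
qed

end

section \<open>Chaining\<close>

lemma chaining_step:
  fixes F :: "real \<Rightarrow> 'a::real_normed_vector"
  assumes inc: "\<And>j i. 1 \<le> j \<Longrightarrow> i < 2^j \<Longrightarrow> norm (F (real (Suc i) / 2^j) - F (real i / 2^j)) \<le> K * (3/4)^j"
    and j: "1 \<le> j" and ab: "a \<le> b" "b \<le> Suc a" "b \<le> 2^j" and K: "0 \<le> K"
  shows "norm (F (real b / 2^j) - F (real a / 2^j)) \<le> K * (3/4)^j"
proof (cases "b = a")
  case False
  then have "b = Suc a" "a < 2^j" using ab by auto
  then show ?thesis using inc[OF j] by blast
qed (use K in simp)

text \<open>7 = 3 + 1 + 3: each point is joined to its lower neighbour on grid m at the price of the
  tail of (3/4)^j over j > m, which is 3 (3/4)^m, and the two neighbours are equal or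
  adjacent.\<close>

lemma chaining:
  fixes F :: "real \<Rightarrow> 'a::real_normed_vector"
  assumes cont: "continuous_on {0..1} F"
    and inc: "\<And>j i. 1 \<le> j \<Longrightarrow> i < 2^j \<Longrightarrow> norm (F (real (Suc i) / 2^j) - F (real i / 2^j)) \<le> K * (3/4)^j"
    and K: "0 \<le> K" and m: "1 \<le> m" and st: "s \<in> {0..1}" "t \<in> {0..1}" "\<bar>s - t\<bar> \<le> 1 / 2^m"
  shows "norm (F s - F t) \<le> 7 * K * (3/4)^m"
proof -
  define d where "d j t = nat \<lfloor>2^j * t\<rfloor>" for j and t :: real
  define A where "A j t = F (real (d j t) / 2^j)" for j and t :: real
  have lim: "norm (F t - A m t) \<le> 3 * K * (3/4)^m" if t: "t \<in> {0..1}" for t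
  proof -
    have dle: "d j t \<le> 2^j" for j using dyadic_index_le[of t j] t by (simp add: d_def)
    have step: "norm (A (Suc j) t - A j t) \<le> K * (3/4)^Suc j" for j
    proof -
      have "0 \<le> \<lfloor>2^j * t\<rfloor>" using t by simp
      \<comment> \<open>The grid point of level j has index 2d at level j + 1, so passing to the
        next level moves by at most one cell.\<close>
      moreover have "2 * \<lfloor>2^j * t\<rfloor> \<le> \<lfloor>2^Suc j * t\<rfloor>" "\<lfloor>2^Suc j * t\<rfloor> \<le> 2 * \<lfloor>2^j * t\<rfloor> + 1"
        by (simp_all add: mult.assoc) linarith+
      ultimately have "2 * d j t \<le> d (Suc j) t" "d (Suc j) t \<le> Suc (2 * d j t)"
        unfolding d_def by linarith+
      from chaining_step[OF inc _ this dle K]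
      have "norm (A (Suc j) t - F (real (2 * d j t) / 2^Suc j)) \<le> K * (3/4)^Suc j" by (simp add: A_def)
      then show ?thesis by (simp add: A_def)
    qed
    \<comment> \<open>The right-hand side is K times the sum of (3/4)^j for m < j \<le> m + n, in
      closed form.\<close>
    have *: "norm (A (m + n) t - A m t) \<le> 3 * K * ((3/4)^m - (3/4)^(m+n))" for n
    proof (induction n)
      case (Suc n)
      have "norm (A (m + Suc n) t - A m t)
        \<le> norm (A (Suc (m + n)) t - A (m + n) t) +
          norm (A (m + n) t - A m t)"
        using norm_triangle_ineq[of "A (Suc (m + n)) t - A (m + n) t"
            "A (m + n) t - A m t"] by simp
      also have "\<dots> \<le> K * (3/4)^Suc (m + n) + 3 * K * ((3/4)^m - (3/4)^(m+n))"
        by (intro add_mono step Suc.IH)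
      also have "\<dots> = 3 * K * ((3/4)^m - (3/4)^(m + Suc n))" by (simp add: algebra_simps)
      finally show ?case .
    qed simp
    have b: "norm (A (n + m) t - A m t) \<le> 3 * K * (3/4)^m" for n
    proof -
      have "3 * K * ((3/4)^m - (3/4)^(m+n)) \<le> 3 * K * (3/4)^m" using K by (intro mult_left_mono) auto
      with *[of n] show ?thesis by (simp add: add.commute)
    qed
    have "(\<lambda>l. real (d l t) / 2^l) \<longlonglongrightarrow> t" unfolding d_def by (rule dyadic_floor_tendsto) (use t in simp)
    then have "(\<lambda>l. A l t) \<longlonglongrightarrow> F t"
      unfolding A_def
    proof (rule continuous_on_tendsto_compose[OF cont _ t])
      show "\<forall>\<^sub>F l in sequentially. real (d l t) / 2^l \<in> {0..1}"
        using dle by (intro always_eventually) (simp add: divide_le_eq)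
    qed
    then have "(\<lambda>n. A (n + m) t) \<longlonglongrightarrow> F t" by (rule LIMSEQ_ignore_initial_segment)
    then have "(\<lambda>n. norm (A (n + m) t - A m t)) \<longlonglongrightarrow> norm (F t - A m t)"
      by (intro tendsto_intros)
    then show ?thesis by (rule LIMSEQ_le_const2) (use b in auto)
  qed
  have main: "norm (F s - F t) \<le> 7 * K * (3/4)^m" if st: "s \<in> {0..1}" "t \<in> {0..1}" "s \<le> t" "t - s \<le> 1 / 2^m" for s t
  proof -
    have "2^m * t \<le> 2^m * s + 1" using st(4) by (simp add: field_simps)
    then have "\<lfloor>2^m * t\<rfloor> \<le> \<lfloor>2^m * s\<rfloor> + 1" "\<lfloor>2^m * s\<rfloor> \<le> \<lfloor>2^m * t\<rfloor>" using st(3) by (linarith, intro floor_mono mult_left_mono) auto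
    moreover have "0 \<le> \<lfloor>2^m * s\<rfloor>" using st by simp
    ultimately have "d m s \<le> d m t" "d m t \<le> Suc (d m s)" unfolding d_def by linarith+
    from chaining_step[OF inc m this _ K] dyadic_index_le[of t m] st
    have "norm (A m t - A m s) \<le> K * (3/4)^m" by (simp add: A_def d_def)
    then have 1: "norm (A m s - A m t) \<le> K * (3/4)^m" by (simp add: norm_minus_commute)
    have "norm (F s - F t) \<le> norm (F s - A m s) + norm (A m s - A m t)
       + norm (A m t - F t)"
      using norm_triangle_ineq[of "F s - A m s" "A m s - A m t"]
        norm_triangle_ineq[of "F s - A m t" "A m t - F t"] by simp
    also have "\<dots> \<le> 3 * K * (3/4)^m + K * (3/4)^m + 3 * K * (3/4)^m"
      using lim[OF st(1)] lim[OF st(2)] 1 by (intro add_mono) (simp_all add: norm_minus_commute)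
    finally show ?thesis by simp
  qed
  show ?thesis
    using main[of s t] main[of t s] st by (cases "s \<le> t") (auto simp: norm_minus_commute)
qed

section \<open>Growth of the iterated-logarithm norming\<close>

lemma exp_exp_1_bounds: "s \<ge> exp (exp 1) \<Longrightarrow> 1 < s \<and> 1 \<le> ln s \<and> 1 \<le> ln (ln s)" for s :: real
proof -
  assume s: "s \<ge> exp (exp 1)"
  have e: "exp 1 \<ge> (1::real)" by simp
  have e2: "exp (exp 1) > (1::real)" by simp
  have s1: "1 < s" using s e2 by linarith
  have "ln (exp (exp 1)) \<le> ln s" using s s1 by (subst ln_le_cancel_iff) auto
  then have l: "exp 1 \<le> ln s" by simp
  then have "ln (exp 1) \<le> ln (ln s)" using e by (subst ln_le_cancel_iff) (auto intro: less_le_trans[OF exp_gt_zero])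
  then have "1 \<le> ln (ln s)" by simp
  moreover have "1 \<le> ln s" using e l by linarith
  ultimately show ?thesis using s1 by simp
qed

lemma LL_pos: "s \<ge> exp (exp 1) \<Longrightarrow> LL s > 0"
proof -
  assume "s \<ge> exp (exp 1)"
  then have "0 < s" "0 < ln (ln s)" using exp_exp_1_bounds[of s] by linarith+
  then have "0 < s * ln (ln s)" by (rule mult_pos_pos)
  then show ?thesis by (simp add: LL_def)
qed

lemma LL_mono: "exp (exp 1) \<le> s \<Longrightarrow> s \<le> t \<Longrightarrow> LL s \<le> LL t"
proof -
  assume s: "exp (exp 1) \<le> s" and st: "s \<le> t"
  note b = exp_exp_1_bounds[OF s]
  then have "ln s \<le> ln t" using st by simp
  then have "ln (ln s) \<le> ln (ln t)" using b by (subst ln_le_cancel_iff) auto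
  then have "s * ln (ln s) \<le> t * ln (ln t)" using b st by (intro mult_mono) auto
  then show ?thesis unfolding LL_def by (intro real_sqrt_le_mono) simp
qed

text \<open>From ln c \<le> c - 1 and both logarithms of s being at least 1, each logarithm grows at
  most by the factor c. The linear bound is crude, but it is applied only with c = 2 and with c
  close to 1.\<close>

lemma LL_scale:
  assumes c: "c \<ge> 1" and s: "s \<ge> exp (exp 1)"
  shows "LL (c * s) \<le> c * LL s"
proof -
  note b = exp_exp_1_bounds[OF s]
  have "ln (c * s) = ln c + ln s" using b c by (simp add: ln_mult)
  also have "\<dots> \<le> c * ln s"
  proof -
    have "ln c \<le> (c - 1) * 1" using ln_le_minus_one[of c] c by simp
    also have "\<dots> \<le> (c - 1) * ln s" using b c by (intro mult_left_mono) auto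
    finally show ?thesis by (simp add: algebra_simps)
  qed
  finally have 1: "ln (c * s) \<le> c * ln s" .
  have "0 < ln (c * s)" using b c \<open>ln (c * s) = ln c + ln s\<close> by (smt (verit) ln_ge_zero)
  then have "ln (ln (c * s)) \<le> ln (c * ln s)" using 1 by (subst ln_le_cancel_iff) auto
  also have "\<dots> = ln c + ln (ln s)" using b c by (simp add: ln_mult)
  also have "\<dots> \<le> c * ln (ln s)"
  proof -
    have "ln c \<le> (c - 1) * 1" using ln_le_minus_one[of c] c by simp
    also have "\<dots> \<le> (c - 1) * ln (ln s)" using b c by (intro mult_left_mono) auto
    finally show ?thesis by (simp add: algebra_simps)
  qed
  finally have "2 * (c * s) * ln (ln (c * s)) \<le> 2 * (c * s) * (c * ln (ln s))"
    using b c by (intro mult_left_mono) auto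
  then have "LL (c * s) \<le> sqrt (c\<^sup>2 * (2 * s * ln (ln s)))"
    unfolding LL_def by (intro real_sqrt_le_mono) (simp add: power2_eq_square mult_ac)
  also have "\<dots> = c * LL s" using c unfolding LL_def real_sqrt_mult by simp
  finally show ?thesis .
qed

lemma power_bracket:
  fixes lam s :: real
  assumes "lam > 1" "s \<ge> 1"
  obtains k where "lam ^ k \<le> s" "s < lam ^ Suc k"
proof -
  define n where "n = (LEAST n. s < lam ^ n)"
  have ex: "\<exists>n. s < lam ^ n" using real_arch_pow[OF assms(1)] .
  have n: "s < lam ^ n" unfolding n_def using ex by (rule LeastI_ex)
  then obtain k where k: "n = Suc k" using assms(2) by (cases n) auto
  have "\<not> s < lam ^ k" using not_less_Least[of k "\<lambda>n. s < lam ^ n"] k n_def by simp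
  then show ?thesis using that[of k] n k by (simp add: not_less)
qed

section \<open>Rescaled paths\<close>

definition scaled_path :: "(real \<Rightarrow> 'a::real_normed_vector) \<Rightarrow> real \<Rightarrow> real \<Rightarrow> 'a" where
  "scaled_path b s t = (1 / LL s) *\<^sub>R b (s * t)"

lemma scaled_path_modulus_dyadic_scale:
  fixes b :: "real \<Rightarrow> 'a::real_normed_vector"
  assumes cont: "continuous_on {0..} b"
    and inc: "\<And>j i. 1 \<le> j \<Longrightarrow> i < 2^j \<Longrightarrow>
      norm (b (real (Suc i) * (2^k / 2^j)) - b (real i * (2^k / 2^j))) < 6 * (3/4)^j * LL (2^k)"
    and LL: "LL (2^k) \<ge> 0" and m: "1 \<le> m" and uv: "u \<in> {0..1}" "v \<in> {0..1}" "\<bar>u - v\<bar> \<le> 1 / 2^m"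
  shows "norm (b (2^k * u) - b (2^k * v)) \<le> 42 * LL (2^k) * (3/4)^m"
proof -
  \<comment> \<open>Chaining with K = 6 LL (2^k), whence 42 = 7 * 6.\<close>
  have "norm (b (2^k * u) - b (2^k * v)) \<le> 7 * (6 * LL (2^k)) * (3/4)^m"
  proof (rule chaining[where F = "\<lambda>x. b (2^k * x)", OF _ _ _ m uv])
    show "continuous_on {0..1} (\<lambda>x. b (2^k * x))"
      by (rule continuous_on_compose2[OF cont]) (auto intro!: continuous_intros)
    fix j i :: nat assume "1 \<le> j" "i < 2^j"
    from less_imp_le[OF inc[OF this]]
    show "norm (b (2^k * (real (Suc i) / 2^j)) - b (2^k * (real i / 2^j))) \<le> 6 * LL (2^k) * (3/4)^j"
      by (simp add: mult_ac del: of_nat_Suc)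
  qed (use LL in simp)
  then show ?thesis by simp
qed

text \<open>All almost sure input, for one fixed path. Levels, tolerances, ratios and prescribed
  increments range over countable sets; \<open>w\<close> is extensional with rational values for
  that reason.\<close>

locale strassen_path =
  fixes b :: "real \<Rightarrow> real^'d"
  assumes cont: "continuous_on {0..} b" and b0: "b 0 = 0"
    and inc: "\<forall>\<^sub>F k in sequentially. \<forall>j\<ge>1. \<forall>i<2^j.
      norm (b (real (Suc i) * (2^k / 2^j)) - b (real i * (2^k / 2^j))) < 6 * (3/4)^j * LL (2^k)"
    and energy: "\<And>l p q. \<forall>\<^sub>F k in sequentially.
      (\<Sum>j<2^l. (norm (b (real (Suc j) * ((1 + 1 / real (Suc q))^k / 2^l)) - b (real j * ((1 + 1 / real (Suc q))^k / 2^l))))\<^sup>2)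
        < (1 + 1 / real (Suc p))\<^sup>2 * (LL ((1 + 1 / real (Suc q))^k))\<^sup>2 / 2^l"
    and follow: "\<And>l p w. 1 \<le> l \<Longrightarrow> w \<in> (({1..<2^l} \<times> UNIV) \<rightarrow>\<^sub>E \<rat>) \<Longrightarrow>
      2 ^ l * (\<Sum>j\<in>{1..<2^l}. \<Sum>i\<in>UNIV. (w (j, i))\<^sup>2) \<le> 1 \<Longrightarrow>
      \<exists>\<^sub>\<infinity>q. \<forall>j\<in>{1..<2^l}. \<forall>i::'d.
       \<bar>(b (real (Suc j) * 2^(l*q)) - b (real j * 2^(l*q))) $ i - LL (2^(l * Suc q)) * w (j, i)\<bar> \<le> 1 / real (Suc p) * LL (2^(l * Suc q))"
begin

text \<open>Let T be the power of 2 with s < T \<le> 2s. The path at scale s is the one at scale T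
  run on [0, s/T] and multiplied by LL T / LL s, which is at most 2; hence 84 = 2 * 42.\<close>

lemma modulus:
  "\<exists>s0\<ge>exp (exp 1). \<forall>s\<ge>s0. \<forall>m\<ge>1. \<forall>u\<in>{0..1}. \<forall>v\<in>{0..1}. \<bar>u - v\<bar> \<le> 1 / 2^m \<longrightarrow>
     norm (scaled_path b s u - scaled_path b s v) \<le> 84 * (3/4)^m"
proof -
  obtain k0 where k0: "\<And>k j i. k \<ge> k0 \<Longrightarrow> 1 \<le> j \<Longrightarrow> i < 2^j \<Longrightarrow>
      norm (b (real (Suc i) * (2^k / 2^j)) - b (real i * (2^k / 2^j))) < 6 * (3/4)^j * LL (2^k)"
    using inc unfolding eventually_sequentially by blast
  define s0 where "s0 = max (exp (exp 1)) (2 ^ k0 :: real)"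
  show ?thesis
  proof (rule exI[of _ s0], intro conjI allI impI ballI)
    show "exp (exp 1) \<le> s0" by (simp add: s0_def)
    fix s :: real and m :: nat and u v :: real
    assume s: "s0 \<le> s" and m: "1 \<le> m" and uv: "u \<in> {0..1}" "v \<in> {0..1}" "\<bar>u - v\<bar> \<le> 1 / 2^m"
    have se: "exp (exp 1) \<le> s" "2 ^ k0 \<le> s" using s by (auto simp: s0_def)
    have s1: "1 < s" using exp_exp_1_bounds[OF se(1)] by simp
    obtain k where k: "2 ^ k \<le> s" "s < 2 ^ Suc k" using power_bracket[of 2 s] s1 by auto
    have "(2::real) ^ k0 < 2 ^ Suc k" using se(2) k(2) by linarith
    then have "k0 < Suc k" by (rule power_less_imp_less_exp[rotated]) simp
    define T where "T = (2::real) ^ Suc k"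
    have T: "T > 0" "s \<le> T" "T \<le> 2 * s" using k by (auto simp: T_def)
    have Te: "exp (exp 1) \<le> T" using T se by linarith
    define c where "c = s / T"
    have c: "0 \<le> c" "c \<le> 1" using T s1 by (auto simp: c_def)
    have cu: "c * u \<in> {0..1}" "c * v \<in> {0..1}" using c uv by (auto intro: mult_le_one)
    have "\<bar>c * u - c * v\<bar> = c * \<bar>u - v\<bar>" using c by (simp add: abs_mult flip: right_diff_distrib)
    also have "\<dots> \<le> 1 * \<bar>u - v\<bar>" using c by (intro mult_right_mono) auto
    finally have cuv: "\<bar>c * u - c * v\<bar> \<le> 1 / 2 ^ m" using uv(3) by simp
    have "norm (b (T * (c * u)) - b (T * (c * v))) \<le> 42 * LL T * (3/4)^m"
      unfolding T_def
      by (rule scaled_path_modulus_dyadic_scale[OF cont k0 _ m cu cuv])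
         (use \<open>k0 < Suc k\<close> LL_pos[OF Te] in \<open>auto simp: T_def less_imp_le\<close>)
    moreover have "T * (c * x) = s * x" for x using T by (simp add: c_def)
    ultimately have 1: "norm (b (s * u) - b (s * v)) \<le> 42 * LL T * (3/4)^m" by simp
    have "LL T \<le> LL (2 * s)" by (rule LL_mono[OF Te T(3)])
    also have "\<dots> \<le> 2 * LL s" by (rule LL_scale) (use se in auto)
    finally have "42 * LL T * (3/4)^m \<le> 42 * (2 * LL s) * (3/4)^m" by (intro mult_right_mono mult_left_mono) auto
    with 1 have "norm (b (s * u) - b (s * v)) \<le> 42 * (2 * LL s) * (3/4)^m" by (rule order.trans)
    then have 2: "norm (b (s * u) - b (s * v)) \<le> LL s * (84 * (3/4)^m)" by (simp add: mult_ac)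
    have "scaled_path b s u - scaled_path b s v = (1 / LL s) *\<^sub>R (b (s * u) - b (s * v))"
      by (simp add: scaled_path_def scaleR_diff_right)
    then show "norm (scaled_path b s u - scaled_path b s v) \<le> 84 * (3/4)^m"
      using 2 LL_pos[OF se(1)] by (simp add: divide_le_eq mult.commute)
  qed
qed

text \<open>Fixing one such scale by choice turns the modulus of continuity into a rule with the
  simple side condition \<open>s \<ge> threshold\<close>.\<close>

definition threshold :: real where
  "threshold = (SOME s0. s0 \<ge> exp (exp 1) \<and> (\<forall>s\<ge>s0. \<forall>m\<ge>1. \<forall>u\<in>{0..1}. \<forall>v\<in>{0..1}. \<bar>u - v\<bar> \<le> 1 / 2^m \<longrightarrow>
     norm (scaled_path b s u - scaled_path b s v) \<le> 84 * (3/4)^m))"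

lemma threshold_ge: "threshold \<ge> exp (exp 1)"
  and scaled_path_modulus: "s \<ge> threshold \<Longrightarrow> 1 \<le> m \<Longrightarrow> u \<in> {0..1} \<Longrightarrow> v \<in> {0..1} \<Longrightarrow> \<bar>u - v\<bar> \<le> 1 / 2^m \<Longrightarrow>
     norm (scaled_path b s u - scaled_path b s v) \<le> 84 * (3/4)^m"
  using someI_ex[OF modulus, folded threshold_def] by blast+

lemma scaled_path_0: "scaled_path b s 0 = 0"
  by (simp add: scaled_path_def b0)

text \<open>The root of the energy is a Euclidean norm of increments, so perturbations can be
  handled by Minkowski's inequality.\<close>

lemma sqrt_denergy: "sqrt (denergy f l) = sqrt (2 ^ l) * L2_set (\<lambda>j. norm (dinc f l j)) {..<2^l}"
  by (simp add: denergy_def L2_set_def real_sqrt_mult)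

lemma denergy_nonneg: "0 \<le> denergy f l"
  unfolding denergy_def by (intro mult_nonneg_nonneg sum_nonneg) auto

text \<open>Compare s with T = lam^(k+1), where s < T \<le> lam s. The path at s is \<rho> times the
  path at T with time contracted by \<theta>; for lam near 1 every grid point moves by at most
  2^(-m), so each increment changes by at most 168 (3/4)^m, which sums to 2^l times that in the root
  of the energy.\<close>

lemma denergy_eventually:
  assumes \<eta>: "0 < \<eta>" "\<eta> \<le> 1"
  shows "\<exists>s0. \<forall>s\<ge>s0. denergy (scaled_path b s) l \<le> (1 + \<eta>)\<^sup>2"
proof -
  have "(\<lambda>m. 2 ^ l * (168 * (3/4) ^ m)) \<longlonglongrightarrow> 2 ^ l * (168 * (0::real))"
    by (intro tendsto_intros LIMSEQ_power_zero) simp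
  from order_tendstoD(2)[OF this, of "\<eta> / 8"]
  have "\<forall>\<^sub>F m in sequentially. 2 ^ l * (168 * (3/4) ^ m) < \<eta> / 8" using \<eta> by simp
  then obtain m where m: "1 \<le> m" "2 ^ l * (168 * (3/4) ^ m) < \<eta> / 8"
    unfolding eventually_sequentially by (metis linear)
  \<comment> \<open>Budget: the ratio, the energy bound at T and the moved grid points cost \<eta>/8
    each, and (1 + \<eta>/8)(1 + \<eta>/4) \<le> 1 + \<eta>.\<close>
  obtain p where p: "1 / real (Suc p) < \<eta> / 8" using \<eta> nat_approx_posE[of "\<eta> / 8"] by auto
  obtain q where q: "1 / real (Suc q) < min (\<eta> / 8) (1 / 2^m)" using \<eta> nat_approx_posE[of "min (\<eta> / 8) (1 / 2^m)"] by auto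
  define lam where "lam = 1 + 1 / real (Suc q)"
  have lam: "lam > 1" "lam \<le> 1 + \<eta> / 8" "1 - 1 / lam \<le> 1 / 2^m"
  proof -
    show l1: "lam > 1" by (simp add: lam_def)
    show "lam \<le> 1 + \<eta> / 8" using q by (simp add: lam_def)
    have "1 - 1 / lam = (lam - 1) / lam" using l1 by (simp add: diff_divide_distrib)
    also have "\<dots> \<le> (lam - 1) / 1" using l1 by (intro divide_left_mono) auto
    also have "(lam - 1) / 1 = 1 / real (Suc q)" by (simp add: lam_def)
    also have "\<dots> \<le> 1 / 2^m" using q by linarith
    finally show "1 - 1 / lam \<le> 1 / 2^m" .
  qed
  have "\<exists>k0. \<forall>k\<ge>k0. (\<Sum>j<2^l. (norm (b (real (Suc j) * (lam^k / 2^l)) - b (real j * (lam^k / 2^l))))\<^sup>2)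
        < (1 + 1 / real (Suc p))\<^sup>2 * (LL (lam^k))\<^sup>2 / 2^l"
    using energy[where l = l and q = q and p = p] unfolding eventually_sequentially lam_def .
  then obtain k0 where k0: "\<forall>k\<ge>k0. (\<Sum>j<2^l. (norm (b (real (Suc j) * (lam^k / 2^l)) - b (real j * (lam^k / 2^l))))\<^sup>2)
        < (1 + 1 / real (Suc p))\<^sup>2 * (LL (lam^k))\<^sup>2 / 2^l"
    by (rule exE)
  define s0 where "s0 = max threshold (lam ^ k0)"
  show ?thesis
  proof (intro exI[of _ s0] allI impI)
    fix s assume s: "s \<ge> s0"
    have ss: "threshold \<le> s" "exp (exp 1) \<le> s" "lam ^ k0 \<le> s" using s threshold_ge by (auto simp: s0_def)
    have sp: "1 < s" using exp_exp_1_bounds[OF ss(2)] by simp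
    obtain k where k: "lam ^ k \<le> s" "s < lam ^ Suc k" using power_bracket[of lam s] lam sp by auto
    have "lam ^ k0 < lam ^ Suc k" using ss k by linarith
    then have kk: "k0 \<le> Suc k" using lam(1) power_less_imp_less_exp[of lam k0 "Suc k"] by simp
    define T where "T = lam ^ Suc k"
    have T: "T > 0" "s \<le> T" "T \<le> lam * s" using k lam by (auto simp: T_def)
    have Te: "exp (exp 1) \<le> T" "threshold \<le> T" using T ss by linarith+
    have LT: "LL T > 0" by (rule LL_pos[OF Te(1)])
    have Ls: "LL s > 0" by (rule LL_pos[OF ss(2)])
    define \<theta> where "\<theta> = s / T"
    have \<theta>: "0 \<le> \<theta>" "\<theta> \<le> 1" "1 - \<theta> \<le> 1 - 1 / lam"
    proof -
      show "0 \<le> \<theta>" "\<theta> \<le> 1" using T sp by (auto simp: \<theta>_def)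
      have "1 / lam \<le> s / T" using T lam sp by (simp add: field_simps)
      then show "1 - \<theta> \<le> 1 - 1 / lam" by (simp add: \<theta>_def)
    qed
    define \<rho> where "\<rho> = LL T / LL s"
    have \<rho>: "0 \<le> \<rho>" "\<rho> \<le> lam"
    proof -
      show "0 \<le> \<rho>" using LT Ls by (simp add: \<rho>_def)
      have "LL T \<le> LL (lam * s)" by (rule LL_mono[OF Te(1) T(3)])
      also have "\<dots> \<le> lam * LL s" by (rule LL_scale) (use ss lam in auto)
      finally show "\<rho> \<le> lam" using Ls by (simp add: \<rho>_def divide_le_eq)
    qed
    have resc: "scaled_path b s t = \<rho> *\<^sub>R scaled_path b T (\<theta> * t)" for t
      using T LT Ls by (simp add: scaled_path_def \<rho>_def \<theta>_def)
    let ?F = "scaled_path b T"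
    have close: "norm (?F (\<theta> * t) - ?F t) \<le> 84 * (3/4)^m" if t: "t \<in> {0..1}" for t
    proof (rule scaled_path_modulus[OF Te(2) m(1) _ t])
      show "\<theta> * t \<in> {0..1}" using \<theta> t by (auto intro: mult_le_one)
      have "\<bar>\<theta> * t - t\<bar> = (1 - \<theta>) * t" using \<theta> t mult_right_mono[of \<theta> 1 t] by (simp add: abs_if algebra_simps)
      also have "\<dots> \<le> (1 - \<theta>) * 1" using \<theta> t by (intro mult_left_mono) auto
      finally show "\<bar>\<theta> * t - t\<bar> \<le> 1 / 2^m" using \<theta>(3) lam(3) by simp
    qed
    have dincle: "norm (dinc (scaled_path b s) l j) \<le> \<rho> * (norm (dinc (?F) l j) + 168 * (3/4)^m)"
      if j: "j < 2^l" for j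
    proof -
      let ?x = "real (Suc j) / 2^l" and ?y = "real j / 2^l"
      have xy: "?x \<in> {0..1}" "?y \<in> {0..1}" using dyadic_point_in_unit[OF j] by blast+
      have "dinc (scaled_path b s) l j = \<rho> *\<^sub>R (dinc ?F l j + ((?F (\<theta> * ?x) - ?F ?x) - (?F (\<theta> * ?y) - ?F ?y)))"
        by (simp add: dinc_def resc algebra_simps del: of_nat_Suc)
      also have "norm \<dots> = \<rho> * norm (dinc ?F l j + ((?F (\<theta> * ?x) - ?F ?x) - (?F (\<theta> * ?y) - ?F ?y)))"
        using \<rho>(1) by simp
      also have "\<dots> \<le> \<rho> * (norm (dinc ?F l j) + (norm (?F (\<theta> * ?x) - ?F ?x) + norm (?F (\<theta> * ?y) - ?F ?y)))"
        by (intro mult_left_mono[OF _ \<rho>(1)] order.trans[OF norm_triangle_ineq] add_left_mono norm_triangle_ineq4)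
      also have "\<dots> \<le> \<rho> * (norm (dinc ?F l j) + (84 * (3/4)^m + 84 * (3/4)^m))"
        by (intro mult_left_mono[OF _ \<rho>(1)] add_left_mono add_mono close xy)
      finally show ?thesis by simp
    qed
    have ET: "denergy (?F) l \<le> (1 + 1 / real (Suc p))\<^sup>2"
    proof -
      have "(\<Sum>j<2^l. (norm (dinc (?F) l j))\<^sup>2)
         = (\<Sum>j<2^l. (norm (b (real (Suc j) * (T / 2^l)) - b (real j * (T / 2^l))))\<^sup>2) / (LL T)\<^sup>2"
        using LT by (simp add: dinc_def scaled_path_def power_divide sum_divide_distrib mult_ac
            flip: scaleR_diff_right del: of_nat_Suc)
      also have "\<dots> \<le> ((1 + 1 / real (Suc p))\<^sup>2 * (LL T)\<^sup>2 / 2^l) / (LL T)\<^sup>2"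
        using less_imp_le[OF k0[rule_format, OF kk]] unfolding T_def[symmetric] by (rule divide_right_mono) simp
      also have "\<dots> = (1 + 1 / real (Suc p))\<^sup>2 / 2^l" using LT by simp
      finally show ?thesis by (simp add: denergy_def field_simps del: of_nat_Suc)
    qed
    have "sqrt (denergy (scaled_path b s) l) \<le> sqrt (2^l) * L2_set (\<lambda>j. \<rho> * (norm (dinc (?F) l j) + 168 * (3/4)^m)) {..<2^l}"
      unfolding sqrt_denergy by (intro mult_left_mono L2_set_mono dincle) auto
    also have "\<dots> = \<rho> * (sqrt (2^l) * L2_set (\<lambda>j. norm (dinc (?F) l j) + 168 * (3/4)^m) {..<2^l})"
      using \<rho>(1) by (simp add: L2_set_right_distrib[symmetric])
    also have "\<dots> \<le> \<rho> * (sqrt (2^l) * (L2_set (\<lambda>j. norm (dinc (?F) l j)) {..<2^l} + L2_set (\<lambda>j. 168 * (3/4)^m) {..<(2::nat)^l}))"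
      using \<rho>(1) by (intro mult_left_mono L2_set_triangle_ineq) auto
    also have "L2_set (\<lambda>j. 168 * (3/4::real)^m) {..<(2::nat)^l} = sqrt (2^l) * (168 * (3/4)^m)"
      by (simp add: L2_set_def real_sqrt_mult)
    also have "\<rho> * (sqrt (2^l) * (L2_set (\<lambda>j. norm (dinc (?F) l j)) {..<2^l} + sqrt (2^l) * (168 * (3/4)^m)))
       = \<rho> * (sqrt (denergy (?F) l) + 2^l * (168 * (3/4)^m))"
      unfolding sqrt_denergy by (simp add: distrib_left mult.assoc[symmetric])
    also have "\<dots> \<le> lam * ((1 + 1 / real (Suc p)) + \<eta> / 8)"
    proof (intro mult_mono add_mono)
      have "sqrt (denergy (?F) l) \<le> sqrt ((1 + 1 / real (Suc p))\<^sup>2)" using ET by (rule real_sqrt_le_mono)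
      then show "sqrt (denergy (?F) l) \<le> 1 + 1 / real (Suc p)" by simp
    qed (use \<rho> m lam in \<open>auto simp: denergy_nonneg intro!: add_nonneg_nonneg\<close>)
    also have "\<dots> \<le> (1 + \<eta> / 8) * (1 + \<eta> / 4)"
      using lam p \<eta> by (intro mult_mono) auto
    also have "\<dots> \<le> 1 + \<eta>"
    proof -
      have "\<eta> * \<eta> \<le> \<eta> * 1" using \<eta> by (intro mult_left_mono) auto
      then have "\<eta> * \<eta> / 32 + \<eta> * 3 / 8 \<le> \<eta>" using \<eta> by linarith
      then show ?thesis by (simp add: algebra_simps)
    qed
    finally show "denergy (scaled_path b s) l \<le> (1 + \<eta>)\<^sup>2"
      by (rule sqrt_le_D)
  qed
qed

end

text \<open>The increment over the first dyadic interval is not controlled by \<open>close\<close> but by \<open>small\<close>: in the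
  application it overlaps the earlier scales and is not independent of them.\<close>

lemma dyadic_approx_sum:
  fixes F g :: "real \<Rightarrow> 'a::real_normed_vector"
  assumes small: "\<And>t K. t \<in> {0..1} \<Longrightarrow> K \<le> 2^l \<Longrightarrow> \<bar>t - real K / 2^l\<bar> \<le> 1 / 2^l \<Longrightarrow>
      norm (F t - F (real K / 2^l)) \<le> a \<and> norm (g t - g (real K / 2^l)) \<le> c"
    and z: "F 0 = 0" "g 0 = 0"
    and close: "\<And>j. j \<in> {1..<2^l} \<Longrightarrow> norm (dinc F l j - dinc g l j) \<le> e"
    and t: "t \<in> {0..1}" and nn: "0 \<le> e"
  shows "norm (F t - g t) \<le> 2 * a + 2 * c + 2^l * e"
proof -
  define K where "K = nat \<lfloor>2^l * t\<rfloor>"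
  have K: "K \<le> 2^l" "\<bar>t - real K / 2^l\<bar> \<le> 1 / 2^l"
    using dyadic_index_le[of t l] dyadic_floor_dist[of t l] t by (auto simp: K_def)
  have s1: "norm (F (1 / 2^l) - F 0) \<le> a \<and> norm (g (1 / 2^l) - g 0) \<le> c"
    using small[of "1 / 2^l" 0] by simp
  have ac: "0 \<le> a" "0 \<le> c" using s1 norm_ge_zero order.trans by blast+
  have grid: "norm (F (real n / 2^l) - g (real n / 2^l)) \<le> a + c + real n * e" if "n \<le> 2^l" for n
    using that
  proof (induction n)
    case 0
    then show ?case using z ac by simp
  next
    case (Suc n)
    show ?case
    proof (cases "n = 0")
      case True
      have "norm (F (1 / 2^l) - g (1 / 2^l)) \<le> norm (F (1 / 2^l)) + norm (g (1 / 2^l))" by (rule norm_triangle_ineq4)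
      then show ?thesis using True s1 z nn by simp
    next
      case False
      have "F (real (Suc n) / 2^l) - g (real (Suc n) / 2^l) = (F (real n / 2^l) - g (real n / 2^l)) + (dinc F l n - dinc g l n)"
        by (simp add: dinc_def)
      also have "norm \<dots> \<le> (a + c + real n * e) + e"
        using Suc False by (intro order.trans[OF norm_triangle_ineq] add_mono close) auto
      finally show ?thesis by (simp add: algebra_simps)
    qed
  qed
  have "real K * e \<le> 2^l * e"
    using K(1) nn by (intro mult_right_mono) (metis of_nat_le_iff of_nat_numeral of_nat_power, simp)
  then have 1: "norm (F (real K / 2^l) - g (real K / 2^l)) \<le> a + c + 2^l * e"
    using grid[OF K(1)] by simp
  \<comment> \<open>a and c occur twice in total: in the grid bound for the first interval, and here
    for replacing t by a grid point.\<close>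
  have "F t - g t = (F t - F (real K / 2^l)) + (F (real K / 2^l) - g (real K / 2^l)) - (g t - g (real K / 2^l))"
    by simp
  also have "norm \<dots> \<le> norm (F t - F (real K / 2^l)) + norm (F (real K / 2^l) - g (real K / 2^l)) + norm (g t - g (real K / 2^l))"
    by (intro order.trans[OF norm_triangle_ineq4] add_right_mono norm_triangle_ineq)
  also have "\<dots> \<le> a + (a + c + 2^l * e) + c"
    using small[OF t K] 1 by (intro add_mono) auto
  finally show ?thesis by simp
qed

text \<open>Rounding toward zero does not increase squares, so rational increments keep the energy
  at most one.\<close>

lemma rational_round_toward_zero:
  assumes "\<delta> > (0::real)"
  shows "\<exists>w\<in>\<rat>. \<bar>w\<bar> \<le> \<bar>x\<bar> \<and> \<bar>x - w\<bar> \<le> \<delta>"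
proof -
  consider "x = 0" | "x > 0" | "x < 0" by linarith
  then show ?thesis
  proof cases
    case 1
    then show ?thesis using assms by (intro bexI[of _ 0]) auto
  next
    case 2
    obtain w where "w \<in> \<rat>" "max 0 (x - \<delta>) < w" "w < x" using Rats_dense_in_real[of "max 0 (x - \<delta>)" x] 2 assms by auto
    then show ?thesis by (intro bexI[of _ w]) auto
  next
    case 3
    obtain w where "w \<in> \<rat>" "x < w" "w < min 0 (x + \<delta>)" using Rats_dense_in_real[of x "min 0 (x + \<delta>)"] 3 assms by auto
    then show ?thesis by (intro bexI[of _ w]) auto
  qed
qed

context strassen_path
begin

text \<open>For fixed l the dyadic energy is a continuous function of finitely many values, so the
  eventual bound (1 + \<eta>)^2 passes to the limit; then \<eta> tends to 0.\<close>

lemma limit_point_finite_energy: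
  assumes s: "filterlim s at_top sequentially"
    and lim: "\<And>t. t \<in> {0..1} \<Longrightarrow> (\<lambda>n. scaled_path b (s n) t) \<longlonglongrightarrow> f t"
    and cont: "continuous_on {0..1} f"
  shows "finite_energy f"
  unfolding finite_energy_def
proof (intro conjI allI cont)
  show "f 0 = 0"
    using LIMSEQ_unique[OF lim[of 0]] by (simp add: scaled_path_0)
  fix l
  have "denergy f l \<le> (1 + \<eta>)\<^sup>2" if \<eta>: "0 < \<eta>" "\<eta> \<le> 1" for \<eta>
  proof (rule LIMSEQ_le_const2)
    show "(\<lambda>n. denergy (scaled_path b (s n)) l) \<longlonglongrightarrow> denergy f l"
      unfolding denergy_def dinc_def
      by (intro tendsto_intros lim) (use dyadic_point_in_unit in \<open>simp_all only: lessThan_iff\<close>)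
    obtain s0 where s0: "\<forall>s\<ge>s0. denergy (scaled_path b s) l \<le> (1 + \<eta>)\<^sup>2" using denergy_eventually[OF \<eta>] by blast
    have "\<forall>\<^sub>F n in sequentially. s0 \<le> s n" using s by (simp add: filterlim_at_top)
    then show "\<exists>N. \<forall>n\<ge>N. denergy (scaled_path b (s n)) l \<le> (1 + \<eta>)\<^sup>2"
      using s0 by (auto simp: eventually_sequentially)
  qed
  note le = this
  have "(\<lambda>n. (1 + inverse (real (Suc n)))\<^sup>2) \<longlonglongrightarrow> (1 + 0)\<^sup>2"
    by (intro tendsto_intros LIMSEQ_inverse_real_of_nat)
  then have "denergy f l \<le> (1 + 0)\<^sup>2"
    by (rule LIMSEQ_le_const) (use le in \<open>auto simp: inverse_le_1_iff\<close>)
  then show "denergy f l \<le> 1" by simp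
qed

text \<open>The modulus is available only for distances up to 1/2, so t is reached from 0 through
  t/2: 126 = 2 * 84 * (3/4).\<close>

lemma scaled_path_bounded:
  assumes s: "s \<ge> threshold" and t: "t \<in> {0..1}"
  shows "norm (scaled_path b s t) \<le> 126"
proof -
  have "norm (scaled_path b s t - scaled_path b s (t/2)) \<le> 84 * (3/4)^1"
    "norm (scaled_path b s (t/2) - scaled_path b s 0) \<le> 84 * (3/4)^1"
    by (rule scaled_path_modulus; use s t in simp)+
  then show ?thesis
    using norm_triangle_ineq[of "scaled_path b s t - scaled_path b s (t/2)" "scaled_path b s (t/2)"]
    by (simp add: scaled_path_0)
qed

text \<open>Arzela-Ascoli, with equicontinuity from the modulus and the bound 126. Initial indices
  below \<open>threshold\<close> are skipped by the shift \<open>N0\<close>, which reappears in the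
  extracted subsequence.\<close>

lemma subsequence_converges:
  assumes s: "filterlim s at_top sequentially"
  obtains f r where "finite_energy f" "strict_mono (r :: nat \<Rightarrow> nat)"
    "\<And>e. e > 0 \<Longrightarrow> \<exists>N. \<forall>n\<ge>N. \<forall>t\<in>{0..1}. norm (scaled_path b (s (r n)) t - f t) < e"
proof -
  have "\<forall>\<^sub>F n in sequentially. threshold \<le> s n" using s by (simp add: filterlim_at_top)
  then obtain N0 where N0: "\<And>n. n \<ge> N0 \<Longrightarrow> threshold \<le> s n" by (auto simp: eventually_sequentially)
  define F where "F n = scaled_path b (s (n + N0))" for n
  have mod: "norm (F n u - F n v) \<le> 84 * (3/4)^m" if "1 \<le> m" "u \<in> {0..1}" "v \<in> {0..1}" "\<bar>u - v\<bar> \<le> 1 / 2^m" for n m u v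
    unfolding F_def using N0[of "n + N0"] that by (intro scaled_path_modulus) auto
  have bound: "norm (F n t) \<le> 126" if "t \<in> {0..1}" for n t
    unfolding F_def using N0[of "n + N0"] that by (intro scaled_path_bounded) auto
  have equi: "\<exists>d. 0 < d \<and> (\<forall>n y. y \<in> {0..1} \<and> norm (x - y) < d \<longrightarrow> norm (F n x - F n y) < e)"
    if x: "x \<in> {0..1}" and e: "0 < e" for x e :: real
  proof -
    have "(\<lambda>m. 84 * (3/4) ^ m) \<longlonglongrightarrow> 84 * (0::real)"
      by (intro tendsto_intros LIMSEQ_power_zero) simp
    from order_tendstoD(2)[OF this, of e] e
    obtain m where m: "\<And>n. n \<ge> m \<Longrightarrow> 84 * (3/4) ^ n < e" by (auto simp: eventually_sequentially)
    show ?thesis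
    proof (intro exI[of _ "1 / 2 ^ Suc m"] conjI allI impI)
      fix n y assume "y \<in> {0..1} \<and> norm (x - y) < 1 / 2 ^ Suc m"
      then have "norm (F n x - F n y) \<le> 84 * (3/4)^Suc m" using x by (intro mod) auto
      also have "\<dots> < e" using m[of "Suc m"] by simp
      finally show "norm (F n x - F n y) < e" .
    qed simp
  qed
  obtain g k where g: "continuous_on {0..1} g" "strict_mono (k :: nat \<Rightarrow> nat)"
    "\<And>e. 0 < e \<Longrightarrow> \<exists>N. \<forall>n x. n \<ge> N \<and> x \<in> {0..1} \<longrightarrow> norm (F (k n) x - g x) < e"
    by (rule Arzela_Ascoli[of "{0..1::real}" F 126]) (use bound equi in \<open>auto\<close>)
  define r where "r n = k n + N0" for n
  have r: "strict_mono r" using g(2) by (simp add: r_def strict_mono_def)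
  have unif: "\<exists>N. \<forall>n\<ge>N. \<forall>t\<in>{0..1}. norm (scaled_path b (s (r n)) t - g t) < e" if "e > 0" for e
    using g(3)[OF that] unfolding F_def r_def by meson
  have "finite_energy g"
  proof (rule limit_point_finite_energy[OF _ _ g(1)])
    show "filterlim (\<lambda>n. s (r n)) at_top sequentially"
      by (rule filterlim_compose[OF s filterlim_subseq[OF r]])
    fix t :: real assume t: "t \<in> {0..1}"
    show "(\<lambda>n. scaled_path b (s (r n)) t) \<longlonglongrightarrow> g t"
    proof (rule LIMSEQ_I)
      fix e :: real assume "e > 0"
      from unif[OF this] t show "\<exists>N. \<forall>n\<ge>N. norm (scaled_path b (s (r n)) t - g t) < e" by blast
    qed
  qed
  then show ?thesis using that r unif by blast
qed

text \<open>At scale n = 2^(l (q+1)) the grid of level l consists of the times j 2^(l q), whose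
  increments can be made to follow those of g. A large l makes both moduli of continuity small,
  which takes care of the first interval and of points off the grid.\<close>

lemma approximates_infinitely_often:
  assumes g: "finite_energy g" and e: "e > 0"
  shows "\<exists>n\<ge>n0. \<forall>t\<in>{0..1}. norm (scaled_path b (real n) t - g t) \<le> e"
proof -
  have "(\<lambda>l. 2 * (84 * (3/4) ^ l) + 2 * (sqrt (1/2)) ^ l) \<longlonglongrightarrow> 2 * (84 * 0) + 2 * (0::real)"
    by (intro tendsto_intros LIMSEQ_power_zero) auto
  from order_tendstoD(2)[OF this, of "e/2"] e
  obtain l0 where l0: "\<And>l. l \<ge> l0 \<Longrightarrow> 2 * (84 * (3/4) ^ l) + 2 * (sqrt (1/2)) ^ l < e/2" by (auto simp: eventually_sequentially)
  define l where "l = Suc l0"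
  have l: "1 \<le> l" "2 * (84 * (3/4) ^ l) + 2 * (sqrt (1/2)) ^ l < e/2" using l0[of l] by (auto simp: l_def)
  define d where "d = real CARD('d)"
  have d: "d > 0" by (simp add: d_def)
  \<comment> \<open>Rounding and following each cost \<delta> per component and interval; over d
    components and 2^l intervals this adds up to e/2.\<close>
  define \<delta> where "\<delta> = e / (4 * 2^l * d)"
  have \<delta>: "\<delta> > 0" "2^l * (2 * \<delta> * d) = e/2" using e d by (auto simp: \<delta>_def)
  obtain p where p: "1 / real (Suc p) < \<delta>" using \<delta>(1) nat_approx_posE by blast
  have "\<forall>x. \<exists>w\<in>\<rat>. \<bar>w\<bar> \<le> \<bar>x\<bar> \<and> \<bar>x - w\<bar> \<le> \<delta>" using rational_round_toward_zero[OF \<delta>(1)] by blast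
  then obtain rd where rd: "\<And>x. rd x \<in> \<rat> \<and> \<bar>rd x\<bar> \<le> \<bar>x\<bar> \<and> \<bar>x - rd x\<bar> \<le> \<delta>" by metis
  \<comment> \<open>Restricted to the finite index set, so that \<open>w\<close> belongs to the
    countable family for which the path is controlled.\<close>
  define w where "w = (\<lambda>p\<in>{1..<2^l} \<times> (UNIV::'d set). rd (dinc g l (fst p) $ snd p))"
  have w1: "w \<in> ({1..<2^l} \<times> UNIV) \<rightarrow>\<^sub>E \<rat>" using rd by (auto simp: w_def)
  have w2: "2 ^ l * (\<Sum>j\<in>{1..<2^l}. \<Sum>i\<in>UNIV. (w (j, i))\<^sup>2) \<le> 1"
  proof -
    have "(\<Sum>j\<in>{1..<2^l}. \<Sum>i\<in>UNIV. (w (j, i))\<^sup>2) \<le> (\<Sum>j\<in>{1..<2^l}. \<Sum>i\<in>UNIV. (dinc g l j $ i)\<^sup>2)"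
      using rd by (intro sum_mono) (simp add: w_def abs_le_square_iff)
    also have "\<dots> = (\<Sum>j\<in>{1..<2^l}. (norm (dinc g l j))\<^sup>2)"
      unfolding power2_norm_eq_inner by (simp add: inner_vec_def power2_eq_square)
    also have "\<dots> \<le> (\<Sum>j<2^l. (norm (dinc g l j))\<^sup>2)"
      by (intro sum_mono2) auto
    finally have "2 ^ l * (\<Sum>j\<in>{1..<2^l}. \<Sum>i\<in>UNIV. (w (j, i))\<^sup>2) \<le> denergy g l"
      unfolding denergy_def by (intro mult_left_mono) auto
    also have "\<dots> \<le> 1" using g by (simp add: finite_energy_def)
    finally show ?thesis .
  qed
  have "filterlim (\<lambda>q. (2::real) ^ (l * Suc q)) at_top sequentially"
  proof (rule filterlim_at_top_mono)
    show "filterlim real at_top sequentially" by (rule filterlim_real_sequentially)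
    show "\<forall>\<^sub>F q in sequentially. real q \<le> 2 ^ (l * Suc q)"
    proof (intro always_eventually allI)
      fix q
      have "1 * q \<le> l * Suc q" using l(1) by (intro mult_mono) auto
      then have "(2::real) ^ q \<le> 2 ^ (l * Suc q)" by (intro power_increasing) auto
      moreover have "real q < 2 ^ q" by (rule of_nat_less_two_power)
      ultimately show "real q \<le> 2 ^ (l * Suc q)" by linarith
    qed
  qed
  then have "\<forall>\<^sub>F q in sequentially. max threshold (real n0) \<le> (2::real) ^ (l * Suc q)"
    by (simp only: filterlim_at_top)
  then obtain q0 where q0: "\<And>q. q \<ge> q0 \<Longrightarrow> max threshold (real n0) \<le> (2::real) ^ (l * Suc q)"
    unfolding eventually_sequentially by blast
  from follow[OF l(1) w1 w2, of p] obtain q where q: "q \<ge> q0"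
    and fol: "\<forall>j\<in>{1..<2^l}. \<forall>i::'d.
       \<bar>(b (real (Suc j) * 2^(l*q)) - b (real j * 2^(l*q))) $ i - LL (2^(l * Suc q)) * w (j, i)\<bar> \<le> 1 / real (Suc p) * LL (2^(l * Suc q))"
    unfolding INFM_nat_le by blast
  define n where "n = (2::nat) ^ (l * Suc q)"
  have rn: "real n = 2 ^ (l * Suc q)" by (simp add: n_def)
  have n: "threshold \<le> real n" "n0 \<le> n" using q0[OF q] by (auto simp: rn[symmetric] simp del: mult_Suc_right)
  have Ln: "LL (real n) > 0" by (rule LL_pos) (use n threshold_ge in linarith)
  define F where "F = scaled_path b (real n)"
  have grid: "F (real j / 2^l) = (1 / LL (real n)) *\<^sub>R b (real j * 2^(l*q))" for j
    by (simp add: F_def scaled_path_def rn power_add mult_ac)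
  have comp: "\<bar>(dinc F l j - dinc g l j) $ i\<bar> \<le> 2 * \<delta>" if j: "j \<in> {1..<2^l}" for j i
  proof -
    let ?D = "(b (real (Suc j) * 2^(l*q)) - b (real j * 2^(l*q))) $ i"
    have "\<bar>?D - LL (real n) * w (j, i)\<bar> \<le> 1 / real (Suc p) * LL (real n)"
      using fol j unfolding rn by blast
    moreover have "dinc F l j $ i - w (j, i) = (?D - LL (real n) * w (j, i)) / LL (real n)"
      using Ln unfolding dinc_def grid by (simp add: diff_divide_distrib del: of_nat_Suc)
    ultimately have "\<bar>dinc F l j $ i - w (j, i)\<bar> \<le> 1 / real (Suc p)"
      using Ln by (simp add: abs_divide divide_le_eq del: of_nat_Suc)
    then have "\<bar>dinc F l j $ i - w (j, i)\<bar> \<le> \<delta>" using p by linarith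
    moreover have "\<bar>dinc g l j $ i - w (j, i)\<bar> \<le> \<delta>" using rd j by (simp add: w_def)
    ultimately show ?thesis by simp
  qed
  have "norm (F t - g t) \<le> 2 * (84 * (3/4)^l) + 2 * (sqrt (1/2))^l + 2^l * (2 * \<delta> * d)" if t: "t \<in> {0..1}" for t
  proof (rule dyadic_approx_sum[OF _ _ _ _ t])
    fix t :: real and K :: nat assume tK: "t \<in> {0..1}" "K \<le> 2^l" "\<bar>t - real K / 2^l\<bar> \<le> 1 / 2^l"
    have K: "real K / 2^l \<in> {0..1}" using tK(2) by (auto simp: divide_le_eq)
    have 1: "norm (F t - F (real K / 2^l)) \<le> 84 * (3/4)^l"
      unfolding F_def using n(1) l(1) tK K by (intro scaled_path_modulus)
    have "(norm (g t - g (real K / 2^l)))\<^sup>2 \<le> \<bar>t - real K / 2^l\<bar>"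
    proof (cases "real K / 2^l \<le> t")
      case True
      then show ?thesis using finite_energy_increment[OF g _ True] tK K by simp
    next
      case False
      then show ?thesis using finite_energy_increment[OF g, of t "real K / 2^l"] tK K by (simp add: norm_minus_commute)
    qed
    then have "norm (g t - g (real K / 2^l)) \<le> sqrt (1 / 2^l)"
      using tK(3) by (intro real_le_rsqrt) simp
    also have "\<dots> = (sqrt (1/2))^l" by (simp add: real_sqrt_power power_divide real_sqrt_divide)
    finally show "norm (F t - F (real K / 2^l)) \<le> 84 * (3/4)^l \<and> norm (g t - g (real K / 2^l)) \<le> (sqrt (1/2))^l"
      using 1 by simp
  next
    show "F 0 = 0" by (simp add: F_def scaled_path_0)
    show "g 0 = 0" using g by (simp add: finite_energy_def)
    show "0 \<le> 2 * \<delta> * d" using \<delta> d by simp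
    fix j assume j: "j \<in> {1..<(2::nat)^l}"
    have "norm (dinc F l j - dinc g l j) \<le> (\<Sum>i\<in>UNIV. \<bar>(dinc F l j - dinc g l j) $ i\<bar>)" by (rule norm_le_l1_cart)
    also have "\<dots> \<le> (\<Sum>i\<in>(UNIV::'d set). 2 * \<delta>)" by (intro sum_mono comp j)
    also have "\<dots> = 2 * \<delta> * d" by (simp add: d_def mult.commute)
    finally show "norm (dinc F l j - dinc g l j) \<le> 2 * \<delta> * d" .
  qed
  then have "\<forall>t\<in>{0..1}. norm (F t - g t) \<le> e" using l(2) \<delta>(2) by fastforce
  then show ?thesis using n(2) unfolding F_def by blast
qed

end

section \<open>The limit set\<close>

lemma mspace_C0: "mspace (C0 :: (real \<Rightarrow> real^'d) metric) = {f. f \<in> extensional {0..1} \<and> continuous_on {0..1} f \<and> f 0 = 0}"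
proof -
  have "bounded (f ` {0..1})" if "continuous_on {0..1} f" for f :: "real \<Rightarrow> real^'d"
    using compact_continuous_image[OF that] compact_imp_bounded by blast
  then show ?thesis by (auto simp: C0_def)
qed

lemma mdist_C0_le:
  fixes f g :: "real \<Rightarrow> real^'d"
  assumes "f \<in> mspace C0" "g \<in> mspace C0"
  shows "mdist C0 f g \<le> a \<longleftrightarrow> (\<forall>t\<in>{0..1}. norm (f t - g t) \<le> a)"
proof -
  have "f \<in> mspace (cfunspace (top_of_set {0..1}) euclidean_metric)" "g \<in> mspace (cfunspace (top_of_set {0..1}) euclidean_metric)"
    using assms by (simp_all add: C0_def)
  from cfunspace_mdist_le[OF this, of a] show ?thesis by (simp add: C0_def dist_norm)
qed

lemma limitin_C0:
  fixes f :: "real \<Rightarrow> real^'d"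
  assumes g: "\<And>n. g n \<in> mspace C0"
  shows "limitin (mtopology_of C0) g f sequentially \<longleftrightarrow>
    f \<in> mspace C0 \<and> (\<forall>e>0. \<exists>N. \<forall>n\<ge>N. \<forall>t\<in>{0..1}. norm (g n t - f t) \<le> e)"
proof -
  have lim: "limitin (mtopology_of C0) g f sequentially \<longleftrightarrow>
    f \<in> mspace C0 \<and> (\<forall>e>0. \<exists>N. \<forall>n\<ge>N. g n \<in> mspace C0 \<and> mdist C0 (g n) f < e)"
    unfolding mtopology_of_def by (rule Metric_space.limit_metric_sequentially[OF Metric_space_mspace_mdist])
  show ?thesis
    unfolding lim
  proof (intro conj_cong refl iffI allI impI)
    fix e :: real assume f: "f \<in> mspace C0" and e: "e > 0"
    { assume "\<forall>e>0. \<exists>N. \<forall>n\<ge>N. g n \<in> mspace C0 \<and> mdist C0 (g n) f < e"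
      with e obtain N where "\<forall>n\<ge>N. mdist C0 (g n) f < e" by blast
      then show "\<exists>N. \<forall>n\<ge>N. \<forall>t\<in>{0..1}. norm (g n t - f t) \<le> e"
        using mdist_C0_le[OF g f, of _ e] less_imp_le by blast }
    { assume A: "\<forall>e>0. \<exists>N. \<forall>n\<ge>N. \<forall>t\<in>{0..1}. norm (g n t - f t) \<le> e"
      obtain N where "\<forall>n\<ge>N. \<forall>t\<in>{0..1}. norm (g n t - f t) \<le> e / 2" using A e half_gt_zero by blast
      then have "\<forall>n\<ge>N. mdist C0 (g n) f \<le> e / 2" using mdist_C0_le[OF g f] by blast
      then have "\<forall>n\<ge>N. mdist C0 (g n) f < e" using e by fastforce
      then show "\<exists>N. \<forall>n\<ge>N. g n \<in> mspace C0 \<and> mdist C0 (g n) f < e" using g by blast }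
  qed
qed

text \<open>By Bolzano--Weierstrass, infinite subsets of the range need an accumulation point. Such
  a subset is the injective image of an infinite set of indices, whose enumeration is a subsequence
  with pairwise distinct values.\<close>

lemma relatively_compact_inI_subsequence:
  assumes g: "range g \<subseteq> mspace m"
    and sub: "\<And>\<sigma>::nat\<Rightarrow>nat. strict_mono \<sigma> \<Longrightarrow> \<exists>r f. strict_mono (r::nat\<Rightarrow>nat) \<and> limitin (mtopology_of m) (g \<circ> \<sigma> \<circ> r) f sequentially"
  shows "relatively_compact_in m (range g)"
  unfolding relatively_compact_in_def
proof (intro conjI g)
  interpret Metric_space "mspace m" "mdist m" by (rule Metric_space_mspace_mdist)
  show "compactin (mtopology_of m) (mtopology_of m closure_of range g)"
    unfolding mtopology_of_def compact_closure_of_eq_Bolzano_Weierstrass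
  proof (intro allI impI, elim conjE)
    fix T assume T: "infinite T" "T \<subseteq> range g"
    then obtain U where U: "inj_on g U" "T = g ` U" using subset_image_inj[of T g UNIV] by blast
    then have infU: "infinite U" using T(1) by blast
    define \<sigma> where "\<sigma> = enumerate U"
    have \<sigma>: "strict_mono \<sigma>" "\<And>n. \<sigma> n \<in> U"
      using infU by (auto simp: \<sigma>_def strict_mono_enumerate enumerate_in_set)
    obtain r f where r: "strict_mono (r::nat\<Rightarrow>nat)" and f: "limitin (mtopology_of m) (g \<circ> \<sigma> \<circ> r) f sequentially"
      using sub[OF \<sigma>(1)] by blast
    have "f \<in> mtopology_of m derived_set_of T"
      unfolding in_derived_set_of
    proof (intro conjI allI impI)
      show "f \<in> topspace (mtopology_of m)" using f by (rule limitin_topspace)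
      fix V assume "f \<in> V \<and> openin (mtopology_of m) V"
      then obtain N where N: "\<And>n. n \<ge> N \<Longrightarrow> g (\<sigma> (r n)) \<in> V"
        using f unfolding limitin_sequentially by auto
      \<comment> \<open>Two distinct members of \<open>T\<close> in the same neighbourhood: at least
        one of them differs from the limit.\<close>
      have "\<sigma> (r N) \<noteq> \<sigma> (r (Suc N))"
        using \<sigma>(1) r by (metis n_not_Suc_n strict_mono_eq)
      then have "g (\<sigma> (r N)) \<noteq> g (\<sigma> (r (Suc N)))" using U(1) \<sigma>(2) by (meson inj_onD)
      moreover have "g (\<sigma> (r N)) \<in> T" "g (\<sigma> (r (Suc N))) \<in> T" using U(2) \<sigma>(2) by auto
      moreover have "g (\<sigma> (r N)) \<in> V" "g (\<sigma> (r (Suc N))) \<in> V" using N by auto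
      ultimately show "\<exists>y. y \<noteq> f \<and> y \<in> T \<and> y \<in> V" by metis
    qed
    then show "mtopology derived_set_of T \<noteq> {}" by (auto simp: mtopology_of_def)
  qed
qed

text \<open>The noise read in the coordinates orthogonal to the drift. A zero row at
  \<open>i0\<close> keeps the (d-1)-dimensional problem among d by d matrices, matching
  \<open>Sigma_perp\<close>.\<close>

definition perp_rows :: "('d \<Rightarrow> real^'d) \<Rightarrow> 'd \<Rightarrow> real^'d^'d \<Rightarrow> real^'d^'d" where
  "perp_rows e i0 S = (\<chi> i. if i = i0 then 0 else S *v e i)"

definition mean_path :: "'d \<Rightarrow> real \<Rightarrow> real \<Rightarrow> real^'d" where
  "mean_path i0 c t = (\<chi> i. if i = i0 then c * t else 0)"

lemma perp_rows_mult: "transpose S = S \<Longrightarrow> (perp_rows e i0 S *v x) $ i = (if i = i0 then 0 else e i \<bullet> (S *v x))"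
  for S :: "real^'d^'d"
  by (simp add: perp_rows_def matrix_vector_mul_component symmetric_inner_swap)

lemma perp_rows_gram:
  fixes S :: "real^'d^'d"
  assumes "transpose S = S" "S ** S = \<Sigma>"
  shows "perp_rows e i0 S ** transpose (perp_rows e i0 S) = Sigma_perp e i0 \<Sigma>"
proof -
  have "(perp_rows e i0 S ** transpose (perp_rows e i0 S)) $ i $ j = perp_rows e i0 S $ i \<bullet> perp_rows e i0 S $ j" for i j
    by (simp add: matrix_matrix_mult_def transpose_def inner_vec_def)
  moreover have "(S *v x) \<bullet> (S *v y) = x \<bullet> (\<Sigma> *v y)" for x y
    by (simp add: assms(2)[symmetric] symmetric_inner_swap[OF assms(1), of x] flip: matrix_vector_mul_assoc)
  ultimately show ?thesis by (simp add: vec_eq_iff Sigma_perp_def) (simp add: perp_rows_def)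
qed

lemma psd_gram: "psd_matrix (A ** transpose A)" for A :: "real^'d^'d"
proof -
  have "x \<bullet> ((A ** transpose A) *v x) = (transpose A *v x) \<bullet> (transpose A *v x)" for x
    by (metis dot_lmul_matrix matrix_vector_mul_assoc transpose_matrix_vector)
  then show ?thesis by (simp add: psd_matrix_def matrix_transpose_mul)
qed

text \<open>\<open>A\<close> and the root T of \<open>Sigma_perp\<close> have the same Gram matrix,
  so the contractions of the polar decomposition exchange their images of the energy ball. In
  dimension one \<open>A\<close> is zero and only the drift remains.\<close>

lemma W_set_eq:
  fixes e :: "'d \<Rightarrow> real^'d" and i0 :: 'd and \<Sigma> :: "real^'d^'d"
  assumes S: "psd_matrix \<Sigma>"
  defines "A \<equiv> perp_rows e i0 (matrix_sqrt \<Sigma>)"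
  shows "W_set e i0 \<mu> \<Sigma> = {restrict (\<lambda>t. mean_path i0 (norm \<mu>) t + A *v f t) {0..1} | f. finite_energy f}"
proof -
  have sym: "transpose (matrix_sqrt \<Sigma>) = matrix_sqrt \<Sigma>" using matrix_sqrt(1)[OF S] by (simp add: psd_matrix_def)
  have gram: "A ** transpose A = Sigma_perp e i0 \<Sigma>"
    unfolding A_def by (rule perp_rows_gram[OF sym matrix_sqrt(2)[OF S]])
  show ?thesis
  proof (cases "CARD('d) = 1")
    case True
    then have all: "i = i0" for i :: 'd by (metis card_1_singletonE iso_tuple_UNIV_I singletonD)
    have A0: "A *v x = 0" for x
      by (simp add: vec_eq_iff A_def perp_rows_mult[OF sym] all)
    have "finite_energy (\<lambda>t. 0 :: real^'d)"
      by (simp add: finite_energy_def denergy_def dinc_def)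
    then show ?thesis using True by (auto simp: W_set_def A0 mean_path_def)
  next
    case False
    define T where "T = matrix_sqrt (Sigma_perp e i0 \<Sigma>)"
    have T: "psd_matrix T" "T ** T = A ** transpose A"
      unfolding T_def gram by (rule matrix_sqrt; metis gram psd_gram)+
    obtain Q R where QR: "\<And>x. T *v (Q *v x) = A *v x" "\<And>x. A *v (R *v x) = T *v x"
      "\<And>x. norm (Q *v x) \<le> norm x" "\<And>x. norm (R *v x) \<le> norm x"
      using contraction_factor[OF T] by blast
    \<comment> \<open>Members of \<open>U_perp\<close> have coordinate \<open>i0\<close> equal to 0,
      which \<open>Q\<close> need not respect. Projecting it away is a contraction and does not
      change the image, because T annihilates the basis vector \<open>axis i0 1\<close>.\<close>
    define P :: "real^'d \<Rightarrow> real^'d" where "P x = x - (x $ i0) *\<^sub>R axis i0 1" for x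
    have P0: "P x $ i0 = 0" for x by (simp add: P_def)
    have linP: "linear P" by (intro linearI) (simp_all add: P_def algebra_simps)
    have nP: "norm (P x) \<le> norm x" for x
      by (rule norm_le_componentwise_cart) (simp add: P_def axis_def)
    have symT: "transpose T = T" using T(1) by (simp add: psd_matrix_def)
    have "(T *v axis i0 1) \<bullet> (T *v axis i0 1) = axis i0 1 \<bullet> ((T ** T) *v axis i0 1)"
      by (simp add: symmetric_inner_swap[OF symT, of "axis i0 1"] flip: matrix_vector_mul_assoc)
    also have "\<dots> = 0"
      by (simp add: T(2) gram inner_axis' matrix_vector_mult_basis column_def Sigma_perp_def)
    finally have T0: "T *v axis i0 1 = 0" by simp
    have TP: "T *v P x = T *v x" for x
      by (simp add: P_def linear_diff[OF matrix_vector_mul_linear] matrix_vector_mult_scaleR T0)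
    have "{restrict (\<lambda>t. mean_path i0 (norm \<mu>) t + T *v f t) {0..1} | f. f \<in> U_perp i0}
       = {restrict (\<lambda>t. mean_path i0 (norm \<mu>) t + A *v f t) {0..1} | f. finite_energy f}" (is "?L = ?R")
    proof (intro subset_antisym subsetI; elim CollectE exE conjE)
      fix h f assume h: "h = restrict (\<lambda>t. mean_path i0 (norm \<mu>) t + T *v f t) {0..1}" and f: "f \<in> U_perp i0"
      have "finite_energy (\<lambda>t. R *v f t)"
        by (rule finite_energy_contraction[OF U_perp_imp_finite_energy[OF f] matrix_vector_mul_linear QR(4)])
      then show "h \<in> ?R"
        unfolding h by (intro CollectI exI[of _ "\<lambda>t. R *v f t"]) (simp add: QR(2))
    next
      fix h f assume h: "h = restrict (\<lambda>t. mean_path i0 (norm \<mu>) t + A *v f t) {0..1}" and f: "finite_energy f"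
      have "finite_energy (\<lambda>t. P (Q *v f t))"
        by (intro finite_energy_contraction[OF _ linP nP] finite_energy_contraction[OF f matrix_vector_mul_linear QR(3)])
      then have "(\<lambda>t. P (Q *v f t)) \<in> U_perp i0" by (rule finite_energy_imp_U_perp) (rule P0)
      then show "h \<in> ?L"
        unfolding h by (intro CollectI exI[of _ "\<lambda>t. P (Q *v f t)"]) (simp add: TP QR(1))
    qed
    then show ?thesis using False by (simp add: W_set_def T_def mean_path_def)
  qed
qed

text \<open>A countable intersection of almost sure events: rational functions on a finite index
  set, extensional outside it, form a countable set.\<close>

lemma (in std_bm) AE_strassen_path: "AE \<omega> in M. strassen_path (\<lambda>t. B t \<omega>)"
proof -
  have 1: "AE \<omega> in M. continuous_on {0..} (\<lambda>t. B t \<omega>)" and 2: "AE \<omega> in M. B 0 \<omega> = 0"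
    using BM by (simp_all add: std_brownian_motion_def)
  have 3: "AE \<omega> in M. \<forall>l p q. \<forall>\<^sub>F k in sequentially.
      (\<Sum>j<2^l. (norm (B (real (Suc j) * ((1 + 1 / real (Suc q))^k / 2^l)) \<omega> - B (real j * ((1 + 1 / real (Suc q))^k / 2^l)) \<omega>))\<^sup>2)
        < (1 + 1 / real (Suc p))\<^sup>2 * (LL ((1 + 1 / real (Suc q))^k))\<^sup>2 / 2^l"
    unfolding AE_all_countable by (intro allI dyadic_energy_small) simp_all
  have cw: "countable (({1..<(2::nat)^l} \<times> (UNIV::'d set)) \<rightarrow>\<^sub>E (\<rat>::real set))" for l
    by (intro countable_PiE) (auto simp: countable_rat)
  have 4: "AE \<omega> in M. \<forall>l p. \<forall>w\<in>(({1..<2^l} \<times> UNIV) \<rightarrow>\<^sub>E \<rat>). 1 \<le> l \<longrightarrow>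
      2 ^ l * (\<Sum>j\<in>{1..<2^l}. \<Sum>i\<in>UNIV. (w (j, i))\<^sup>2) \<le> 1 \<longrightarrow>
      (\<exists>\<^sub>\<infinity>q. \<forall>j\<in>{1..<2^l}. \<forall>i::'d.
       \<bar>(B (real (Suc j) * 2^(l*q)) \<omega> - B (real j * 2^(l*q)) \<omega>) $ i - LL (2^(l * Suc q)) * w (j, i)\<bar> \<le> 1 / real (Suc p) * LL (2^(l * Suc q)))"
    (is "AE \<omega> in M. \<forall>l p. \<forall>w\<in>_. ?l l \<longrightarrow> ?w l w \<longrightarrow> ?f l p w \<omega>")
    unfolding AE_all_countable AE_ball_countable[OF cw]
  proof (intro allI ballI)
    fix l p :: nat and w :: "nat \<times> 'd \<Rightarrow> real"
    show "AE \<omega> in M. ?l l \<longrightarrow> ?w l w \<longrightarrow> ?f l p w \<omega>"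
    proof (cases "?l l \<and> ?w l w")
      case True
      then have "AE \<omega> in M. ?f l p w \<omega>" by (intro increments_follow_infinitely_often) auto
      then show ?thesis by eventually_elim blast
    next
      case False
      then show ?thesis by (intro AE_I2) blast
    qed
  qed
  show ?thesis
    using 1 2 3 4 dyadic_increments_small
    by eventually_elim (rule strassen_path.intro; simp only: Ball_def)
qed

lemma ell_eq_LL: "n \<ge> 3 \<Longrightarrow> ell n = LL (real n)"
  by (simp add: ell_def LL_def)

lemma LL_over_self_tendsto: "(\<lambda>n. LL (real n) / real n) \<longlonglongrightarrow> 0"
  unfolding LL_def by real_asymp

section \<open>Transfer to the process with drift\<close>

context strassen_path
begin

context
  fixes \<mu> :: "real^'d" and S :: "real^'d^'d" and e :: "'d \<Rightarrow> real^'d" and i0 :: 'd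
  assumes mu: "\<mu> \<noteq> 0" and sym: "transpose S = S"
    and onb: "\<forall>i j. e i \<bullet> e j = (if i = j then 1 else 0)"
    and e1: "e i0 = \<mu> /\<^sub>R norm \<mu>"
begin

definition rescaled :: "nat \<Rightarrow> real \<Rightarrow> real^'d" where
  "rescaled n = restrict (\<lambda>t. psi i0 n (coords e ((real n * t) *\<^sub>R \<mu> + S *v b (real n * t)))) {0..1}"

definition limit_path :: "(real \<Rightarrow> real^'d) \<Rightarrow> real \<Rightarrow> real^'d" where
  "limit_path f = restrict (\<lambda>t. mean_path i0 (norm \<mu>) t + perp_rows e i0 S *v f t) {0..1}"

lemma drift_coords: "\<mu> \<bullet> e i = (if i = i0 then norm \<mu> else 0)"
proof -
  have m: "\<mu> = norm \<mu> *\<^sub>R e i0" using mu by (simp add: e1)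
  then have "\<mu> \<bullet> e i = norm \<mu> * (e i0 \<bullet> e i)" by (metis inner_scaleR_left)
  then show ?thesis using onb by auto
qed

lemma rescaled_component:
  assumes "t \<in> {0..1}"
  shows "rescaled n t $ i = (if i = i0 then (real n * t * norm \<mu> + e i0 \<bullet> (S *v b (real n * t))) / real n
     else (e i \<bullet> (S *v b (real n * t))) / ell n)"
  using assms by (simp add: rescaled_def psi_def coords_def inner_add_left drift_coords inner_commute[of "S *v _"])

lemma rescaled_in_C0: "rescaled n \<in> mspace C0"
proof -
  have bc: "continuous_on {0..1} (\<lambda>t. e i \<bullet> (S *v b (real n * t)))" for i
    by (intro continuous_intros linear_continuous_on_compose[OF _ matrix_vector_mul_linear] continuous_on_compose2[OF cont]) auto
  have "continuous_on {0..1} (\<lambda>t. rescaled n t $ i)" for i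
  proof (cases "i = i0")
    case True
    have "continuous_on {0..1} (\<lambda>t. (real n * t * norm \<mu> + e i0 \<bullet> (S *v b (real n * t))) * inverse (real n))"
      by (intro continuous_intros bc)
    then show ?thesis
      by (rule continuous_on_eq) (simp add: True rescaled_component divide_inverse)
  next
    case False
    have "continuous_on {0..1} (\<lambda>t. (e i \<bullet> (S *v b (real n * t))) * inverse (ell n))"
      by (intro continuous_intros bc)
    then show ?thesis
      by (rule continuous_on_eq) (simp add: False rescaled_component divide_inverse)
  qed
  then have "continuous_on {0..1} (\<lambda>t. \<chi> i. rescaled n t $ i)" by (rule continuous_on_vec_lambda)
  then have "continuous_on {0..1} (rescaled n)" by simp
  moreover have "rescaled n 0 = 0"
    by (simp add: vec_eq_iff rescaled_component b0)
  ultimately show ?thesis by (simp add: mspace_C0 rescaled_def)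
qed

lemma limit_path_in_C0:
  assumes "finite_energy f" shows "limit_path f \<in> mspace C0"
proof -
  have f: "continuous_on {0..1} f" "f 0 = 0" using assms by (auto simp: finite_energy_def)
  have "continuous_on {0..1} (\<lambda>t. mean_path i0 (norm \<mu>) t)"
    unfolding mean_path_def
  proof (rule continuous_on_vec_lambda)
    show "continuous_on {0..1} (\<lambda>t. if i = i0 then norm \<mu> * t else 0)" for i
      by (cases "i = i0") (auto intro!: continuous_intros)
  qed
  then have "continuous_on {0..1} (\<lambda>t. mean_path i0 (norm \<mu>) t + perp_rows e i0 S *v f t)"
    by (intro continuous_intros linear_continuous_on_compose[OF f(1) matrix_vector_mul_linear])
  then have "continuous_on {0..1} (limit_path f)"
    by (rule continuous_on_eq) (simp add: limit_path_def)
  moreover have "limit_path f 0 = 0"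
    by (simp add: limit_path_def f mean_path_def vec_eq_iff)
  ultimately show ?thesis by (simp add: mspace_C0 limit_path_def)
qed

text \<open>Orthogonally to the drift, \<open>rescaled\<close> is exactly the linear image of the
  scaled path, as \<open>ell\<close> and \<open>LL\<close> agree from 3 on. Along the drift the
  noise is divided by n instead, which leaves the factor LL n / n times a quantity bounded through
  126.\<close>

lemma rescaled_close:
  assumes n: "n \<ge> 3" "LL (real n) > 0" and t: "t \<in> {0..1}" and e126: "norm (scaled_path b (real n) t) \<le> 126"
  shows "norm (rescaled n t - limit_path f t) \<le>
     norm (perp_rows e i0 S *v (scaled_path b (real n) t - f t)) + 126 * norm (S *v e i0) * (LL (real n) / real n)"
proof -
  let ?p = "scaled_path b (real n) t" and ?A = "perp_rows e i0 S"
  have bp: "b (real n * t) = LL (real n) *\<^sub>R ?p" using n(2) by (simp add: scaled_path_def)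
  have "rescaled n t - limit_path f t = ?A *v (?p - f t) + ((LL (real n) / real n) * ((S *v e i0) \<bullet> ?p)) *\<^sub>R axis i0 1"
  proof (rule vec_eq_iff[THEN iffD2], intro allI)
    fix i
    show "(rescaled n t - limit_path f t) $ i = (?A *v (?p - f t) + ((LL (real n) / real n) * ((S *v e i0) \<bullet> ?p)) *\<^sub>R axis i0 1) $ i"
    proof (cases "i = i0")
      case True
      have "rescaled n t $ i = t * norm \<mu> + LL (real n) * ((S *v e i0) \<bullet> ?p) / real n"
        using n(1) True by (simp add: rescaled_component[OF t] bp matrix_vector_mult_scaleR symmetric_inner_swap[OF sym] add_divide_distrib)
      then show ?thesis using t True
        by (simp add: limit_path_def mean_path_def perp_rows_mult[OF sym] mult.commute)
    next
      case False
      have "rescaled n t $ i = e i \<bullet> (S *v ?p)"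
        using n False by (simp add: rescaled_component[OF t] bp matrix_vector_mult_scaleR ell_eq_LL)
      then show ?thesis using t False
        by (simp add: limit_path_def mean_path_def perp_rows_mult[OF sym] axis_def
            linear_diff[OF matrix_vector_mul_linear] inner_diff_right)
    qed
  qed
  also have "norm \<dots> \<le> norm (?A *v (?p - f t)) + \<bar>(LL (real n) / real n) * ((S *v e i0) \<bullet> ?p)\<bar>"
    by (rule order.trans[OF norm_triangle_ineq]) (simp add: norm_axis_1)
  also have "\<bar>(LL (real n) / real n) * ((S *v e i0) \<bullet> ?p)\<bar> \<le> (LL (real n) / real n) * (norm (S *v e i0) * 126)"
  proof -
    have "\<bar>(S *v e i0) \<bullet> ?p\<bar> \<le> norm (S *v e i0) * norm ?p" by (rule Cauchy_Schwarz_ineq2)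
    also have "\<dots> \<le> norm (S *v e i0) * 126" using e126 by (intro mult_left_mono) auto
    finally show ?thesis using n by (simp add: abs_mult divide_right_mono mult_left_mono)
  qed
  finally show ?thesis by (simp add: mult_ac)
qed

text \<open>The common device for relative compactness and for both inclusions: uniform convergence
  of scaled paths along \<open>s\<close> carries over to the rescaled process.\<close>

lemma rescaled_converges:
  assumes s: "filterlim s at_top sequentially" and f: "finite_energy f"
    and conv: "\<And>\<epsilon>. \<epsilon> > 0 \<Longrightarrow> \<exists>N. \<forall>n\<ge>N. \<forall>t\<in>{0..1}. norm (scaled_path b (real (s n)) t - f t) \<le> \<epsilon>"
  shows "limitin (mtopology_of C0) (\<lambda>n. rescaled (s n)) (limit_path f) sequentially"
  unfolding limitin_C0[OF rescaled_in_C0]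
proof (intro conjI limit_path_in_C0[OF f] allI impI)
  fix \<epsilon> :: real assume \<epsilon>: "\<epsilon> > 0"
  let ?A = "perp_rows e i0 S"
  obtain K where K: "K > 0" "\<And>x. norm (?A *v x) \<le> norm x * K"
    using bounded_linear.pos_bounded[OF matrix_vector_mul_bounded_linear[of ?A]] by blast
  obtain N1 where N1: "\<forall>n\<ge>N1. \<forall>t\<in>{0..1}. norm (scaled_path b (real (s n)) t - f t) \<le> \<epsilon> / (2 * K)"
    using conv[of "\<epsilon> / (2 * K)"] \<epsilon> K by auto
  have "(\<lambda>n. 126 * norm (S *v e i0) * (LL (real (s n)) / real (s n))) \<longlonglongrightarrow> 126 * norm (S *v e i0) * 0"
    by (intro tendsto_intros filterlim_compose[OF LL_over_self_tendsto s])
  from order_tendstoD(2)[OF this, of "\<epsilon> / 2"]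
  have ev1: "\<forall>\<^sub>F n in sequentially. 126 * norm (S *v e i0) * (LL (real (s n)) / real (s n)) < \<epsilon> / 2" using \<epsilon> by simp
  have "\<forall>\<^sub>F n in sequentially. max 3 (nat \<lceil>threshold\<rceil>) \<le> s n" using s by (simp only: filterlim_at_top)
  with ev1 eventually_ge_at_top[of N1]
  have "\<forall>\<^sub>F n in sequentially. \<forall>t\<in>{0..1}. norm (rescaled (s n) t - limit_path f t) \<le> \<epsilon>"
  proof eventually_elim
    fix n assume h: "126 * norm (S *v e i0) * (LL (real (s n)) / real (s n)) < \<epsilon> / 2" "N1 \<le> n" "max 3 (nat \<lceil>threshold\<rceil>) \<le> s n"
    then have n: "3 \<le> s n" "threshold \<le> real (s n)" by linarith+
    show "\<forall>t\<in>{0..1}. norm (rescaled (s n) t - limit_path f t) \<le> \<epsilon>"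
    proof
      fix t :: real assume t: "t \<in> {0..1}"
      have "LL (real (s n)) > 0" using n threshold_ge by (intro LL_pos) linarith
      from rescaled_close[OF n(1) this t scaled_path_bounded[OF n(2) t]]
      have "norm (rescaled (s n) t - limit_path f t) \<le>
        norm (?A *v (scaled_path b (real (s n)) t - f t)) + 126 * norm (S *v e i0) * (LL (real (s n)) / real (s n))" .
      also have "\<dots> \<le> \<epsilon> / (2 * K) * K + \<epsilon> / 2"
        using N1 h(1,2) t K(1) by (intro add_mono order.trans[OF K(2)] mult_right_mono) auto
      finally show "norm (rescaled (s n) t - limit_path f t) \<le> \<epsilon>" using K(1) by simp
    qed
  qed
  then show "\<exists>N. \<forall>n\<ge>N. \<forall>t\<in>{0..1}. norm (rescaled (s n) t - limit_path f t) \<le> \<epsilon>"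
    by (simp only: eventually_sequentially)
qed

lemma rescaled_subsequence:
  assumes \<sigma>: "strict_mono (\<sigma> :: nat \<Rightarrow> nat)"
  shows "\<exists>r f. strict_mono (r :: nat \<Rightarrow> nat) \<and> finite_energy f \<and> limitin (mtopology_of C0) (rescaled \<circ> \<sigma> \<circ> r) (limit_path f) sequentially"
proof -
  have s: "filterlim \<sigma> at_top sequentially" by (rule filterlim_subseq[OF \<sigma>])
  have "filterlim (\<lambda>n. real (\<sigma> n)) at_top sequentially"
    by (rule filterlim_compose[OF filterlim_real_sequentially s])
  from subsequence_converges[OF this] obtain f r where f: "finite_energy f" and r: "strict_mono (r :: nat \<Rightarrow> nat)"
    and c: "\<And>e. e > 0 \<Longrightarrow> \<exists>N. \<forall>n\<ge>N. \<forall>t\<in>{0..1}. norm (scaled_path b (real (\<sigma> (r n))) t - f t) < e"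
    by metis
  have "limitin (mtopology_of C0) (\<lambda>n. rescaled (\<sigma> (r n))) (limit_path f) sequentially"
  proof (rule rescaled_converges[OF _ f])
    show "filterlim (\<lambda>n. \<sigma> (r n)) at_top sequentially"
      by (rule filterlim_compose[OF s filterlim_subseq[OF r]])
    show "\<exists>N. \<forall>n\<ge>N. \<forall>t\<in>{0..1}. norm (scaled_path b (real (\<sigma> (r n))) t - f t) \<le> \<epsilon>" if "\<epsilon> > 0" for \<epsilon>
      using c[OF that] less_imp_le by meson
  qed
  then show ?thesis using r f by (auto simp: o_def)
qed

lemma rescaled_relatively_compact: "relatively_compact_in C0 (range rescaled)"
proof (rule relatively_compact_inI_subsequence)
  show "range rescaled \<subseteq> mspace C0" using rescaled_in_C0 by auto
qed (use rescaled_subsequence in blast)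

text \<open>A convergent subsequence has a further subsequence tending to some
  \<open>limit_path f\<close>, and limits are unique. Conversely, approximations at arbitrarily late
  indices are strung into a strictly increasing sequence with errors 1/(n+1).\<close>

lemma rescaled_limit_points: "seq_limit_points C0 rescaled = {limit_path f | f. finite_energy f}"
proof (intro subset_antisym subsetI)
  fix h assume "h \<in> seq_limit_points C0 rescaled"
  then obtain \<sigma> where \<sigma>: "strict_mono (\<sigma> :: nat \<Rightarrow> nat)" and h: "limitin (mtopology_of C0) (rescaled \<circ> \<sigma>) h sequentially"
    by (auto simp: seq_limit_points_def)
  obtain r f where r: "strict_mono (r :: nat \<Rightarrow> nat)" and f: "finite_energy f"
    and lim: "limitin (mtopology_of C0) (rescaled \<circ> \<sigma> \<circ> r) (limit_path f) sequentially"
    using rescaled_subsequence[OF \<sigma>] by blast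
  have "limitin (mtopology_of C0) (rescaled \<circ> \<sigma> \<circ> r) h sequentially"
    by (rule limitin_subsequence[OF r h])
  moreover have "Hausdorff_space (mtopology_of C0)"
    unfolding mtopology_of_def by (rule Metric_space.Hausdorff_space_mtopology[OF Metric_space_mspace_mdist])
  ultimately have "h = limit_path f"
    using lim limitin_Hausdorff_unique[of "mtopology_of C0"] trivial_limit_sequentially by blast
  then show "h \<in> {limit_path f | f. finite_energy f}" using f by blast
next
  fix h assume "h \<in> {limit_path f | f. finite_energy f}"
  then obtain f where h: "h = limit_path f" and f: "finite_energy f" by blast
  have "\<exists>\<sigma>. strict_mono \<sigma> \<and> (\<forall>n. \<forall>t\<in>{0..1}. norm (scaled_path b (real (\<sigma> n)) t - f t) \<le> 1 / real (Suc n))"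
  proof -
    have "\<exists>\<sigma>. \<forall>n. (\<forall>t\<in>{0..1}. norm (scaled_path b (real (\<sigma> n)) t - f t) \<le> 1 / real (Suc n)) \<and> \<sigma> n < \<sigma> (Suc n)"
    proof (rule dependent_nat_choice)
      show "\<exists>x. \<forall>t\<in>{0..1}. norm (scaled_path b (real x) t - f t) \<le> 1 / real (Suc 0)"
        using approximates_infinitely_often[OF f, of "1 / real (Suc 0)" 0] by auto
      show "\<exists>y. (\<forall>t\<in>{0..1}. norm (scaled_path b (real y) t - f t) \<le> 1 / real (Suc (Suc n))) \<and> x < y" for x n
        using approximates_infinitely_often[OF f, of "1 / real (Suc (Suc n))" "Suc x"] Suc_le_eq by auto
    qed
    then show ?thesis by (auto simp: strict_mono_Suc_iff)
  qed
  then obtain \<sigma> where \<sigma>: "strict_mono \<sigma>" "\<And>n t. t \<in> {0..1} \<Longrightarrow> norm (scaled_path b (real (\<sigma> n)) t - f t) \<le> 1 / real (Suc n)"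
    by blast
  have "limitin (mtopology_of C0) (\<lambda>n. rescaled (\<sigma> n)) (limit_path f) sequentially"
  proof (rule rescaled_converges[OF filterlim_subseq[OF \<sigma>(1)] f])
    fix \<epsilon> :: real assume "\<epsilon> > 0"
    then obtain N where N: "1 / real (Suc N) < \<epsilon>" using nat_approx_posE by blast
    show "\<exists>N. \<forall>n\<ge>N. \<forall>t\<in>{0..1}. norm (scaled_path b (real (\<sigma> n)) t - f t) \<le> \<epsilon>"
    proof (intro exI[of _ N] allI impI ballI)
      fix n and t :: real assume "N \<le> n" "t \<in> {0..1}"
      then have "norm (scaled_path b (real (\<sigma> n)) t - f t) \<le> 1 / real (Suc n)" by (intro \<sigma>(2))
      also have "\<dots> \<le> 1 / real (Suc N)" using \<open>N \<le> n\<close> by (intro divide_left_mono) auto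
      finally show "norm (scaled_path b (real (\<sigma> n)) t - f t) \<le> \<epsilon>" using N by simp
    qed
  qed
  then show "h \<in> seq_limit_points C0 rescaled"
    using \<sigma>(1) limit_path_in_C0[OF f] unfolding seq_limit_points_def h by (auto simp: o_def)
qed

end

end

theorem theorem3p1:
  fixes M :: "'w measure" and B :: "real \<Rightarrow> 'w \<Rightarrow> real^'d"
    and \<mu> :: "real^'d" and \<Sigma> :: "real^'d^'d"
    and e :: "'d \<Rightarrow> real^'d" and i0 :: 'd
  assumes BM: "std_brownian_motion M B"
    and mu: "\<mu> \<noteq> 0"
    and Sigma: "psd_matrix \<Sigma>"
    and onb: "\<forall>i j. e i \<bullet> e j = (if i = j then 1 else 0)"
    and e1: "e i0 = \<mu> /\<^sub>R norm \<mu>"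
  shows "AE \<omega> in M.
    (let X = (\<lambda>t. t *\<^sub>R \<mu> + matrix_sqrt \<Sigma> *v B t \<omega>);
         g = (\<lambda>n. restrict (\<lambda>t. psi i0 n (coords e (X (real n * t)))) {0..1})
     in relatively_compact_in C0 (range g) \<and> seq_limit_points C0 g = W_set e i0 \<mu> \<Sigma>)"
proof -
  interpret std_bm M B by unfold_locales (rule BM)
  have sym: "transpose (matrix_sqrt \<Sigma>) = matrix_sqrt \<Sigma>"
    using matrix_sqrt(1)[OF Sigma] by (simp add: psd_matrix_def)
  show ?thesis
    using AE_strassen_path
  proof eventually_elim
    fix \<omega> assume "strassen_path (\<lambda>t. B t \<omega>)"
    then interpret strassen_path "\<lambda>t. B t \<omega>" .
    note rel = rescaled_relatively_compact[OF mu sym onb e1]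
      and pts = rescaled_limit_points[OF mu sym onb e1]
    show "let X = (\<lambda>t. t *\<^sub>R \<mu> + matrix_sqrt \<Sigma> *v B t \<omega>);
         g = (\<lambda>n. restrict (\<lambda>t. psi i0 n (coords e (X (real n * t)))) {0..1})
     in relatively_compact_in C0 (range g) \<and> seq_limit_points C0 g = W_set e i0 \<mu> \<Sigma>"
      unfolding Let_def W_set_eq[OF Sigma]
      using rel pts unfolding rescaled_def[OF mu sym onb e1, abs_def] limit_path_def[OF mu sym onb e1, abs_def]
      by simp
  qed
qed

end
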